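(* For every $\beta>0$ there exist initial data $u_0\in\mathcal{L}(1)$ such that the solution $u$ of the $\beta$-Szegő equation $$i\partial_t u=\Pi(|u|^2u)-\beta\,S\,\Pi\big(|S^\dagger u|^2S^\dagger u\big)$$ with $u(0)=u_0$ has exponentially growing Sobolev norms at late times: there is a constant $c>0$ such that for every $s>\tfrac12$, $$\|u(t)\|_{H^s}\simeq e^{(2s-1)c|t|}\qquad\text{as }t\to\infty .$$
   Context: $L^2_+(\mathbb{S}^1)$ is the closed subspace of $L^2(\mathbb{S}^1)$ of functions $u=\sum_{n\ge 0}\alpha_ne^{in\theta}$; such $u$ is identified with $u(z)=\sum_{n\ge0}\alpha_nz^n$. $H^s_+(\mathbb{S}^1)=H^s(\mathbb{S}^1)\cap L^2_+(\mathbb{S}^1)$, with $\|u\|_{H^s}^2=\sum_{n\ge0}(1+n)^{2s}|\alpha_n|^2$. $\Pi:L^2(\mathbb{S}^1)\to L^2_+(\mathbb{S}^1)$ is the Szegő projector (removing negative Fourier modes). $S$ is the shift $Sh=e^{i\theta}h$ on $L^2_+$, and $S^\dagger$ is its adjoint, $(S^\dagger h)_n=h_{n+1}$. The equation is globally well-posed in $H^s_+(\mathbb{S}^1)$ for $s>1/2$. $\mathcal{L}(1)$ is the set of rational functions $u(z)=A(z)/B(z)$ where $A,B$ are complex polynomials of degree at most $1$ with no common factors, $\deg A=1$ or $\deg B=1$, and $B$ has no zeros in the closed unit disk. $f(t)\simeq g(t)$ as $t\to\infty$ means that there are constants $0<m\le M<\infty$ (possibly depending on $s$, $\beta$ and $u_0$)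 and $T$ with $m\,g(t)\le f(t)\le M\,g(t)$ for all $t\ge T$. *)

theory Defs
  imports
    "HOL-Analysis.Analysis"
    "HOL-Computational_Algebra.Computational_Algebra"
begin

section \<open>Function spaces on the unit circle\<close>

text \<open>
  Elements of \<open>L\<^sup>2(S\<^sup>1)\<close> are given by representatives \<open>f :: complex \<Rightarrow> complex\<close>, of which only the
  values on the unit circle matter; equality of elements is equality almost everywhere with
  respect to normalised arc length.
\<close>

definition circle_measure :: "complex measure" where
  "circle_measure =
     distr (uniform_measure lborel {0..2 * pi}) (restrict_space borel (sphere 0 1)) cis"

definition L2_circle :: "(complex \<Rightarrow> complex) set" where
  "L2_circle = {f. f \<in> borel_measurable circle_measure \<and>
                   integrable circle_measure (\<lambda>z. (cmod (f z))\<^sup>2)}"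

text \<open>On the circle \<open>z powi (- n)\<close> is \<open>e\<^bsup>-i n \<theta>\<^esup>\<close>.\<close>

definition fourier_coeff :: "(complex \<Rightarrow> complex) \<Rightarrow> int \<Rightarrow> complex" where
  "fourier_coeff f n = (LINT z|circle_measure. f z * z powi (- n))"

definition L2_plus :: "(complex \<Rightarrow> complex) set" where
  "L2_plus = {f \<in> L2_circle. \<exists>\<alpha> :: nat \<Rightarrow> complex.
     (\<lambda>N. LINT z|circle_measure. (cmod (f z - (\<Sum>n<N. \<alpha> n * z ^ n)))\<^sup>2) \<longlonglongrightarrow> 0}"

definition sobolev :: "real \<Rightarrow> (complex \<Rightarrow> complex) set" where
  "sobolev s = {f \<in> L2_circle.
     (\<lambda>n :: int. (1 + \<bar>real_of_int n\<bar>) powr (2 * s) * (cmod (fourier_coeff f n))\<^sup>2) summable_on UNIV}"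

definition sobolev_plus :: "real \<Rightarrow> (complex \<Rightarrow> complex) set" where
  "sobolev_plus s = sobolev s \<inter> L2_plus"

definition sobolev_norm :: "real \<Rightarrow> (complex \<Rightarrow> complex) \<Rightarrow> real" where
  "sobolev_norm s f =
     sqrt (\<Sum>n. (1 + real n) powr (2 * s) * (cmod (fourier_coeff f (int n)))\<^sup>2)"


section \<open>The Szego projector and the shift\<close>

text \<open>
  A representative of the element of \<open>L\<^sup>2\<^sub>+\<close> with Fourier coefficients \<open>\<alpha>\<close>. For square-summable \<open>\<alpha>\<close>
  it exists by Riesz-Fischer and is unique up to null sets; only its class is ever used.
\<close>

definition hardy_series :: "(nat \<Rightarrow> complex) \<Rightarrow> complex \<Rightarrow> complex" where
  "hardy_series \<alpha> = (SOME g. g \<in> L2_plus \<and> (\<forall>n. fourier_coeff g (int n) = \<alpha> n))"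

definition szego_projector :: "(complex \<Rightarrow> complex) \<Rightarrow> complex \<Rightarrow> complex" where
  "szego_projector f = hardy_series (\<lambda>n. fourier_coeff f (int n))"

definition shift :: "(complex \<Rightarrow> complex) \<Rightarrow> complex \<Rightarrow> complex" where
  "shift h = (\<lambda>z. z * h z)"

definition shift_adjoint :: "(complex \<Rightarrow> complex) \<Rightarrow> complex \<Rightarrow> complex" where
  "shift_adjoint h = hardy_series (\<lambda>n. fourier_coeff h (int (n + 1)))"

definition cubic :: "(complex \<Rightarrow> complex) \<Rightarrow> complex \<Rightarrow> complex" where
  "cubic f = (\<lambda>z. complex_of_real ((cmod (f z))\<^sup>2) * f z)"


section \<open>The equation\<close>

definition has_sobolev_derivative ::
  "real \<Rightarrow> (real \<Rightarrow> complex \<Rightarrow> complex) \<Rightarrow> (complex \<Rightarrow> complex) \<Rightarrow> real \<Rightarrow> bool" where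
  "has_sobolev_derivative s u v t \<longleftrightarrow> v \<in> sobolev_plus s \<and>
     ((\<lambda>h. sobolev_norm s (\<lambda>z. (u (t + h) z - u t z) / complex_of_real h - v z)) \<longlongrightarrow> 0) (at 0)"

text \<open>
  Global strong solutions in \<open>H\<^sup>s\<^sub>+\<close>. For \<open>s > 1/2\<close> the nonlinearity maps \<open>H\<^sup>s\<^sub>+\<close> continuously to itself,
  so a differentiable curve satisfying the equation is automatically \<open>C\<^sup>1\<close> in time.
\<close>

definition beta_szego_solution ::
  "real \<Rightarrow> real \<Rightarrow> (complex \<Rightarrow> complex) \<Rightarrow> (real \<Rightarrow> complex \<Rightarrow> complex) \<Rightarrow> bool" where
  "beta_szego_solution s \<beta> u0 u \<longleftrightarrow>
     (\<forall>t. u t \<in> sobolev_plus s) \<and>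
     (AE z in circle_measure. u 0 z = u0 z) \<and>
     (\<forall>t. \<exists>v. has_sobolev_derivative s u v t \<and>
        (AE z in circle_measure.
           \<i> * v z = szego_projector (cubic (u t)) z
             - complex_of_real \<beta> * shift (szego_projector (cubic (shift_adjoint (u t)))) z))"


section \<open>Rational data and asymptotic comparability\<close>

definition rational_L1 :: "(complex \<Rightarrow> complex) set" where
  "rational_L1 = {u. \<exists>A B :: complex poly.
     degree A \<le> 1 \<and> degree B \<le> 1 \<and> coprime A B \<and> (degree A = 1 \<or> degree B = 1) \<and>
     (\<forall>z. cmod z \<le> 1 \<longrightarrow> poly B z \<noteq> 0) \<and> u = (\<lambda>z. poly A z / poly B z)}"

definition comparable_at_top :: "(real \<Rightarrow> real) \<Rightarrow> (real \<Rightarrow> real) \<Rightarrow> bool" where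
  "comparable_at_top f g \<longleftrightarrow>
     (\<exists>m M T. 0 < m \<and> m \<le> M \<and> (\<forall>t\<ge>T. m * g t \<le> f t \<and> f t \<le> M * g t))"

end

(* On data u = b + c z / (1 - p z) the equation reduces to an ODE for (b, c, p), and every quantity in it
   is a function of the gap 1 - |p|^2 once |b|^2 + |c|^2 / (1 - |p|^2) (mass) and
   |c|^2 / (1 - |p|^2)^2 (momentum) are fixed. Normalising the momentum to 1, taking the mass equal
   to 1 + beta and the energy on the level set where the gap is allowed to reach 0, the inverse gap r satisfies
   r'^2 = beta (4 r^2 - 6 r + 2 - beta / 4), so r = 3/4 + sqrt (1 + beta) / 4 * cosh (2 sqrt beta t),
   and the square of the H^s norm is comparable to r^(2 s - 1).
   Any other solution agrees with this one for t >= 0: the nonlinearity is Lipschitz in L^2 on bounded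
   sets of absolutely convergent Fourier series, and Gronwall's inequality applies. *)
theory Submission
  imports Defs "HOL-Probability.Probability_Measure"
begin

section \<open>The circle as a probability space\<close>

text \<open>No existence theorem for the ODE is used. The gap leaves the separate phases of
  \<open>b\<close>, \<open>c\<close>, \<open>p\<close> open but fixes
  \<open>X = cnj b * c * cnj p\<close>: Im X is half the derivative of |p|^2, Re X comes from the
  energy, and |X|^2 = |b|^2 |c|^2 |p|^2 is then the first-order equation for \<open>r\<close>. So
  the orbit is written down backwards from \<open>r\<close>, with two integrations for the phases of
  \<open>p\<close> and \<open>c\<close>, and only its derivatives are verified. Origin of the mass:
  with unit momentum and mass M, the chosen energy level says 4 Re X = - 2 (M + 1 - \<beta>) / r +
  (4 - \<beta>) / r^2, so r'^2 has leading coefficient 4 M - (M + 1 - \<beta>)^2. It is largest at M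
  = 1 + \<beta>, where it equals 4 \<beta>, positive for every \<beta> > 0. The growth is asserted
  for every solution with the given data, in whichever H^s it lives, and functions are fixed only up
  to null sets. Hence everything passes through Fourier coefficients in l1, a space that contains
  the coefficients of all H^s with s > 1/2.\<close>

lemma space_circle_measure [simp]: "space circle_measure = sphere 0 1"
  by (simp add: circle_measure_def space_restrict_space)

lemma sets_circle_measure [measurable_cong, simp]:
  "sets circle_measure = sets (restrict_space borel (sphere 0 1))"
  by (simp add: circle_measure_def)

lemma cis_measurable_circle:
  "cis \<in> uniform_measure lborel {0..2 * pi} \<rightarrow>\<^sub>M restrict_space borel (sphere 0 1)"
proof (rule measurable_restrict_space2)
  have "cis \<in> borel_measurable borel"
    by (intro borel_measurable_continuous_onI continuous_intros)
  then show "cis \<in> borel_measurable (uniform_measure lborel {0..2 * pi})"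
    by (simp add: measurable_def)
qed auto

lemma prob_space_circle_measure: "prob_space circle_measure"
  unfolding circle_measure_def
  by (intro prob_space.prob_space_distr prob_space_uniform_measure cis_measurable_circle) auto

interpretation circle: prob_space circle_measure
  by (rule prob_space_circle_measure)

lemma continuous_measurable_circle:
  fixes f :: "complex \<Rightarrow> 'b::topological_space"
  assumes "continuous_on (sphere 0 1) f"
  shows "f \<in> borel_measurable circle_measure"
  using borel_measurable_continuous_on_restrict[OF assms]
  by (simp cong: measurable_cong_sets)

lemma power_measurable_circle [measurable]: "(\<lambda>z. z ^ n) \<in> borel_measurable circle_measure"
  by (intro continuous_measurable_circle continuous_intros)

lemma powi_measurable_circle [measurable]: "(\<lambda>z. z powi n) \<in> borel_measurable circle_measure"
  by (rule continuous_measurable_circle) (auto intro!: continuous_intros)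

lemma ident_measurable_circle [measurable]: "(\<lambda>z. z) \<in> borel_measurable circle_measure"
  by (rule continuous_measurable_circle) (auto intro!: continuous_intros)

lemma integrable_circle_bounded:
  fixes f :: "complex \<Rightarrow> 'b::{banach, second_countable_topology}"
  assumes "f \<in> borel_measurable circle_measure" "\<And>z. cmod z = 1 \<Longrightarrow> norm (f z) \<le> B"
  shows "integrable circle_measure f"
  using assms by (intro circle.integrable_const_bound[where B = B] AE_I2) auto

lemma integral_circle_measure:
  fixes f :: "complex \<Rightarrow> complex"
  assumes "f \<in> borel_measurable circle_measure"
  shows "(LINT z|circle_measure. f z) = (LINT t:{0..2 * pi}|lborel. f (cis t)) / (2 * pi)"
proof -
  have "uniform_measure lborel {0..2 * pi} = density lborel (\<lambda>t. ennreal (indicator {0..2 * pi} t / (2 * pi)))"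
    unfolding uniform_measure_def
    by (intro arg_cong2[where f = density] refl ext)
       (auto simp: indicator_def ennreal_numeral divide_ennreal[symmetric] ennreal_mult)
  moreover have "(LINT z|circle_measure. f z) = (LINT t|uniform_measure lborel {0..2 * pi}. f (cis t))"
    unfolding circle_measure_def
    using assms by (intro integral_distr cis_measurable_circle)  (simp cong: measurable_cong_sets)
  moreover have "(\<lambda>t. f (cis t)) \<in> borel_measurable lborel"
  proof -
    have "(\<lambda>t. f (cis t)) \<in> borel_measurable (uniform_measure lborel {0..2 * pi})"
      using assms by (intro measurable_compose[OF cis_measurable_circle]) (simp cong: measurable_cong_sets)
    then show ?thesis by (simp add: measurable_def)
  qed
  ultimately have "(LINT z|circle_measure. f z) =
      (LINT t|lborel. (indicator {0..2 * pi} t / (2 * pi)) *\<^sub>R f (cis t))"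
    by (simp add: integral_density)
  also have "\<dots> = (LINT t|lborel. (indicator {0..2 * pi} t *\<^sub>R f (cis t)) / (2 * pi))"
    by (intro Bochner_Integration.integral_cong) (auto simp: scaleR_conv_of_real)
  finally show ?thesis by (simp add: set_lebesgue_integral_def)
qed

text \<open>For n nonzero the integrand has the primitive \<open>F\<close>, which takes the same
  value at both ends of the period.\<close>

lemma integral_circle_powi:
  "(LINT z|circle_measure. z powi n) = (if n = 0 then 1 else 0)"
proof (cases "n = 0")
  case True
  then show ?thesis by (simp add: circle.prob_space[simplified])
next
  case False
  define F where "F = (\<lambda>t. cis (of_int n * t) / (\<i> * of_int n))"
  have "(LINT t|lborel. indicator {0..2 * pi} t *\<^sub>R cis (of_int n * t)) = F (2 * pi) - F 0"
  proof (rule integral_FTC_Icc)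
    fix t :: real
    show "(F has_vector_derivative cis (of_int n * t)) (at t within {0..2 * pi})"
      unfolding F_def using False
      by (auto simp: cis_conv_exp field_simps intro!: derivative_eq_intros
          has_vector_derivative_real_field)
  qed (auto intro!: continuous_intros)
  also have "F (2 * pi) = F 0"
    unfolding F_def using cis_multiple_2pi[of "of_int n"] by (simp add: mult_ac)
  finally show ?thesis
    using False by (simp add: integral_circle_measure set_lebesgue_integral_def Complex.DeMoivre cis_power_int)
qed

section \<open>The Hardy space and Fourier coefficients\<close>

lemma cnj_eq_inverse_on_circle: "cmod z = 1 \<Longrightarrow> cnj z = inverse z"
  by (metis complex_norm_square inverse_unique of_real_1 one_power2)

lemma power_times_powi_on_circle:
  assumes "cmod z = 1"
  shows "z ^ n * z powi k = z powi (int n + k)"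
  using assms by (subst power_int_add) auto

lemma cnj_power_on_circle: "cmod z = 1 \<Longrightarrow> cnj (z ^ n) = z powi (- int n)"
  by (simp add: cnj_eq_inverse_on_circle power_int_minus power_inverse)

lemma L2_circle_measurable [dest]: "f \<in> L2_circle \<Longrightarrow> f \<in> borel_measurable circle_measure"
  by (simp add: L2_circle_def)

lemma L2_circle_integrable_square: "f \<in> L2_circle \<Longrightarrow> integrable circle_measure (\<lambda>z. (cmod (f z))\<^sup>2)"
  by (simp add: L2_circle_def)

lemma L2_circle_integrable:
  assumes "f \<in> L2_circle"
  shows "integrable circle_measure f"
proof (rule Bochner_Integration.integrable_bound)
  show "integrable circle_measure (\<lambda>z. 1 + (cmod (f z))\<^sup>2)"
    using L2_circle_integrable_square[OF assms] by simp
  have "cmod w \<le> 1 + (cmod w)\<^sup>2" for w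
    using zero_le_power2[of "cmod w - 1/2"] by (simp add: power2_eq_square algebra_simps)
  then show "AE z in circle_measure. norm (f z) \<le> norm (1 + (cmod (f z))\<^sup>2)"
    by (intro AE_I2) (metis norm_of_real abs_of_nonneg add_nonneg_nonneg zero_le_one zero_le_power2 real_norm_def)
qed (use assms in auto)

lemma L2_circle_integrable_powi:
  assumes "f \<in> L2_circle"
  shows "integrable circle_measure (\<lambda>z. f z * z powi n)"
proof (rule Bochner_Integration.integrable_bound[OF L2_circle_integrable[OF assms]])
  show "(\<lambda>z. f z * z powi n) \<in> borel_measurable circle_measure"
    using L2_circle_measurable[OF assms] by measurable
  show "AE z in circle_measure. norm (f z * z powi n) \<le> norm (f z)"
    by (intro AE_I2) (auto simp: norm_mult norm_power_int)
qed

lemma L2_circle_bounded: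
  assumes "f \<in> borel_measurable circle_measure" "\<And>z. cmod z = 1 \<Longrightarrow> cmod (f z) \<le> B"
  shows "f \<in> L2_circle"
  unfolding L2_circle_def
  using assms by (auto intro!: integrable_circle_bounded[where B = "B\<^sup>2"] power_mono)

lemma norm_diff_square_le: "(cmod (a - b))\<^sup>2 \<le> 2 * (cmod a)\<^sup>2 + 2 * (cmod b)\<^sup>2"
proof -
  have "(cmod (a - b))\<^sup>2 \<le> (cmod a + cmod b)\<^sup>2"
    by (intro power_mono norm_triangle_ineq4) auto
  also have "\<dots> \<le> 2 * (cmod a)\<^sup>2 + 2 * (cmod b)\<^sup>2"
    using zero_le_power2[of "cmod a - cmod b"] by (simp add: power2_eq_square algebra_simps)
  finally show ?thesis .
qed

lemma L2_circle_cmult: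
  assumes "f \<in> L2_circle"
  shows "(\<lambda>z. c * f z) \<in> L2_circle"
  using assms unfolding L2_circle_def by (auto simp: norm_mult power_mult_distrib)

lemma L2_circle_diff:
  assumes "f \<in> L2_circle" "g \<in> L2_circle"
  shows "(\<lambda>z. f z - g z) \<in> L2_circle"
proof -
  have [measurable]: "f \<in> borel_measurable circle_measure" "g \<in> borel_measurable circle_measure"
    using assms by auto
  have "integrable circle_measure (\<lambda>z. (cmod (f z - g z))\<^sup>2)"
  proof (rule Bochner_Integration.integrable_bound)
    show "integrable circle_measure (\<lambda>z. 2 * (cmod (f z))\<^sup>2 + 2 * (cmod (g z))\<^sup>2)"
      using assms[THEN L2_circle_integrable_square] by simp
  qed (auto simp: norm_diff_square_le)
  then show ?thesis by (simp add: L2_circle_def)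
qed

lemma L2_circle_sum:
  assumes "\<And>i. i \<in> I \<Longrightarrow> f i \<in> L2_circle"
  shows "(\<lambda>z. \<Sum>i\<in>I. f i z) \<in> L2_circle"
  using assms
proof (induction I rule: infinite_finite_induct)
  case (insert i I)
  have "(\<lambda>z. f i z - (-1) * (\<Sum>j\<in>I. f j z)) \<in> L2_circle"
    by (intro L2_circle_diff L2_circle_cmult insert) (use insert in auto)
  with insert show ?case by simp
qed (auto intro: L2_circle_bounded[where B = 0])

lemma fourier_coeff_diff:
  assumes "f \<in> L2_circle" "g \<in> L2_circle"
  shows "fourier_coeff (\<lambda>z. f z - g z) n = fourier_coeff f n - fourier_coeff g n"
  unfolding fourier_coeff_def
  using assms by (simp add: left_diff_distrib L2_circle_integrable_powi)

lemma fourier_coeff_cmult: "fourier_coeff (\<lambda>z. c * f z) n = c * fourier_coeff f n"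
  unfolding fourier_coeff_def by (simp add: mult.assoc)

lemma fourier_coeff_cong_AE:
  assumes "AE z in circle_measure. f z = g z"
    "f \<in> borel_measurable circle_measure" "g \<in> borel_measurable circle_measure"
  shows "fourier_coeff f n = fourier_coeff g n"
  unfolding fourier_coeff_def using assms by (intro integral_cong_AE) auto

lemma fourier_coeff_sum_power:
  "fourier_coeff (\<lambda>z. \<Sum>n<N. \<alpha> n * z ^ n) k = (if 0 \<le> k \<and> k < int N then \<alpha> (nat k) else 0)"
proof -
  have "fourier_coeff (\<lambda>z. \<Sum>n<N. \<alpha> n * z ^ n) k
      = (LINT z|circle_measure. (\<Sum>n<N. \<alpha> n * z powi (int n - k)))"
    unfolding fourier_coeff_def
    by (intro Bochner_Integration.integral_cong refl)
       (auto simp: sum_distrib_right power_times_powi_on_circle mult.assoc intro!: sum.cong)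
  also have "\<dots> = (\<Sum>n<N. \<alpha> n * (LINT z|circle_measure. z powi (int n - k)))"
    by (subst Bochner_Integration.integral_sum)
       (auto intro!: integrable_circle_bounded[where B = 1] integrable_mult_right simp: norm_power_int)
  also have "\<dots> = (\<Sum>n<N. if int n = k then \<alpha> n else 0)"
    by (intro sum.cong) (auto simp: integral_circle_powi)
  also have "\<dots> = (\<Sum>n<N. if n = nat k \<and> 0 \<le> k then \<alpha> n else 0)"
    by (intro sum.cong) auto
  also have "\<dots> = (if 0 \<le> k \<and> k < int N then \<alpha> (nat k) else 0)"
    by (cases "0 \<le> k") (auto simp: sum.delta nat_less_iff)
  finally show ?thesis .
qed

text \<open>Nonnegativity of the variance of |f| gives (E |f|)^2 \<le> E |f|^2 on the probability
  space of the circle. Each Fourier coefficient is therefore continuous in L2.\<close>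

lemma fourier_coeff_square_le:
  assumes "f \<in> L2_circle"
  shows "(cmod (fourier_coeff f n))\<^sup>2 \<le> (LINT z|circle_measure. (cmod (f z))\<^sup>2)"
proof -
  have int: "integrable circle_measure (\<lambda>z. cmod (f z))"
    using L2_circle_integrable[OF assms] by simp
  have "cmod (fourier_coeff f n) \<le> (LINT z|circle_measure. cmod (f z * z powi (- n)))"
    unfolding fourier_coeff_def by (rule integral_norm_bound)
  also have "\<dots> = (LINT z|circle_measure. cmod (f z))"
    by (intro Bochner_Integration.integral_cong) (auto simp: norm_mult norm_power_int)
  finally have "(cmod (fourier_coeff f n))\<^sup>2 \<le> (LINT z|circle_measure. cmod (f z))\<^sup>2"
    by (intro power_mono) auto
  also have "\<dots> \<le> (LINT z|circle_measure. (cmod (f z))\<^sup>2)"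
    using circle.variance_positive[of "\<lambda>z. cmod (f z)"]
    by (simp add: circle.variance_eq int L2_circle_integrable_square[OF assms])
  finally show ?thesis .
qed

lemma L2_plus_L2_circle: "f \<in> L2_plus \<Longrightarrow> f \<in> L2_circle"
  by (simp add: L2_plus_def)

lemma power_L2_circle: "(\<lambda>z. \<alpha> * z ^ n) \<in> L2_circle"
  by (intro L2_circle_bounded[where B = "cmod \<alpha>"]) (auto simp: norm_mult norm_power)

text \<open>Since coefficients are L2-continuous, the sequence \<alpha> in the definition of
  \<open>L2_plus\<close> can only consist of the Fourier coefficients, which removes the existential
  from all later arguments.\<close>

lemma L2_plus_expansion:
  assumes "f \<in> L2_plus"
  shows L2_plus_coeff_neg: "n < 0 \<Longrightarrow> fourier_coeff f n = 0"
    and L2_plus_partial_sums: "(\<lambda>N. LINT z|circle_measure.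
      (cmod (f z - (\<Sum>n<N. fourier_coeff f (int n) * z ^ n)))\<^sup>2) \<longlonglongrightarrow> 0"
proof -
  obtain \<alpha> where \<alpha>: "(\<lambda>N. LINT z|circle_measure. (cmod (f z - (\<Sum>n<N. \<alpha> n * z ^ n)))\<^sup>2) \<longlonglongrightarrow> 0"
    using assms by (auto simp: L2_plus_def)
  have f: "f \<in> L2_circle" using assms by (rule L2_plus_L2_circle)
  have coeff: "fourier_coeff f k = (if 0 \<le> k then \<alpha> (nat k) else 0)" for k
  proof -
    define d where "d = fourier_coeff f k - (if 0 \<le> k then \<alpha> (nat k) else 0)"
    have "(cmod d)\<^sup>2 \<le> (LINT z|circle_measure. (cmod (f z - (\<Sum>n<N. \<alpha> n * z ^ n)))\<^sup>2)" if "N > nat k" for N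
    proof -
      have S: "(\<lambda>z. \<Sum>n<N. \<alpha> n * z ^ n) \<in> L2_circle"
        by (intro L2_circle_sum power_L2_circle)
      have "d = fourier_coeff (\<lambda>z. f z - (\<Sum>n<N. \<alpha> n * z ^ n)) k"
        using that unfolding d_def by (auto simp: fourier_coeff_diff[OF f S] fourier_coeff_sum_power)
      then show ?thesis
        using fourier_coeff_square_le[OF L2_circle_diff[OF f S]] by simp
    qed
    then have "(cmod d)\<^sup>2 \<le> 0"
      by (intro tendsto_lowerbound[OF \<alpha>] eventually_mono[OF eventually_gt_at_top[of "nat k"]]) auto
    then show ?thesis unfolding d_def by simp
  qed
  show "n < 0 \<Longrightarrow> fourier_coeff f n = 0"
    by (simp add: coeff)
  show "(\<lambda>N. LINT z|circle_measure.
      (cmod (f z - (\<Sum>n<N. fourier_coeff f (int n) * z ^ n)))\<^sup>2) \<longlonglongrightarrow> 0"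
    using \<alpha> by (simp add: coeff)
qed

text \<open>Both functions are L2 limits of the same partial sums. This is the step that turns
  identities between coefficients into identities almost everywhere.\<close>

lemma L2_plus_eqI:
  assumes "f \<in> L2_plus" "g \<in> L2_plus" "\<And>n. fourier_coeff f (int n) = fourier_coeff g (int n)"
  shows "AE z in circle_measure. f z = g z"
proof -
  have L2: "f \<in> L2_circle" "g \<in> L2_circle"
    using assms by (auto intro: L2_plus_L2_circle)
  define S where "S = (\<lambda>N z. \<Sum>n<N. fourier_coeff f (int n) * z ^ n)"
  have SL2: "S N \<in> L2_circle" for N
    unfolding S_def by (intro L2_circle_sum power_L2_circle)
  have lim: "(\<lambda>N. 2 * (LINT z|circle_measure. (cmod (f z - S N z))\<^sup>2)
      + 2 * (LINT z|circle_measure. (cmod (g z - S N z))\<^sup>2)) \<longlonglongrightarrow> 2 * 0 + 2 * 0"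
    using L2_plus_partial_sums[OF assms(1)] L2_plus_partial_sums[OF assms(2)]
    unfolding S_def by (intro tendsto_intros) (simp_all add: assms(3))
  have "(LINT z|circle_measure. (cmod (f z - g z))\<^sup>2) \<le>
      2 * (LINT z|circle_measure. (cmod (f z - S N z))\<^sup>2)
      + 2 * (LINT z|circle_measure. (cmod (g z - S N z))\<^sup>2)" for N
  proof -
    have "(LINT z|circle_measure. (cmod (f z - g z))\<^sup>2)
        \<le> (LINT z|circle_measure. 2 * (cmod (f z - S N z))\<^sup>2 + 2 * (cmod (g z - S N z))\<^sup>2)"
      using norm_diff_square_le[of "f z - S N z" "g z - S N z" for z]
      by (intro integral_mono L2_circle_integrable_square L2_circle_diff L2 Bochner_Integration.integrable_add
          integrable_mult_right SL2) auto
    also have "\<dots> = 2 * (LINT z|circle_measure. (cmod (f z - S N z))\<^sup>2)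
      + 2 * (LINT z|circle_measure. (cmod (g z - S N z))\<^sup>2)"
      using L2_circle_integrable_square[OF L2_circle_diff[OF L2(1) SL2]]
        L2_circle_integrable_square[OF L2_circle_diff[OF L2(2) SL2]] by simp
    finally show ?thesis .
  qed
  then have "(LINT z|circle_measure. (cmod (f z - g z))\<^sup>2) \<le> 0"
    using tendsto_lowerbound[OF lim, of "LINT z|circle_measure. (cmod (f z - g z))\<^sup>2"] by auto
  moreover have "(LINT z|circle_measure. (cmod (f z - g z))\<^sup>2) \<ge> 0"
    by simp
  ultimately have "(LINT z|circle_measure. (cmod (f z - g z))\<^sup>2) = 0" by linarith
  then have "AE z in circle_measure. (cmod (f z - g z))\<^sup>2 = 0"
    using L2_circle_integrable_square[OF L2_circle_diff[OF L2]]
    by (subst (asm) integral_nonneg_eq_0_iff_AE) auto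
  then show ?thesis by simp
qed

section \<open>Absolutely convergent Hardy series\<close>

text \<open>A concrete representative: \<open>hardy_series\<close> is obtained by choice and is
  known only up to null sets, whereas this sum can be evaluated at every point of the circle once
  \<open>a\<close> is absolutely summable.\<close>

definition hseries :: "(nat \<Rightarrow> complex) \<Rightarrow> complex \<Rightarrow> complex" where
  "hseries a z = (\<Sum>n. a n * z ^ n)"

lemma hseries_summable:
  assumes "summable (\<lambda>n. cmod (a n))" "cmod z = 1"
  shows "summable (\<lambda>n. cmod (a n * z ^ n))" "summable (\<lambda>n. a n * z ^ n)"
proof -
  show "summable (\<lambda>n. cmod (a n * z ^ n))"
    using assms by (simp add: norm_mult norm_power)
  then show "summable (\<lambda>n. a n * z ^ n)"
    by (rule summable_norm_cancel)
qed

lemma hseries_diff: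
  assumes "summable (\<lambda>n. cmod (a n))" "summable (\<lambda>n. cmod (b n))" "cmod z = 1"
  shows "hseries (\<lambda>n. a n - b n) z = hseries a z - hseries b z"
  unfolding hseries_def using assms
  by (subst suminf_diff) (auto intro!: hseries_summable simp: left_diff_distrib)

lemma norm_hseries_le:
  assumes "summable (\<lambda>n. cmod (a n))" "cmod z = 1"
  shows "cmod (hseries a z) \<le> (\<Sum>n. cmod (a n))"
proof -
  have "cmod (hseries a z) \<le> (\<Sum>n. cmod (a n * z ^ n))"
    unfolding hseries_def by (intro summable_norm hseries_summable assms)
  then show ?thesis using assms by (simp add: norm_mult norm_power)
qed

lemma hseries_measurable [measurable]: "hseries a \<in> borel_measurable circle_measure"
  unfolding hseries_def by measurable

lemma hseries_L2_circle:
  assumes "summable (\<lambda>n. cmod (a n))"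
  shows "hseries a \<in> L2_circle"
  using norm_hseries_le[OF assms] by (intro L2_circle_bounded) auto

lemma integral_hseries_mult:
  assumes a: "summable (\<lambda>n. cmod (a n))" and [measurable]: "g \<in> borel_measurable circle_measure"
    and B: "\<And>z. cmod z = 1 \<Longrightarrow> cmod (g z) \<le> B"
  shows "(\<lambda>n. a n * (LINT z|circle_measure. z ^ n * g z)) sums
    (LINT z|circle_measure. hseries a z * g z)"
proof -
  have bound: "cmod (a n * z ^ n * g z) \<le> cmod (a n) * B" if "cmod z = 1" for n z
    using that B[OF that] by (simp add: norm_mult norm_power mult_left_mono)
  have int: "integrable circle_measure (\<lambda>z. a n * z ^ n * g z)" for n
    by (rule integrable_circle_bounded[OF _ bound]) measurable
  have "(\<lambda>n. LINT z|circle_measure. a n * z ^ n * g z) sums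
      (LINT z|circle_measure. (\<Sum>n. a n * z ^ n * g z))"
  proof (rule sums_integral[OF int])
    show "AE z in circle_measure. summable (\<lambda>n. norm (a n * z ^ n * g z))"
      using bound by (intro AE_I2 summable_comparison_test[OF _ summable_mult2[OF a, of B]]) auto
    have "norm (LINT z|circle_measure. norm (a n * z ^ n * g z)) \<le> cmod (a n) * B" for n
    proof -
      have "(LINT z|circle_measure. norm (a n * z ^ n * g z)) \<le> (LINT z|circle_measure. cmod (a n) * B)"
        using bound by (intro integral_mono integrable_norm int) auto
      then show ?thesis
        by (simp add: circle.prob_space[simplified])
    qed
    then show "summable (\<lambda>n. LINT z|circle_measure. norm (a n * z ^ n * g z))"
      by (intro summable_comparison_test[OF _ summable_mult2[OF a, of B]]) auto
  qed
  moreover have "(LINT z|circle_measure. (\<Sum>n. a n * z ^ n * g z)) =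
      (LINT z|circle_measure. hseries a z * g z)"
    unfolding hseries_def
    by (intro Bochner_Integration.integral_cong refl suminf_mult2[symmetric] hseries_summable a) auto
  ultimately show ?thesis
    by (simp add: mult.assoc)
qed

lemma fourier_coeff_hseries:
  assumes a: "summable (\<lambda>n. cmod (a n))"
  shows "fourier_coeff (hseries a) k = (if 0 \<le> k then a (nat k) else 0)"
proof -
  have "(\<lambda>n. a n * (LINT z|circle_measure. z ^ n * z powi (- k))) sums fourier_coeff (hseries a) k"
    unfolding fourier_coeff_def
    by (rule integral_hseries_mult[OF a, where B = 1]) (auto simp: norm_power_int)
  moreover have "(LINT z|circle_measure. z ^ n * z powi (- k)) = (if int n = k then 1 else 0)" for n
  proof -
    have "(LINT z|circle_measure. z ^ n * z powi (- k)) = (LINT z|circle_measure. z powi (int n - k))"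
      by (intro Bochner_Integration.integral_cong) (auto simp: power_times_powi_on_circle)
    then show ?thesis by (simp add: integral_circle_powi)
  qed
  ultimately have "(\<lambda>n. if int n = k then a n else 0) sums fourier_coeff (hseries a) k"
    by (simp add: if_distrib cong: if_cong)
  moreover have "(\<lambda>n. if int n = k then a n else 0) sums (if 0 \<le> k then a (nat k) else 0)"
  proof (cases "0 \<le> k")
    case True
    then have "(\<lambda>n. if int n = k then a n else 0) = (\<lambda>n. if n = nat k then a n else 0)" by (intro ext) auto
    then show ?thesis using True sums_single[of "nat k" a] by simp
  next
    case False
    then have "(\<lambda>n. if int n = k then a n else 0) = (\<lambda>n. 0)" by auto
    then show ?thesis using False by simp
  qed
  ultimately show ?thesis by (rule sums_unique2)
qed

lemma inner_hseries_sums: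
  assumes a: "summable (\<lambda>n. cmod (a n))" and [measurable]: "g \<in> borel_measurable circle_measure"
    and B: "\<And>z. cmod z = 1 \<Longrightarrow> cmod (g z) \<le> B"
  shows "(\<lambda>n. cnj (a n) * fourier_coeff g (int n)) sums
    (LINT z|circle_measure. cnj (hseries a z) * g z)"
proof -
  have [measurable]: "(\<lambda>z. cnj (g z)) \<in> borel_measurable circle_measure"
    by (intro measurable_compose[OF assms(2)] borel_measurable_continuous_onI continuous_intros)
  have "(\<lambda>n. cnj (a n * (LINT z|circle_measure. z ^ n * cnj (g z)))) sums
    cnj (LINT z|circle_measure. hseries a z * cnj (g z))"
    using B by (subst sums_cnj) (auto intro!: integral_hseries_mult[OF a, where B = B])
  moreover have "cnj (LINT z|circle_measure. z ^ n * cnj (g z)) = fourier_coeff g (int n)" for n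
  proof -
    have "cnj (LINT z|circle_measure. z ^ n * cnj (g z)) = (LINT z|circle_measure. cnj (z ^ n * cnj (g z)))"
      by (simp only: Bochner_Integration.integral_cnj)
    also have "\<dots> = fourier_coeff g (int n)"
      unfolding fourier_coeff_def
      by (intro Bochner_Integration.integral_cong) (auto simp: cnj_power_on_circle simp del: complex_cnj_power)
    finally show ?thesis .
  qed
  moreover have "cnj (LINT z|circle_measure. hseries a z * cnj (g z)) =
      (LINT z|circle_measure. cnj (hseries a z) * g z)"
    by (subst Bochner_Integration.integral_cnj[symmetric]) simp
  ultimately show ?thesis by simp
qed

lemma parseval_hseries:
  assumes a: "summable (\<lambda>n. cmod (a n))"
  shows "(\<lambda>n. (cmod (a n))\<^sup>2) sums (LINT z|circle_measure. (cmod (hseries a z))\<^sup>2)"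
proof -
  have "(\<lambda>n. cnj (a n) * fourier_coeff (hseries a) (int n)) sums
      (LINT z|circle_measure. cnj (hseries a z) * hseries a z)"
    by (rule inner_hseries_sums[OF a _ norm_hseries_le[OF a]]) auto
  moreover have "cnj w * w = complex_of_real ((cmod w)\<^sup>2)" for w
    by (simp add: complex_norm_square[symmetric] mult.commute)
  ultimately have "(\<lambda>n. complex_of_real ((cmod (a n))\<^sup>2)) sums
      complex_of_real (LINT z|circle_measure. (cmod (hseries a z))\<^sup>2)"
    by (simp add: fourier_coeff_hseries[OF a] del: of_real_power)
  then show ?thesis by (simp only: sums_of_real_iff)
qed

text \<open>The tails \<open>T N\<close> of the coefficient sum bound the remainder uniformly on the
  circle, and uniform convergence implies L2 convergence.\<close>

lemma hseries_L2_plus: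
  assumes a: "summable (\<lambda>n. cmod (a n))"
  shows "hseries a \<in> L2_plus"
  unfolding L2_plus_def mem_Collect_eq
proof (intro conjI exI)
  show "hseries a \<in> L2_circle" by (rule hseries_L2_circle[OF a])
  define T where "T = (\<lambda>N. \<Sum>n. cmod (a (n + N)))"
  have aN: "summable (\<lambda>n. cmod (a (n + N)))" for N
    using a by (rule summable_ignore_initial_segment)
  have T: "T \<longlonglongrightarrow> 0"
    unfolding T_def
    using suminf_exist_split2[OF a] .
  have bound: "cmod (hseries a z - (\<Sum>n<N. a n * z ^ n)) \<le> T N" if z: "cmod z = 1" for z N
  proof -
    have "hseries a z - (\<Sum>n<N. a n * z ^ n) = (\<Sum>n. a (n + N) * z ^ (n + N))"
      unfolding hseries_def using suminf_minus_initial_segment[OF hseries_summable(2)[OF a z], of N] by simp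
    also have "cmod \<dots> \<le> (\<Sum>n. cmod (a (n + N) * z ^ (n + N)))"
      using aN z by (intro summable_norm) (simp add: norm_mult norm_power)
    finally show ?thesis using z unfolding T_def by (simp add: norm_mult norm_power)
  qed
  show "(\<lambda>N. LINT z|circle_measure. (cmod (hseries a z - (\<Sum>n<N. a n * z ^ n)))\<^sup>2) \<longlonglongrightarrow> 0"
  proof (rule tendsto_sandwich[OF _ _ tendsto_const])
    show "\<forall>\<^sub>F N in sequentially. (LINT z|circle_measure. (cmod (hseries a z - (\<Sum>n<N. a n * z ^ n)))\<^sup>2) \<le> (T N)\<^sup>2"
    proof (rule always_eventually, rule allI)
      fix N
      have "(LINT z|circle_measure. (cmod (hseries a z - (\<Sum>n<N. a n * z ^ n)))\<^sup>2)
          \<le> (LINT z|circle_measure. (T N)\<^sup>2)"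
        using bound[of _ N]
        by (intro integral_mono L2_circle_integrable_square L2_circle_diff hseries_L2_circle a
             L2_circle_sum power_L2_circle power_mono) auto
      then show "(LINT z|circle_measure. (cmod (hseries a z - (\<Sum>n<N. a n * z ^ n)))\<^sup>2) \<le> (T N)\<^sup>2"
        by (simp add: circle.prob_space[simplified])
    qed
    show "(\<lambda>N. (T N)\<^sup>2) \<longlonglongrightarrow> 0"
      using tendsto_power[OF T, of 2] by simp
  qed auto
qed

lemma hardy_series_L2_plus:
  assumes a: "summable (\<lambda>n. cmod (a n))"
  shows "hardy_series a \<in> L2_plus" "fourier_coeff (hardy_series a) (int n) = a n"
    and hardy_series_AE: "AE z in circle_measure. hardy_series a z = hseries a z"
proof -
  have "hardy_series a \<in> L2_plus \<and> (\<forall>n. fourier_coeff (hardy_series a) (int n) = a n)"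
    unfolding hardy_series_def
    by (rule someI[of _ "hseries a"]) (simp add: hseries_L2_plus fourier_coeff_hseries a)
  then show *: "hardy_series a \<in> L2_plus" "fourier_coeff (hardy_series a) (int n) = a n" for n
    by auto
  show "AE z in circle_measure. hardy_series a z = hseries a z"
    by (intro L2_plus_eqI) (simp_all add: * hseries_L2_plus fourier_coeff_hseries a)
qed

section \<open>Embedding of the Sobolev spaces into absolutely convergent series\<close>

lemma sobolev_plus_weighted_summable:
  assumes "f \<in> sobolev_plus s"
  shows "summable (\<lambda>n. (1 + real n) powr (2 * s) * (cmod (fourier_coeff f (int n)))\<^sup>2)"
proof -
  define g where "g = (\<lambda>n :: int. (1 + \<bar>real_of_int n\<bar>) powr (2 * s) * (cmod (fourier_coeff f n))\<^sup>2)"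
  have "g summable_on UNIV"
    using assms unfolding g_def sobolev_plus_def sobolev_def by blast
  then have "g summable_on range int"
    by (rule summable_on_subset_banach) simp
  then have "(g \<circ> int) summable_on UNIV"
    by (subst (asm) summable_on_reindex) auto
  then have "(\<lambda>n. (1 + real n) powr (2 * s) * (cmod (fourier_coeff f (int n)))\<^sup>2) summable_on UNIV"
    by (simp add: g_def o_def)
  then show ?thesis
    by (rule summable_on_imp_summable)
qed

lemma cauchy_schwarz_series:
  fixes x y :: "nat \<Rightarrow> real"
  assumes "summable (\<lambda>n. (x n)\<^sup>2)" "summable (\<lambda>n. (y n)\<^sup>2)"
  shows "summable (\<lambda>n. \<bar>x n * y n\<bar>)"
    and "(\<Sum>n. \<bar>x n * y n\<bar>) \<le> sqrt (\<Sum>n. (x n)\<^sup>2) * sqrt (\<Sum>n. (y n)\<^sup>2)"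
proof -
  have partial: "(\<Sum>n<N. \<bar>x n * y n\<bar>) \<le> sqrt (\<Sum>n. (x n)\<^sup>2) * sqrt (\<Sum>n. (y n)\<^sup>2)" for N
  proof -
    have "(\<Sum>n<N. \<bar>x n * y n\<bar>) \<le> L2_set x {..<N} * L2_set y {..<N}"
      by (simp add: abs_mult L2_set_mult_ineq)
    also have "\<dots> \<le> sqrt (\<Sum>n. (x n)\<^sup>2) * sqrt (\<Sum>n. (y n)\<^sup>2)"
      unfolding L2_set_def using assms
      by (intro mult_mono real_sqrt_le_mono sum_le_suminf) (auto intro!: sum_nonneg suminf_nonneg)
    finally show ?thesis .
  qed
  show summ: "summable (\<lambda>n. \<bar>x n * y n\<bar>)"
    by (rule bounded_imp_summable[OF _ partial[of "Suc _", unfolded lessThan_Suc_atMost]]) auto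
  show "(\<Sum>n. \<bar>x n * y n\<bar>) \<le> sqrt (\<Sum>n. (x n)\<^sup>2) * sqrt (\<Sum>n. (y n)\<^sup>2)"
    by (rule suminf_le_const[OF summ partial])
qed

definition embedding_constant :: "real \<Rightarrow> real" where
  "embedding_constant s = sqrt (\<Sum>n. (1 + real n) powr (- 2 * s))"

text \<open>Cauchy-Schwarz against the weight (1 + n)^(-s), which is square summable because 2 s >
  1; \<open>embedding_constant\<close> is the l2 norm of that weight.\<close>

lemma weighted_l2_embedding:
  assumes "s > 1/2" and a: "summable (\<lambda>n. (1 + real n) powr (2 * s) * (cmod (a n))\<^sup>2)"
  shows "summable (\<lambda>n. cmod (a n))"
    and "(\<Sum>n. cmod (a n)) \<le> embedding_constant s *
      sqrt (\<Sum>n. (1 + real n) powr (2 * s) * (cmod (a n))\<^sup>2)"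
proof -
  define x where "x = (\<lambda>n. (1 + real n) powr (- s))"
  define y where "y = (\<lambda>n. (1 + real n) powr s * cmod (a n))"
  have xsq: "(x n)\<^sup>2 = (1 + real n) powr (- 2 * s)" for n
    unfolding x_def by (simp add: power2_eq_square powr_add[symmetric])
  have ysq: "(y n)\<^sup>2 = (1 + real n) powr (2 * s) * (cmod (a n))\<^sup>2" for n
    unfolding y_def by (simp add: power2_eq_square powr_add[symmetric] mult_ac)
  have xy: "\<bar>x n * y n\<bar> = cmod (a n)" for n
    unfolding x_def y_def by (simp add: powr_minus field_simps)
  have "summable (\<lambda>n. real n powr (- 2 * s))"
    using assms(1) by (simp add: summable_real_powr_iff)
  then have "summable (\<lambda>n. real (Suc n) powr (- 2 * s))"
    by (subst summable_Suc_iff)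
  then have "summable (\<lambda>n. (x n)\<^sup>2)" by (simp add: xsq add.commute)
  from cauchy_schwarz_series[OF this, of y] a
  show "summable (\<lambda>n. cmod (a n))"
    and "(\<Sum>n. cmod (a n)) \<le> embedding_constant s *
      sqrt (\<Sum>n. (1 + real n) powr (2 * s) * (cmod (a n))\<^sup>2)"
    unfolding xy unfolding xsq ysq embedding_constant_def by auto
qed

lemma sobolev_plus_l1_coeff:
  assumes "s > 1/2" "f \<in> sobolev_plus s"
  shows "summable (\<lambda>n. cmod (fourier_coeff f (int n)))"
  using weighted_l2_embedding(1)[OF assms(1) sobolev_plus_weighted_summable[OF assms(2)]] .

lemma hseries_sobolev_plus:
  assumes a: "summable (\<lambda>n. cmod (a n))" and "summable (\<lambda>n. (1 + real n) powr (2 * s) * (cmod (a n))\<^sup>2)"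
  shows "hseries a \<in> sobolev_plus s"
proof -
  let ?f = "\<lambda>n :: int. (1 + \<bar>real_of_int n\<bar>) powr (2 * s) * (cmod (fourier_coeff (hseries a) n))\<^sup>2"
  have "(\<lambda>n. (1 + real n) powr (2 * s) * (cmod (a n))\<^sup>2) summable_on UNIV"
    using assms(2) by (intro norm_summable_imp_summable_on) (simp add: abs_mult)
  then have "?f summable_on range int"
    by (subst summable_on_reindex) (auto simp: o_def fourier_coeff_hseries a)
  \<comment> \<open>The negative modes of a Hardy series vanish, so nothing is added outside
    \<open>range int\<close>.\<close>
  then have "?f summable_on UNIV"
    by (rule summable_on_cong_neutral[THEN iffD1, rotated 3])
       (auto simp: fourier_coeff_hseries a image_iff intro: nonneg_int_cases)
  then show ?thesis
    by (simp add: sobolev_plus_def sobolev_def hseries_L2_plus hseries_L2_circle a)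
qed

section \<open>Uniqueness\<close>

lemma l1_bound: "summable (\<lambda>n. cmod (a n)) \<Longrightarrow> cmod (a n) \<le> (\<Sum>n. cmod (a n))"
  using sum_le_suminf[of "\<lambda>n. cmod (a n)" "{n}"] by auto

lemma l1_product:
  assumes a: "summable (\<lambda>n. cmod (a n))" and b: "summable (\<lambda>n. cmod (b n))"
  shows "summable (\<lambda>n. cmod (a n) * cmod (b n))"
    and "(\<Sum>n. cmod (a n) * cmod (b n)) \<le> (\<Sum>n. cmod (a n)) * (\<Sum>n. cmod (b n))"
proof -
  have le: "cmod (a n) * cmod (b n) \<le> (\<Sum>n. cmod (a n)) * cmod (b n)" for n
    by (intro mult_right_mono l1_bound a) auto
  show summ: "summable (\<lambda>n. cmod (a n) * cmod (b n))"
    using le by (intro summable_comparison_test[OF _ summable_mult[OF b]]) auto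
  have "(\<Sum>n. cmod (a n) * cmod (b n)) \<le> (\<Sum>n. (\<Sum>n. cmod (a n)) * cmod (b n))"
    by (intro suminf_le le summ summable_mult b)
  then show "(\<Sum>n. cmod (a n) * cmod (b n)) \<le> (\<Sum>n. cmod (a n)) * (\<Sum>n. cmod (b n))"
    by (simp add: suminf_mult[OF b])
qed

lemma l1_square:
  assumes "summable (\<lambda>n. cmod (a n))"
  shows "summable (\<lambda>n. (cmod (a n))\<^sup>2)" "(\<Sum>n. (cmod (a n))\<^sup>2) \<le> (\<Sum>n. cmod (a n))\<^sup>2"
  using l1_product[OF assms assms] by (simp_all add: power2_eq_square)

lemma l1_diff:
  assumes a: "summable (\<lambda>n. cmod (a n))" and b: "summable (\<lambda>n. cmod (b n))"
  shows "summable (\<lambda>n. cmod (a n - b n))"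
    and "(\<Sum>n. cmod (a n - b n)) \<le> (\<Sum>n. cmod (a n)) + (\<Sum>n. cmod (b n))"
proof -
  show *: "summable (\<lambda>n. cmod (a n - b n))"
    by (intro summable_comparison_test[OF _ summable_add[OF a b]] exI[of _ 0]) (auto simp: norm_triangle_ineq4)
  have "(\<Sum>n. cmod (a n - b n)) \<le> (\<Sum>n. cmod (a n) + cmod (b n))"
    by (intro suminf_le * summable_add a b norm_triangle_ineq4)
  then show "(\<Sum>n. cmod (a n - b n)) \<le> (\<Sum>n. cmod (a n)) + (\<Sum>n. cmod (b n))"
    by (simp add: suminf_add[OF a b])
qed

lemma l1_add:
  assumes a: "summable (\<lambda>n. cmod (a n))" and b: "summable (\<lambda>n. cmod (b n))"
  shows "summable (\<lambda>n. cmod (a n + b n))"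
    and "(\<Sum>n. cmod (a n + b n)) \<le> (\<Sum>n. cmod (a n)) + (\<Sum>n. cmod (b n))"
  using l1_diff[of a "\<lambda>n. - b n"] assms by simp_all

lemma l1_scale:
  assumes "summable (\<lambda>n. cmod (a n))"
  shows "summable (\<lambda>n. cmod (c * a n))" "(\<Sum>n. cmod (c * a n)) = cmod c * (\<Sum>n. cmod (a n))"
  using assms by (simp_all add: norm_mult suminf_mult)

lemma hseries_mult:
  assumes a: "summable (\<lambda>n. cmod (a n))" and b: "summable (\<lambda>n. cmod (b n))"
  defines "d \<equiv> \<lambda>n. \<Sum>i\<le>n. a i * b (n - i)"
  shows "summable (\<lambda>n. cmod (d n))"
    and "cmod z = 1 \<Longrightarrow> hseries d z = hseries a z * hseries b z"
proof -
  have "summable (\<lambda>n. \<Sum>i\<le>n. cmod (a i) * cmod (b (n - i)))"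
    using a b by (intro summable_Cauchy_product) auto
  then show "summable (\<lambda>n. cmod (d n))"
    unfolding d_def
    by (rule summable_comparison_test[rotated]) (auto intro!: exI[of _ 0] sum_norm_le simp: norm_mult)
  assume z: "cmod z = 1"
  have "hseries a z * hseries b z = (\<Sum>k. \<Sum>i\<le>k. (a i * z ^ i) * (b (k - i) * z ^ (k - i)))"
    unfolding hseries_def by (intro Cauchy_product hseries_summable a b z)
  also have "\<dots> = hseries d z"
    unfolding hseries_def d_def sum_distrib_right
    by (intro suminf_cong sum.cong refl) (auto simp: power_add[symmetric])
  finally show "hseries d z = hseries a z * hseries b z" ..
qed

section \<open>The cubic nonlinearity on absolutely convergent series\<close>

definition cubic_coeff :: "(nat \<Rightarrow> complex) \<Rightarrow> nat \<Rightarrow> complex" where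
  "cubic_coeff a n = fourier_coeff (cubic (hseries a)) (int n)"

lemma cubic_measurable [measurable (raw)]:
  assumes [measurable]: "f \<in> borel_measurable circle_measure"
  shows "cubic f \<in> borel_measurable circle_measure"
  unfolding cubic_def by measurable

lemma cmod_cubic: "cmod (cubic f z) = (cmod (f z)) ^ 3"
  by (simp add: cubic_def norm_mult norm_power power3_eq_cube power2_eq_square)

lemma cubic_hseries_bound:
  assumes "summable (\<lambda>n. cmod (a n))" "cmod z = 1"
  shows "cmod (cubic (hseries a) z) \<le> (\<Sum>n. cmod (a n)) ^ 3"
  unfolding cmod_cubic by (intro power_mono norm_hseries_le assms) auto

lemma cubic_hseries_L2:
  assumes "summable (\<lambda>n. cmod (a n))"
  shows "cubic (hseries a) \<in> L2_circle"
  using cubic_hseries_bound[OF assms] by (intro L2_circle_bounded) auto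

text \<open>Writing |u|^2 u as cnj u times u^2, the nonnegative modes are the correlation of
  \<open>a\<close> with the coefficients \<open>d\<close> of u^2. Correlating two l1 sequences gives
  an l1 sequence, as in Young's inequality.\<close>

lemma cubic_coeff_l1:
  assumes a: "summable (\<lambda>n. cmod (a n))"
  shows "summable (\<lambda>n. cmod (cubic_coeff a n))"
proof -
  define d where "d = (\<lambda>n. \<Sum>i\<le>n. a i * a (n - i))"
  define A where "A = (\<Sum>n. cmod (a n))"
  define D where "D = (\<Sum>n. cmod (d n))"
  have d: "summable (\<lambda>n. cmod (d n))" and
    dz: "cmod z = 1 \<Longrightarrow> hseries d z = hseries a z * hseries a z" for z
    unfolding d_def using hseries_mult[OF a a] by auto
  have sums: "(\<lambda>k. cnj (a k) * d (n + k)) sums cubic_coeff a n" for n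
  proof -
    \<comment> \<open>Moving the factor z^(-n) onto u^2 turns the n-th coefficient into a pairing
      with the Hardy series of \<open>a\<close>.\<close>
    let ?g = "\<lambda>z. hseries d z * z powi (- int n)"
    have "(\<lambda>k. cnj (a k) * fourier_coeff ?g (int k)) sums
        (LINT z|circle_measure. cnj (hseries a z) * ?g z)"
      using norm_hseries_le[OF d] by (intro inner_hseries_sums[OF a]) (auto simp: norm_mult norm_power_int)
    moreover have "fourier_coeff ?g (int k) = d (n + k)" for k
    proof -
      have "z powi (- int n) * z powi (- int k) = z powi (- (int (n + k)))" if "cmod z = 1" for z :: complex
        using that by (subst power_int_add[symmetric]) (auto simp: algebra_simps)
      then have "fourier_coeff ?g (int k) = fourier_coeff (hseries d) (int (n + k))"
        unfolding fourier_coeff_def by (intro Bochner_Integration.integral_cong) (auto simp: mult.assoc)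
      then show ?thesis by (simp add: fourier_coeff_hseries[OF d] nat_add_distrib)
    qed
    moreover have "(LINT z|circle_measure. cnj (hseries a z) * ?g z) = cubic_coeff a n"
      unfolding cubic_coeff_def fourier_coeff_def
      by (intro Bochner_Integration.integral_cong)
         (auto simp: dz cubic_def complex_norm_square simp del: of_real_power)
    ultimately show ?thesis by simp
  qed
  have inner: "summable (\<lambda>k. cmod (a k) * cmod (d (n + k)))"
    and le: "cmod (cubic_coeff a n) \<le> (\<Sum>k. cmod (a k) * cmod (d (n + k)))" for n
  proof -
    have "summable (\<lambda>k. cmod (d (n + k)))"
      using summable_ignore_initial_segment[OF d, of n] by (simp add: add.commute)
    then show *: "summable (\<lambda>k. cmod (a k) * cmod (d (n + k)))"
      by (rule l1_product(1)[OF a])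
    have "cmod (\<Sum>k. cnj (a k) * d (n + k)) \<le> (\<Sum>k. cmod (cnj (a k) * d (n + k)))"
      using * by (intro summable_norm) (simp add: norm_mult)
    then show "cmod (cubic_coeff a n) \<le> (\<Sum>k. cmod (a k) * cmod (d (n + k)))"
      using sums_unique[OF sums] by (simp add: norm_mult)
  qed
  \<comment> \<open>Truncating at \<open>N\<close> leaves one of the two sums finite, so they can be
    exchanged termwise; the bound does not depend on \<open>N\<close>.\<close>
  have "(\<Sum>n\<le>N. cmod (cubic_coeff a n)) \<le> A * D" for N
  proof -
    have "(\<Sum>n\<le>N. cmod (cubic_coeff a n)) \<le> (\<Sum>n\<le>N. \<Sum>k. cmod (a k) * cmod (d (n + k)))"
      by (intro sum_mono le)
    also have "\<dots> = (\<Sum>k. \<Sum>n\<le>N. cmod (a k) * cmod (d (n + k)))"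
      by (rule suminf_sum[symmetric]) (rule inner)
    also have "\<dots> \<le> (\<Sum>k. cmod (a k) * D)"
    proof (intro suminf_le summable_sum inner summable_mult2 a)
      fix k
      have "(\<Sum>n\<le>N. cmod (d (n + k))) = (\<Sum>n\<in>(\<lambda>n. n + k) ` {..N}. cmod (d n))"
        by (subst sum.reindex) (auto simp: inj_on_def)
      also have "\<dots> \<le> D"
        unfolding D_def by (intro sum_le_suminf d) auto
      finally show "(\<Sum>n\<le>N. cmod (a k) * cmod (d (n + k))) \<le> cmod (a k) * D"
        by (simp add: sum_distrib_left[symmetric] mult_left_mono)
    qed
    finally show ?thesis
      by (simp add: suminf_mult2[OF a, symmetric] A_def)
  qed
  then show ?thesis
    by (intro bounded_imp_summable[where B = "A * D"]) auto
qed

lemma cubic_lipschitz: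
  assumes "cmod x \<le> M" "cmod y \<le> M"
  shows "cmod (of_real ((cmod x)\<^sup>2) * x - of_real ((cmod y)\<^sup>2) * y) \<le> 3 * M\<^sup>2 * cmod (x - y)"
proof -
  have M: "M \<ge> 0" using assms(1) norm_ge_zero[of x] by linarith
  \<comment> \<open>The first summand contributes M^2, the second 2 M^2 through |x| + |y| \<le> 2 M;
    this is the constant 3.\<close>
  have "of_real ((cmod x)\<^sup>2) * x - of_real ((cmod y)\<^sup>2) * y =
      of_real ((cmod x)\<^sup>2) * (x - y) + of_real ((cmod x - cmod y) * (cmod x + cmod y)) * y"
    by (simp add: algebra_simps power2_eq_square)
  then have "cmod (of_real ((cmod x)\<^sup>2) * x - of_real ((cmod y)\<^sup>2) * y) \<le>
      cmod (of_real ((cmod x)\<^sup>2) * (x - y)) + cmod (of_real ((cmod x - cmod y) * (cmod x + cmod y)) * y)"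
    by (metis norm_triangle_ineq)
  also have "\<dots> = (cmod x)\<^sup>2 * cmod (x - y) + \<bar>cmod x - cmod y\<bar> * (cmod x + cmod y) * cmod y"
    by (simp add: norm_mult norm_power del: of_real_mult of_real_diff of_real_add of_real_power)
       (simp add: abs_mult)
  also have "\<dots> \<le> M\<^sup>2 * cmod (x - y) + cmod (x - y) * (M + M) * M"
    using assms M by (intro add_mono mult_mono power_mono norm_triangle_ineq3) auto
  finally show ?thesis by (simp add: power2_eq_square algebra_simps)
qed

text \<open>The difference of the cubic terms is tested only against \<open>a - b\<close>, so the
  projector disappears and the pointwise Lipschitz bound can be integrated. The l1 bound
  \<open>M\<close> enters as a supremum bound on the circle, while the estimate itself is in
  L2.\<close>

lemma inner_cubic_diff:
  assumes a: "summable (\<lambda>n. cmod (a n))" and b: "summable (\<lambda>n. cmod (b n))"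
    and M: "(\<Sum>n. cmod (a n)) \<le> M" "(\<Sum>n. cmod (b n)) \<le> M"
  obtains I where "(\<lambda>n. cnj (a n - b n) * (cubic_coeff a n - cubic_coeff b n)) sums I"
    "cmod I \<le> 3 * M\<^sup>2 * (\<Sum>n. (cmod (a n - b n))\<^sup>2)"
proof -
  let ?w = "\<lambda>n. a n - b n"
  let ?g = "\<lambda>z. cubic (hseries a) z - cubic (hseries b) z"
  define I where "I = (LINT z|circle_measure. cnj (hseries ?w z) * ?g z)"
  have w: "summable (\<lambda>n. cmod (?w n))"
    by (rule l1_diff[OF a b])
  have g: "cmod (?g z) \<le> 3 * M\<^sup>2 * cmod (hseries ?w z)" if z: "cmod z = 1" for z
    using cubic_lipschitz[OF order_trans[OF norm_hseries_le[OF a z] M(1)]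
        order_trans[OF norm_hseries_le[OF b z] M(2)]]
    by (simp add: cubic_def hseries_diff[OF a b z])
  have g': "cmod (?g z) \<le> 3 * M\<^sup>2 * (\<Sum>n. cmod (?w n))" if z: "cmod z = 1" for z
    by (rule order_trans[OF g[OF z]], rule mult_left_mono) (auto intro!: norm_hseries_le[OF w z])
  have "(\<lambda>n. cnj (?w n) * fourier_coeff ?g (int n)) sums I"
    unfolding I_def by (rule inner_hseries_sums[OF w _ g']) measurable
  then have sums: "(\<lambda>n. cnj (?w n) * (cubic_coeff a n - cubic_coeff b n)) sums I"
    unfolding cubic_coeff_def by (simp add: fourier_coeff_diff cubic_hseries_L2 a b)
  have "cmod I \<le> (LINT z|circle_measure. cmod (cnj (hseries ?w z) * ?g z))"
    unfolding I_def by (rule integral_norm_bound)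
  also have "\<dots> \<le> (LINT z|circle_measure. 3 * M\<^sup>2 * (cmod (hseries ?w z))\<^sup>2)"
  proof (rule integral_mono_AE')
    show "integrable circle_measure (\<lambda>z. 3 * M\<^sup>2 * (cmod (hseries ?w z))\<^sup>2)"
      by (intro integrable_mult_right L2_circle_integrable_square hseries_L2_circle w)
    show "AE z in circle_measure. cmod (cnj (hseries ?w z) * ?g z) \<le> 3 * M\<^sup>2 * (cmod (hseries ?w z))\<^sup>2"
    proof (rule AE_I2)
      fix z assume "z \<in> space circle_measure"
      then have "cmod z = 1" by simp
      from mult_left_mono[OF g[OF this], of "cmod (hseries ?w z)"]
      show "cmod (cnj (hseries ?w z) * ?g z) \<le> 3 * M\<^sup>2 * (cmod (hseries ?w z))\<^sup>2"
        by (simp add: norm_mult power2_eq_square mult_ac)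
    qed
  qed auto
  also have "\<dots> = 3 * M\<^sup>2 * (\<Sum>n. (cmod (?w n))\<^sup>2)"
    using sums_unique[OF parseval_hseries[OF w]] by simp
  finally show ?thesis using that sums by blast
qed

section \<open>Differentiable curves of summable sequences\<close>

text \<open>The l1 norm controls the supremum on the circle and the l2 norm, and it is controlled by
  every H^s norm with s > 1/2. Uniqueness can thus be proved once, without reference to s.\<close>

definition l1_derivative :: "(real \<Rightarrow> nat \<Rightarrow> complex) \<Rightarrow> (nat \<Rightarrow> complex) \<Rightarrow> real \<Rightarrow> bool" where
  "l1_derivative a v t \<longleftrightarrow> summable (\<lambda>n. cmod (v n)) \<and>
     ((\<lambda>h. \<Sum>n. cmod ((a (t + h) n - a t n) / of_real h - v n)) \<longlongrightarrow> 0) (at 0)"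

lemma difference_quotient_l1:
  assumes "\<And>t. summable (\<lambda>n. cmod (a t n))" "summable (\<lambda>n. cmod (v n))"
  shows "summable (\<lambda>n. cmod ((a (t + h) n - a t n) / of_real h - v n))"
proof (rule l1_diff)
  show "summable (\<lambda>n. cmod ((a (t + h) n - a t n) / of_real h))"
    using l1_scale(1)[OF l1_diff(1)[OF assms(1)[of "t + h"] assms(1)[of t]], of "1 / of_real h"] by simp
qed (rule assms)

lemma l1_derivative_diff:
  assumes "\<And>t. summable (\<lambda>n. cmod (a t n))" "\<And>t. summable (\<lambda>n. cmod (b t n))"
    and "l1_derivative a v t" "l1_derivative b w t"
  shows "l1_derivative (\<lambda>t n. a t n - b t n) (\<lambda>n. v n - w n) t"
proof -
  let ?A = "\<lambda>h n. (a (t + h) n - a t n) / of_real h - v n"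
  let ?B = "\<lambda>h n. (b (t + h) n - b t n) / of_real h - w n"
  have v: "summable (\<lambda>n. cmod (v n))" and w: "summable (\<lambda>n. cmod (w n))"
    using assms(3,4) by (auto simp: l1_derivative_def)
  have "((\<lambda>h. \<Sum>n. cmod (?A h n - ?B h n)) \<longlongrightarrow> 0) (at 0)"
  proof (rule tendsto_sandwich[OF _ _ tendsto_const])
    have "((\<lambda>h. (\<Sum>n. cmod (?A h n)) + (\<Sum>n. cmod (?B h n))) \<longlongrightarrow> 0 + 0) (at 0)"
      using assms(3,4) by (intro tendsto_add) (auto simp: l1_derivative_def)
    then show "((\<lambda>h. (\<Sum>n. cmod (?A h n)) + (\<Sum>n. cmod (?B h n))) \<longlongrightarrow> 0) (at 0)"
      by simp
    show "\<forall>\<^sub>F h in at 0. (\<Sum>n. cmod (?A h n - ?B h n)) \<le> (\<Sum>n. cmod (?A h n)) + (\<Sum>n. cmod (?B h n))"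
      by (intro always_eventually allI l1_diff(2) difference_quotient_l1 assms v w)
    show "\<forall>\<^sub>F h in at 0. 0 \<le> (\<Sum>n. cmod (?A h n - ?B h n))"
      by (intro always_eventually allI suminf_nonneg l1_diff(1) difference_quotient_l1 assms v w) auto
  qed
  moreover have "?A h n - ?B h n =
      ((a (t + h) n - b (t + h) n) - (a t n - b t n)) / of_real h - (v n - w n)" for h n
    by (simp add: diff_divide_distrib)
  ultimately show ?thesis
    unfolding l1_derivative_def using l1_diff(1)[OF v w] by simp
qed

text \<open>Used to bound the l1 norms of two solutions on a compact time interval, which makes the
  Lipschitz constant uniform there.\<close>

lemma l1_derivative_isCont:
  assumes a: "\<And>t. summable (\<lambda>n. cmod (a t n))" and "l1_derivative a v t"
  shows "isCont (\<lambda>t. \<Sum>n. cmod (a t n)) t"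
proof -
  let ?D = "\<lambda>h. \<Sum>n. cmod ((a (t + h) n - a t n) / of_real h - v n)"
  let ?V = "\<Sum>n. cmod (v n)"
  have v: "summable (\<lambda>n. cmod (v n))" and D: "(?D \<longlongrightarrow> 0) (at 0)"
    using assms(2) by (auto simp: l1_derivative_def)
  have bound: "\<bar>(\<Sum>n. cmod (a (t + h) n)) - (\<Sum>n. cmod (a t n))\<bar> \<le> \<bar>h\<bar> * (?D h + ?V)"
    if "h \<noteq> 0" for h
  proof -
    have eq: "a (t + h) n - a t n = of_real h * (((a (t + h) n - a t n) / of_real h - v n) + v n)" for n
      using that by simp
    have e: "summable (\<lambda>n. cmod ((a (t + h) n - a t n) / of_real h - v n))"
      by (rule difference_quotient_l1[OF a v])
    have "(\<Sum>n. cmod (a (t + h) n - a t n)) =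
        (\<Sum>n. cmod (of_real h * (((a (t + h) n - a t n) / of_real h - v n) + v n)))"
      by (rule suminf_cong) (use eq in metis)
    then have "(\<Sum>n. cmod (a (t + h) n - a t n)) \<le> \<bar>h\<bar> * (?D h + ?V)"
      using l1_scale(2)[OF l1_add(1)[OF e v], of "of_real h"] l1_add(2)[OF e v]
      by (simp add: mult_left_mono)
    moreover have "(\<Sum>n. cmod (a (t + h) n)) \<le> (\<Sum>n. cmod (a (t + h) n - a t n)) + (\<Sum>n. cmod (a t n))"
      using l1_add(2)[OF l1_diff(1)[OF a a] a, of "t + h" t t] by simp
    moreover have "(\<Sum>n. cmod (a t n)) \<le> (\<Sum>n. cmod (a (t + h) n)) + (\<Sum>n. cmod (a (t + h) n - a t n))"
      using l1_diff(2)[OF a l1_diff(1)[OF a a], of "t + h" "t + h" t] by simp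
    ultimately show ?thesis by linarith
  qed
  have "((\<lambda>h. \<bar>h\<bar> * (?D h + ?V)) \<longlongrightarrow> \<bar>0\<bar> * (0 + ?V)) (at 0)"
    by (intro tendsto_intros D)
  then have lim: "((\<lambda>h. \<bar>h\<bar> * (?D h + ?V)) \<longlongrightarrow> 0) (at 0)" by simp
  have "((\<lambda>h. (\<Sum>n. cmod (a (t + h) n)) - (\<Sum>n. cmod (a t n))) \<longlongrightarrow> 0) (at 0)"
    by (rule Lim_null_comparison[OF _ lim])
       (auto simp: eventually_at intro!: exI[of _ 1] bound)
  then show ?thesis
    unfolding isCont_iff using LIM_zero_iff by blast
qed

text \<open>With difference quotient \<open>d h\<close>, |w + h d|^2 = |w|^2 + 2 h Re (cnj w d) +
  h^2 |d|^2. Replacing \<open>d h\<close> by \<open>v\<close> in the linear term costs at most 2 W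
  D(h), and the quadratic term divided by h is at most |h| (D(h) + V)^2.\<close>

lemma l1_derivative_square_norm:
  assumes w: "\<And>t. summable (\<lambda>n. cmod (w t n))" and "l1_derivative w v t"
  shows "((\<lambda>t. \<Sum>n. (cmod (w t n))\<^sup>2) has_real_derivative 2 * Re (\<Sum>n. cnj (w t n) * v n)) (at t)"
proof -
  define d where "d = (\<lambda>h n. (w (t + h) n - w t n) / of_real h)"
  define D where "D = (\<lambda>h. \<Sum>n. cmod (d h n - v n))"
  define W where "W = (\<Sum>n. cmod (w t n))"
  define V where "V = (\<Sum>n. cmod (v n))"
  have v: "summable (\<lambda>n. cmod (v n))" and D: "(D \<longlongrightarrow> 0) (at 0)"
    using assms(2) by (auto simp: l1_derivative_def D_def d_def)
  have dv: "summable (\<lambda>n. cmod (d h n - v n))" for h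
    unfolding d_def by (rule difference_quotient_l1[OF w v])
  have d: "summable (\<lambda>n. cmod (d h n))" and dle: "(\<Sum>n. cmod (d h n)) \<le> D h + V" for h
    using l1_add[OF dv v, of h] by (auto simp: D_def V_def)
  have prod: "summable (\<lambda>n. cnj (w t n) * b n)" if "summable (\<lambda>n. cmod (b n))" for b
    by (rule summable_norm_cancel) (use l1_product(1)[OF w that, of t] in \<open>simp add: norm_mult\<close>)
  have bound: "\<bar>((\<Sum>n. (cmod (w (t + h) n))\<^sup>2) - (\<Sum>n. (cmod (w t n))\<^sup>2)) / h
      - 2 * Re (\<Sum>n. cnj (w t n) * v n)\<bar> \<le> 2 * (W * D h) + \<bar>h\<bar> * (D h + V)\<^sup>2" if h: "h \<noteq> 0" for h
  proof -
    have "(cmod (w (t + h) n))\<^sup>2 - (cmod (w t n))\<^sup>2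
        = h * (2 * Re (cnj (w t n) * d h n)) + h * (h * (cmod (d h n))\<^sup>2)" for n
    proof -
      have "w (t + h) n = w t n + of_real h * d h n"
        using h by (simp add: d_def)
      then show ?thesis
        unfolding cmod_power2 by (simp add: power2_eq_square algebra_simps)
    qed
    moreover have "(\<lambda>n. Re (cnj (w t n) * d h n)) sums Re (\<Sum>n. cnj (w t n) * d h n)"
      using prod[OF d] by (intro sums_Re summable_sums)
    ultimately have "(\<lambda>n. (cmod (w (t + h) n))\<^sup>2 - (cmod (w t n))\<^sup>2) sums
        (h * (2 * Re (\<Sum>n. cnj (w t n) * d h n)) + h * (h * (\<Sum>n. (cmod (d h n))\<^sup>2)))"
      by (simp only:) (intro sums_add sums_mult summable_sums l1_square d)
    moreover have "(\<lambda>n. (cmod (w (t + h) n))\<^sup>2 - (cmod (w t n))\<^sup>2) sums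
        ((\<Sum>n. (cmod (w (t + h) n))\<^sup>2) - (\<Sum>n. (cmod (w t n))\<^sup>2))"
      by (intro sums_diff summable_sums l1_square w)
    ultimately have "(\<Sum>n. (cmod (w (t + h) n))\<^sup>2) - (\<Sum>n. (cmod (w t n))\<^sup>2) =
        h * (2 * Re (\<Sum>n. cnj (w t n) * d h n)) + h * (h * (\<Sum>n. (cmod (d h n))\<^sup>2))"
      by (rule sums_unique2[symmetric])
    then have "((\<Sum>n. (cmod (w (t + h) n))\<^sup>2) - (\<Sum>n. (cmod (w t n))\<^sup>2)) / h
        - 2 * Re (\<Sum>n. cnj (w t n) * v n) =
        2 * Re ((\<Sum>n. cnj (w t n) * d h n) - (\<Sum>n. cnj (w t n) * v n)) + h * (\<Sum>n. (cmod (d h n))\<^sup>2)"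
      using h by (simp add: field_simps)
    also have "(\<Sum>n. cnj (w t n) * d h n) - (\<Sum>n. cnj (w t n) * v n) = (\<Sum>n. cnj (w t n) * (d h n - v n))"
      using suminf_diff[OF prod[OF d] prod[OF v]] by (simp add: right_diff_distrib)
    finally have eq: "((\<Sum>n. (cmod (w (t + h) n))\<^sup>2) - (\<Sum>n. (cmod (w t n))\<^sup>2)) / h
        - 2 * Re (\<Sum>n. cnj (w t n) * v n) =
        2 * Re (\<Sum>n. cnj (w t n) * (d h n - v n)) + h * (\<Sum>n. (cmod (d h n))\<^sup>2)" .
    have "\<bar>Re (\<Sum>n. cnj (w t n) * (d h n - v n))\<bar> \<le> cmod (\<Sum>n. cnj (w t n) * (d h n - v n))"
      by (rule abs_Re_le_cmod)
    also have "\<dots> \<le> (\<Sum>n. cmod (cnj (w t n) * (d h n - v n)))"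
      by (rule summable_norm) (use l1_product(1)[OF w dv, of t h] in \<open>simp add: norm_mult\<close>)
    also have "\<dots> \<le> W * D h"
      unfolding W_def D_def using l1_product(2)[OF w dv, of t h] by (simp add: norm_mult)
    finally have 1: "\<bar>Re (\<Sum>n. cnj (w t n) * (d h n - v n))\<bar> \<le> W * D h" .
    have nonneg: "0 \<le> (\<Sum>n. cmod (d h n))"
      by (intro suminf_nonneg d) auto
    have "(\<Sum>n. (cmod (d h n))\<^sup>2) \<le> (D h + V)\<^sup>2"
      by (rule order_trans[OF l1_square(2)[OF d] power_mono[OF dle nonneg]])
    moreover have "0 \<le> (\<Sum>n. (cmod (d h n))\<^sup>2)"
      by (intro suminf_nonneg l1_square d) auto
    ultimately have 2: "\<bar>h * (\<Sum>n. (cmod (d h n))\<^sup>2)\<bar> \<le> \<bar>h\<bar> * (D h + V)\<^sup>2"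
      by (simp add: abs_mult mult_left_mono)
    show ?thesis unfolding eq using 1 2 by linarith
  qed
  have "((\<lambda>h. 2 * (W * D h) + \<bar>h\<bar> * (D h + V)\<^sup>2) \<longlongrightarrow> 2 * (W * 0) + \<bar>0\<bar> * (0 + V)\<^sup>2) (at 0)"
    by (intro tendsto_intros D)
  then have lim: "((\<lambda>h. 2 * (W * D h) + \<bar>h\<bar> * (D h + V)\<^sup>2) \<longlongrightarrow> 0) (at 0)" by simp
  have "((\<lambda>h. ((\<Sum>n. (cmod (w (t + h) n))\<^sup>2) - (\<Sum>n. (cmod (w t n))\<^sup>2)) / h
      - 2 * Re (\<Sum>n. cnj (w t n) * v n)) \<longlongrightarrow> 0) (at 0)"
    by (rule Lim_null_comparison[OF _ lim]) (auto simp: eventually_at intro!: exI[of _ 1] bound)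
  then show ?thesis
    unfolding DERIV_def using LIM_zero_iff by blast
qed

section \<open>The vector field on coefficients and the Gronwall estimate\<close>

definition szego_field :: "real \<Rightarrow> (nat \<Rightarrow> complex) \<Rightarrow> nat \<Rightarrow> complex" where
  "szego_field \<beta> a n = - \<i> * (cubic_coeff a n -
     of_real \<beta> * (case n of 0 \<Rightarrow> 0 | Suc m \<Rightarrow> cubic_coeff (\<lambda>k. a (Suc k)) m))"

text \<open>In the pairing, the shift moves to the other factor as its adjoint. The second term is
  then a cubic pairing for the sequences without their first entry, whose l1 and l2 norms do not
  exceed the original ones. Both pairings carry the constant 3, doubled by the factor in front of
  Re.\<close>

lemma szego_field_lipschitz:
  assumes a: "summable (\<lambda>n. cmod (a n))" and b: "summable (\<lambda>n. cmod (b n))"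
    and M: "(\<Sum>n. cmod (a n)) \<le> M" "(\<Sum>n. cmod (b n)) \<le> M"
  shows "2 * Re (\<Sum>n. cnj (a n - b n) * (szego_field \<beta> a n - szego_field \<beta> b n)) \<le>
    6 * (1 + \<bar>\<beta>\<bar>) * M\<^sup>2 * (\<Sum>n. (cmod (a n - b n))\<^sup>2)"
proof -
  let ?a = "\<lambda>k. a (Suc k)" and ?b = "\<lambda>k. b (Suc k)"
  let ?phi = "\<Sum>n. (cmod (a n - b n))\<^sup>2"
  have a': "summable (\<lambda>n. cmod (?a n))" and b': "summable (\<lambda>n. cmod (?b n))"
    using a b by (simp_all only: summable_Suc_iff[of "\<lambda>n. cmod (_ n)"])
  have tail: "(\<Sum>n. f (Suc n)) \<le> (\<Sum>n. f n)" if "summable f" "\<And>n. 0 \<le> f n" for f :: "nat \<Rightarrow> real"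
    using suminf_split_head[OF that(1)] that(2)[of 0] by linarith
  obtain I where I: "(\<lambda>n. cnj (a n - b n) * (cubic_coeff a n - cubic_coeff b n)) sums I"
    "cmod I \<le> 3 * M\<^sup>2 * ?phi"
    by (rule inner_cubic_diff[OF a b M])
  have M': "(\<Sum>n. cmod (?a n)) \<le> M" "(\<Sum>n. cmod (?b n)) \<le> M"
    using tail[OF a] tail[OF b] M by auto
  obtain J where J: "(\<lambda>n. cnj (?a n - ?b n) * (cubic_coeff ?a n - cubic_coeff ?b n)) sums J"
    "cmod J \<le> 3 * M\<^sup>2 * (\<Sum>n. (cmod (?a n - ?b n))\<^sup>2)"
    by (rule inner_cubic_diff[OF a' b' M'])
  have "(\<Sum>n. (cmod (?a n - ?b n))\<^sup>2) \<le> ?phi"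
    using tail[OF l1_square(1)[OF l1_diff(1)[OF a b]]] by simp
  then have J': "cmod J \<le> 3 * M\<^sup>2 * ?phi"
    by (intro order_trans[OF J(2)] mult_left_mono) auto
  \<comment> \<open>\<open>e\<close> is the shifted cubic difference. Its entry 0 vanishes, so
    adding that index to the tail sum leaves the value \<open>J\<close> unchanged.\<close>
  define e where "e = (\<lambda>n. case n of 0 \<Rightarrow> 0 | Suc m \<Rightarrow> cubic_coeff ?a m - cubic_coeff ?b m)"
  have "(\<lambda>n. cnj (a n - b n) * e n) sums (J + cnj (a 0 - b 0) * e 0)"
    by (rule sums_Suc) (use J(1) in \<open>simp add: e_def\<close>)
  then have Je: "(\<lambda>n. cnj (a n - b n) * e n) sums J" by (simp add: e_def)
  have "(\<lambda>n. - \<i> * (cnj (a n - b n) * (cubic_coeff a n - cubic_coeff b n) -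
      of_real \<beta> * (cnj (a n - b n) * e n))) sums (- \<i> * (I - of_real \<beta> * J))"
    by (intro sums_mult sums_diff I Je)
  moreover have "- \<i> * (cnj (a n - b n) * (cubic_coeff a n - cubic_coeff b n) -
      of_real \<beta> * (cnj (a n - b n) * e n)) =
      cnj (a n - b n) * (szego_field \<beta> a n - szego_field \<beta> b n)" for n
    unfolding szego_field_def e_def by (cases n) (simp_all add: algebra_simps)
  ultimately have "(\<Sum>n. cnj (a n - b n) * (szego_field \<beta> a n - szego_field \<beta> b n)) =
      - \<i> * (I - of_real \<beta> * J)"
    by (simp add: sums_iff)
  moreover have "Re (- \<i> * (I - of_real \<beta> * J)) \<le> cmod I + \<bar>\<beta>\<bar> * cmod J"
    using complex_Re_le_cmod[of "- \<i> * (I - of_real \<beta> * J)"] norm_triangle_ineq4[of I "of_real \<beta> * J"]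
    by (simp add: norm_mult)
  moreover have "\<bar>\<beta>\<bar> * cmod J \<le> \<bar>\<beta>\<bar> * (3 * M\<^sup>2 * ?phi)"
    by (intro mult_left_mono J') auto
  moreover have "6 * (1 + \<bar>\<beta>\<bar>) * M\<^sup>2 * ?phi = 2 * (3 * M\<^sup>2 * ?phi + \<bar>\<beta>\<bar> * (3 * M\<^sup>2 * ?phi))"
    by (simp add: algebra_simps)
  ultimately show ?thesis using I(2) by simp
qed

lemma szego_coefficients_unique:
  assumes a: "\<And>t. summable (\<lambda>n. cmod (a t n))" and b: "\<And>t. summable (\<lambda>n. cmod (b t n))"
    and a': "\<And>t. l1_derivative a (szego_field \<beta> (a t)) t"
    and b': "\<And>t. l1_derivative b (szego_field \<beta> (b t)) t"
    and init: "a 0 = b 0" and T: "T \<ge> 0"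
  shows "a T = b T"
proof -
  define \<phi> where "\<phi> = (\<lambda>t. \<Sum>n. (cmod (a t n - b t n))\<^sup>2)"
  define \<phi>' where "\<phi>' = (\<lambda>t. 2 * Re (\<Sum>n. cnj (a t n - b t n) * (szego_field \<beta> (a t) n - szego_field \<beta> (b t) n)))"
  have deriv: "(\<phi> has_real_derivative \<phi>' t) (at t)" for t
    unfolding \<phi>_def \<phi>'_def
    using l1_derivative_square_norm[OF l1_diff(1)[OF a b] l1_derivative_diff[OF a b a' b']] by simp
  \<comment> \<open>Each summand is nonnegative, so one bound on the sum serves as \<open>M\<close>
    for both solutions.\<close>
  let ?N = "\<lambda>t. (\<Sum>n. cmod (a t n)) + (\<Sum>n. cmod (b t n))"
  have "continuous_on {0..T} ?N"
    by (intro continuous_at_imp_continuous_on ballI continuous_add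
        l1_derivative_isCont[OF a a'] l1_derivative_isCont[OF b b'])
  then have "bounded (?N ` {0..T})"
    by (intro compact_imp_bounded compact_continuous_image) auto
  then obtain M where bounded: "\<forall>x\<in>?N ` {0..T}. norm x \<le> M"
    unfolding bounded_iff by blast
  have M: "?N t \<le> M" if "t \<in> {0..T}" for t
    using bspec[OF bounded imageI[OF that]] by (simp only: real_norm_def abs_le_iff)
  define K where "K = 6 * (1 + \<bar>\<beta>\<bar>) * M\<^sup>2"
  have le: "\<phi>' t \<le> K * \<phi> t" if "t \<in> {0..T}" for t
  proof -
    have "0 \<le> (\<Sum>n. cmod (a t n))" "0 \<le> (\<Sum>n. cmod (b t n))"
      by (auto intro!: suminf_nonneg a b)
    then show ?thesis
      unfolding \<phi>'_def \<phi>_def K_def using M[OF that] by (intro szego_field_lipschitz a b) auto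
  qed
  have "\<phi> T * exp (- K * T) \<le> \<phi> 0 * exp (- K * 0)"
  proof (rule DERIV_nonpos_imp_nonincreasing[OF T])
    fix t assume t: "0 \<le> t" "t \<le> T"
    have "((\<lambda>t. \<phi> t * exp (- K * t)) has_real_derivative (\<phi>' t - K * \<phi> t) * exp (- K * t)) (at t)"
      by (auto intro!: derivative_eq_intros deriv simp: algebra_simps)
    moreover have "(\<phi>' t - K * \<phi> t) * exp (- K * t) \<le> 0"
      using le[of t] t by (intro mult_nonpos_nonneg) auto
    ultimately show "\<exists>y. ((\<lambda>t. \<phi> t * exp (- K * t)) has_real_derivative y) (at t) \<and> y \<le> 0" by blast
  qed
  moreover have "\<phi> 0 = 0" unfolding \<phi>_def by (simp add: init)
  ultimately have "\<phi> T * exp (- K * T) \<le> 0" by simp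
  then have "\<phi> T \<le> 0" by (simp add: mult_le_0_iff)
  have summ: "summable (\<lambda>n. (cmod (a T n - b T n))\<^sup>2)"
    by (intro l1_square l1_diff a b)
  have "(cmod (a T n - b T n))\<^sup>2 \<le> \<phi> T" for n
    unfolding \<phi>_def using sum_le_suminf[OF summ, of "{n}"] by auto
  then have "(cmod (a T n - b T n))\<^sup>2 \<le> 0" for n
    using \<open>\<phi> T \<le> 0\<close> order_trans by blast
  then show ?thesis by (intro ext) simp
qed

section \<open>The equation in Fourier coefficients\<close>

lemma hseries_scale:
  assumes "summable (\<lambda>n. cmod (a n))" "cmod z = 1"
  shows "hseries (\<lambda>n. k * a n) z = k * hseries a z"
  unfolding hseries_def using assms
  by (subst suminf_mult[symmetric]) (auto intro!: hseries_summable simp: mult.assoc)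

definition shift_seq :: "(nat \<Rightarrow> complex) \<Rightarrow> nat \<Rightarrow> complex" where
  "shift_seq a n = (case n of 0 \<Rightarrow> 0 | Suc m \<Rightarrow> a m)"

lemma shift_seq_simps [simp]: "shift_seq a 0 = 0" "shift_seq a (Suc m) = a m"
  by (simp_all add: shift_seq_def)

lemma shift_seq_l1:
  assumes "summable (\<lambda>n. cmod (a n))"
  shows "summable (\<lambda>n. cmod (shift_seq a n))"
  using assms by (subst summable_Suc_iff[symmetric]) simp

lemma hseries_shift_seq:
  assumes "summable (\<lambda>n. cmod (a n))" "cmod z = 1"
  shows "hseries (shift_seq a) z = z * hseries a z"
proof -
  have "hseries (shift_seq a) z = (\<Sum>n. shift_seq a (Suc n) * z ^ Suc n)"
    unfolding hseries_def
    using suminf_split_head[OF hseries_summable(2)[OF shift_seq_l1[OF assms(1)] assms(2)]] by simp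
  also have "\<dots> = (\<Sum>n. z * (a n * z ^ n))"
    by (intro suminf_cong) (simp add: mult_ac)
  also have "\<dots> = z * hseries a z"
    unfolding hseries_def by (intro suminf_mult hseries_summable assms)
  finally show ?thesis .
qed

lemma szego_field_shift_seq:
  "szego_field \<beta> a = (\<lambda>n. - \<i> * (cubic_coeff a n - of_real \<beta> * shift_seq (cubic_coeff (\<lambda>k. a (Suc k))) n))"
  by (intro ext) (simp add: szego_field_def shift_seq_def)

lemma szego_field_l1:
  assumes a: "summable (\<lambda>n. cmod (a n))"
  shows "summable (\<lambda>n. cmod (szego_field \<beta> a n))"
proof -
  have "summable (\<lambda>n. cmod (a (Suc n)))"
    using a by (simp only: summable_Suc_iff[of "\<lambda>n. cmod (a n)"])
  then show ?thesis
    unfolding szego_field_shift_seq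
    by (intro l1_scale(1) l1_diff(1) cubic_coeff_l1 shift_seq_l1 a)
qed

lemma szego_projector_cubic:
  assumes "f \<in> L2_plus" and l1: "summable (\<lambda>n. cmod (fourier_coeff f (int n)))"
  shows "szego_projector (cubic f) = hardy_series (cubic_coeff (\<lambda>n. fourier_coeff f (int n)))"
proof -
  let ?a = "\<lambda>n. fourier_coeff f (int n)"
  have "AE z in circle_measure. f z = hseries ?a z"
    using assms by (intro L2_plus_eqI) (auto simp: hseries_L2_plus fourier_coeff_hseries)
  then have "AE z in circle_measure. cubic f z = cubic (hseries ?a) z"
    by eventually_elim (simp add: cubic_def)
  then have "fourier_coeff (cubic f) (int n) = cubic_coeff ?a n" for n
    unfolding cubic_coeff_def
    by (rule fourier_coeff_cong_AE) (use assms(1) in \<open>auto intro!: cubic_measurable dest!: L2_plus_L2_circle\<close>)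
  then show ?thesis
    unfolding szego_projector_def by (intro arg_cong[of _ _ hardy_series] ext)
qed

text \<open>Both projected cubic terms are \<open>hardy_series\<close> of l1 sequences, and the same
  holds for \<open>shift_adjoint f\<close>. Replacing each by its convergent series makes the
  right-hand side \<i> times the series of the vector field.\<close>

lemma szego_rhs_AE:
  assumes "f \<in> L2_plus" and l1: "summable (\<lambda>n. cmod (fourier_coeff f (int n)))"
  shows "AE z in circle_measure. szego_projector (cubic f) z
      - complex_of_real \<beta> * shift (szego_projector (cubic (shift_adjoint f))) z
      = \<i> * hseries (szego_field \<beta> (\<lambda>n. fourier_coeff f (int n))) z"
proof -
  define a where "a = (\<lambda>n. fourier_coeff f (int n))"
  define a' where "a' = (\<lambda>n. a (Suc n))"
  have a: "summable (\<lambda>n. cmod (a n))" using l1 by (simp add: a_def)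
  then have a': "summable (\<lambda>n. cmod (a' n))"
    unfolding a'_def by (simp only: summable_Suc_iff[of "\<lambda>n. cmod (a n)"])
  have adj: "shift_adjoint f = hardy_series a'"
    by (simp add: shift_adjoint_def a'_def a_def)
  have P1: "szego_projector (cubic f) = hardy_series (cubic_coeff a)"
    using szego_projector_cubic[OF assms] by (simp add: a_def)
  have P2: "szego_projector (cubic (shift_adjoint f)) = hardy_series (cubic_coeff a')"
    using szego_projector_cubic[of "hardy_series a'"] hardy_series_L2_plus[OF a'] a' by (simp add: adj)
  have c: "summable (\<lambda>n. cmod (cubic_coeff a n))" and c': "summable (\<lambda>n. cmod (cubic_coeff a' n))"
    by (intro cubic_coeff_l1 a a')+
  have sum: "\<i> * hseries (szego_field \<beta> a) z = hseries (cubic_coeff a) z - of_real \<beta> * (z * hseries (cubic_coeff a') z)"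
    if z: "cmod z = 1" for z
  proof -
    have B: "summable (\<lambda>n. cmod (of_real \<beta> * shift_seq (cubic_coeff a') n))"
      by (intro l1_scale(1) shift_seq_l1 c')
    have "hseries (szego_field \<beta> a) z =
        - \<i> * hseries (\<lambda>n. cubic_coeff a n - of_real \<beta> * shift_seq (cubic_coeff a') n) z"
      unfolding szego_field_shift_seq a'_def[symmetric] by (rule hseries_scale[OF l1_diff(1)[OF c B] z])
    also have "\<dots> = - \<i> * (hseries (cubic_coeff a) z - of_real \<beta> * (z * hseries (cubic_coeff a') z))"
      by (simp only: hseries_diff[OF c B z] hseries_scale[OF shift_seq_l1[OF c'] z] hseries_shift_seq[OF c' z])
    finally show ?thesis by simp
  qed
  \<comment> \<open>The series identities hold at points of the circle, so this fact has to be
    present when the almost-everywhere statements are combined.\<close>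
  have "AE z in circle_measure. z \<in> sphere 0 1"
    by (rule AE_I2) simp
  then show ?thesis
    using hardy_series_AE[OF c] hardy_series_AE[OF c']
    by eventually_elim (simp add: P1 P2 sum shift_def a_def[symmetric])
qed

lemma weighted_diff_summable:
  fixes w :: "nat \<Rightarrow> real"
  assumes "\<And>n. 0 \<le> w n" "summable (\<lambda>n. w n * (cmod (a n))\<^sup>2)" "summable (\<lambda>n. w n * (cmod (b n))\<^sup>2)"
  shows "summable (\<lambda>n. w n * (cmod (a n - b n))\<^sup>2)"
proof (rule summable_comparison_test)
  show "summable (\<lambda>n. 2 * (w n * (cmod (a n))\<^sup>2) + 2 * (w n * (cmod (b n))\<^sup>2))"
    by (intro summable_add summable_mult assms)
  have "w n * (cmod (a n - b n))\<^sup>2 \<le> w n * (2 * (cmod (a n))\<^sup>2 + 2 * (cmod (b n))\<^sup>2)" for n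
    by (intro mult_left_mono norm_diff_square_le assms)
  then show "\<exists>N. \<forall>n\<ge>N. norm (w n * (cmod (a n - b n))\<^sup>2) \<le> 2 * (w n * (cmod (a n))\<^sup>2) + 2 * (w n * (cmod (b n))\<^sup>2)"
    using assms(1) by (simp add: algebra_simps)
qed

text \<open>Treating the quotient as multiplication by 1 / h keeps the identity valid at h = 0,
  where both quotients are 0 by convention; later bounds then hold for all h and not just near the
  limit.\<close>

lemma fourier_coeff_difference_quotient:
  assumes "f \<in> L2_circle" "g \<in> L2_circle" "v \<in> L2_circle"
  shows "fourier_coeff (\<lambda>z. (f z - g z) / h - v z) n =
    (fourier_coeff f n - fourier_coeff g n) / h - fourier_coeff v n"
proof -
  have fg: "(\<lambda>z. (1 / h) * (f z - g z)) \<in> L2_circle"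
    by (intro L2_circle_cmult L2_circle_diff assms)
  have "fourier_coeff (\<lambda>z. (f z - g z) / h - v z) n = fourier_coeff (\<lambda>z. (1 / h) * (f z - g z) - v z) n"
    by simp
  also have "\<dots> = (1 / h) * (fourier_coeff f n - fourier_coeff g n) - fourier_coeff v n"
    by (simp only: fourier_coeff_diff[OF fg assms(3)] fourier_coeff_cmult fourier_coeff_diff[OF assms(1,2)])
  finally show ?thesis by simp
qed

lemma sobolev_plus_L2: "f \<in> sobolev_plus s \<Longrightarrow> f \<in> L2_circle" "f \<in> sobolev_plus s \<Longrightarrow> f \<in> L2_plus"
  by (auto simp: sobolev_plus_def sobolev_def)

text \<open>The embedding is applied to the difference quotient minus the derivative, so convergence
  in H^s becomes convergence in l1. From here on a solution is a differentiable l1 curve and s no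
  longer appears.\<close>

lemma beta_szego_solution_coeff:
  assumes s: "s > 1/2" and sol: "beta_szego_solution s \<beta> u0 u"
  defines "a \<equiv> \<lambda>t n. fourier_coeff (u t) (int n)"
  shows "summable (\<lambda>n. cmod (a t n))"
    and "l1_derivative a (szego_field \<beta> (a t)) t"
    and "u0 \<in> borel_measurable circle_measure \<Longrightarrow> a 0 n = fourier_coeff u0 (int n)"
proof -
  have u: "u t \<in> sobolev_plus s" for t
    using sol by (simp add: beta_szego_solution_def)
  show a: "summable (\<lambda>n. cmod (a t n))" for t
    unfolding a_def by (rule sobolev_plus_l1_coeff[OF s u])
  show "a 0 n = fourier_coeff u0 (int n)" if "u0 \<in> borel_measurable circle_measure"
    unfolding a_def using sol that sobolev_plus_L2(1)[OF u]
    by (intro fourier_coeff_cong_AE) (auto simp: beta_szego_solution_def)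
  obtain v where v: "v \<in> sobolev_plus s" and
    lim: "((\<lambda>h. sobolev_norm s (\<lambda>z. (u (t + h) z - u t z) / complex_of_real h - v z)) \<longlongrightarrow> 0) (at 0)" and
    eq: "AE z in circle_measure. \<i> * v z = szego_projector (cubic (u t)) z
             - complex_of_real \<beta> * shift (szego_projector (cubic (shift_adjoint (u t)))) z"
    using sol unfolding beta_szego_solution_def has_sobolev_derivative_def by blast
  have "AE z in circle_measure. v z = hseries (szego_field \<beta> (a t)) z"
    using eq szego_rhs_AE[OF sobolev_plus_L2(2)[OF u], of t \<beta>] a[of t]
    unfolding a_def by auto
  then have coeff: "fourier_coeff v (int n) = szego_field \<beta> (a t) n" for n
    using fourier_coeff_cong_AE[of v "hseries (szego_field \<beta> (a t))"] sobolev_plus_L2(1)[OF v]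
    by (auto simp: fourier_coeff_hseries szego_field_l1 a)
  let ?d = "\<lambda>h n. (a (t + h) n - a t n) / of_real h - szego_field \<beta> (a t) n"
  have d: "fourier_coeff (\<lambda>z. (u (t + h) z - u t z) / complex_of_real h - v z) (int n) = ?d h n" for h n
    unfolding a_def
    by (subst fourier_coeff_difference_quotient) (auto intro: sobolev_plus_L2 u v simp: coeff a_def)
  have w: "summable (\<lambda>n. (1 + real n) powr (2 * s) * (cmod (a t n))\<^sup>2)" for t
    unfolding a_def by (rule sobolev_plus_weighted_summable[OF u])
  have wd: "summable (\<lambda>n. (1 + real n) powr (2 * s) * (cmod (?d h n))\<^sup>2)" for h
  proof -
    have "summable (\<lambda>n. (1 + real n) powr (2 * s) * (cmod (szego_field \<beta> (a t) n))\<^sup>2)"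
      using sobolev_plus_weighted_summable[OF v] by (simp add: coeff)
    moreover have "summable (\<lambda>n. (1 + real n) powr (2 * s) * (cmod ((a (t + h) n - a t n) / of_real h))\<^sup>2)"
      using summable_mult[OF weighted_diff_summable[OF _ w w, of "t + h" t], of "1 / h\<^sup>2"]
      by (simp add: norm_divide power_divide)
    ultimately show ?thesis by (intro weighted_diff_summable) auto
  qed
  have "((\<lambda>h. \<Sum>n. cmod (?d h n)) \<longlongrightarrow> 0) (at 0)"
  proof (rule tendsto_sandwich[OF _ _ tendsto_const])
    show "((\<lambda>h. embedding_constant s * sobolev_norm s (\<lambda>z. (u (t + h) z - u t z) / complex_of_real h - v z)) \<longlongrightarrow> 0) (at 0)"
      using tendsto_mult[OF tendsto_const lim] by simp
    show "\<forall>\<^sub>F h in at 0. (\<Sum>n. cmod (?d h n)) \<le>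
        embedding_constant s * sobolev_norm s (\<lambda>z. (u (t + h) z - u t z) / complex_of_real h - v z)"
      using weighted_l2_embedding(2)[OF s wd] by (intro always_eventually allI) (simp add: sobolev_norm_def d)
    show "\<forall>\<^sub>F h in at 0. 0 \<le> (\<Sum>n. cmod (?d h n))"
      by (intro always_eventually allI suminf_nonneg weighted_l2_embedding(1)[OF s wd]) auto
  qed
  then show "l1_derivative a (szego_field \<beta> (a t)) t"
    unfolding l1_derivative_def using szego_field_l1[OF a] by simp
qed

text \<open>The converse passage: a coefficient curve solving the equation in the weighted l2 norm
  gives a strong solution through its concrete representatives.\<close>

lemma beta_szego_solution_hseries:
  assumes s: "s > 1/2"
    and w: "\<And>t. summable (\<lambda>n. (1 + real n) powr (2 * s) * (cmod (a t n))\<^sup>2)"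
    and wF: "\<And>t. summable (\<lambda>n. (1 + real n) powr (2 * s) * (cmod (szego_field \<beta> (a t) n))\<^sup>2)"
    and lim: "\<And>t. ((\<lambda>h. \<Sum>n. (1 + real n) powr (2 * s) *
      (cmod ((a (t + h) n - a t n) / of_real h - szego_field \<beta> (a t) n))\<^sup>2) \<longlongrightarrow> 0) (at 0)"
    and init: "\<And>z. cmod z = 1 \<Longrightarrow> hseries (a 0) z = u0 z"
  shows "beta_szego_solution s \<beta> u0 (\<lambda>t. hseries (a t))"
  unfolding beta_szego_solution_def
proof (intro conjI allI)
  have a: "summable (\<lambda>n. cmod (a t n))" for t
    by (rule weighted_l2_embedding(1)[OF s w])
  have F: "summable (\<lambda>n. cmod (szego_field \<beta> (a t) n))" for t
    by (rule weighted_l2_embedding(1)[OF s wF])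
  show u: "hseries (a t) \<in> sobolev_plus s" for t
    by (rule hseries_sobolev_plus[OF a w])
  show "AE z in circle_measure. hseries (a 0) z = u0 z"
    using init by (intro AE_I2) auto
  fix t
  have v: "hseries (szego_field \<beta> (a t)) \<in> sobolev_plus s"
    by (rule hseries_sobolev_plus[OF F wF])
  have "sobolev_norm s (\<lambda>z. (hseries (a (t + h)) z - hseries (a t) z) / of_real h - hseries (szego_field \<beta> (a t)) z) =
      sqrt (\<Sum>n. (1 + real n) powr (2 * s) *
      (cmod ((a (t + h) n - a t n) / of_real h - szego_field \<beta> (a t) n))\<^sup>2)" for h
    unfolding sobolev_norm_def
    by (subst fourier_coeff_difference_quotient)
       (auto intro!: hseries_L2_circle a F simp: fourier_coeff_hseries a F)
  then have "has_sobolev_derivative s (\<lambda>t. hseries (a t)) (hseries (szego_field \<beta> (a t))) t"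
    unfolding has_sobolev_derivative_def using v tendsto_real_sqrt[OF lim[of t]] by simp
  moreover have "AE z in circle_measure. \<i> * hseries (szego_field \<beta> (a t)) z = szego_projector (cubic (hseries (a t))) z
      - complex_of_real \<beta> * shift (szego_projector (cubic (shift_adjoint (hseries (a t))))) z"
    using szego_rhs_AE[OF hseries_L2_plus[OF a], of t \<beta>] a[of t]
    by (simp add: fourier_coeff_hseries a eq_commute)
  ultimately show "\<exists>v. has_sobolev_derivative s (\<lambda>t. hseries (a t)) v t \<and>
        (AE z in circle_measure. \<i> * v z = szego_projector (cubic (hseries (a t))) z
      - complex_of_real \<beta> * shift (szego_projector (cubic (shift_adjoint (hseries (a t))))) z)"
    by blast
qed

section \<open>Two-term geometric coefficient sequences\<close>

text \<open>With \<open>d = 0\<close> these are the coefficients of b + c z / (1 - p z). The last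
  slot is the variation in \<open>p\<close>: moving \<open>p\<close> with velocity p' contributes
  \<open>d = c * p'\<close>. The family of jets with base point \<open>p\<close> thus contains the
  tangent vectors of the rational family. At m = 0 the natural-number exponent \<open>m - 1\<close>
  is harmless because of the factor m.\<close>

definition jet :: "complex \<Rightarrow> complex \<Rightarrow> complex \<Rightarrow> complex \<Rightarrow> nat \<Rightarrow> complex" where
  "jet p b c d n = (case n of 0 \<Rightarrow> b | Suc m \<Rightarrow> c * p ^ m + d * (of_nat m * p ^ (m - 1)))"

lemma jet_simps [simp]:
  "jet p b c d 0 = b" "jet p b c d (Suc m) = c * p ^ m + d * (of_nat m * p ^ (m - 1))"
  by (simp_all add: jet_def)

section \<open>Weighted summability of jets\<close>

lemma powr_le_exp:
  fixes \<sigma> \<delta> y :: real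
  assumes "\<sigma> > 0" "\<delta> > 0" "y \<ge> 0"
  shows "y powr \<sigma> \<le> (\<sigma> / \<delta>) powr \<sigma> * exp (\<delta> * y)"
proof -
  \<comment> \<open>The inequality x \<le> exp x at x = \<delta> y / \<sigma>, to be raised to the
    power \<sigma>.\<close>
  have "\<delta> * y / \<sigma> \<le> exp (\<delta> * y / \<sigma>)"
    using exp_ge_add_one_self[of "\<delta> * y / \<sigma>"] by linarith
  then have "(\<delta> * y / \<sigma>) powr \<sigma> \<le> exp (\<delta> * y / \<sigma>) powr \<sigma>"
    using assms by (intro powr_mono2) auto
  also have "\<dots> = exp (\<delta> * y)"
    using assms by (simp add: powr_def)
  finally have "(\<sigma> / \<delta>) powr \<sigma> * (\<delta> * y / \<sigma>) powr \<sigma> \<le> (\<sigma> / \<delta>) powr \<sigma> * exp (\<delta> * y)"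
    by (intro mult_left_mono) auto
  moreover have "(\<sigma> / \<delta>) powr \<sigma> * (\<delta> * y / \<sigma>) powr \<sigma> = y powr \<sigma>"
    using assms by (subst powr_mult[symmetric]) auto
  ultimately show ?thesis by simp
qed

lemma summable_powr_geometric:
  fixes r \<sigma> :: real
  assumes "\<sigma> > 0" "0 < r" "r < 1"
  shows "summable (\<lambda>n. (1 + real n) powr \<sigma> * r ^ n)"
proof (rule summable_comparison_test)
  \<comment> \<open>Half of the exponential decay absorbs the power weight, the other half remains
    as a convergent geometric series.\<close>
  define \<delta> where "\<delta> = - ln r / 2"
  define K where "K = (\<sigma> / \<delta>) powr \<sigma>"
  have \<delta>: "\<delta> > 0" using assms by (simp add: \<delta>_def)
  have "(1 + real n) powr \<sigma> * r ^ n \<le> K * exp \<delta> * exp (- \<delta>) ^ n" for n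
  proof -
    have r: "r = exp (- 2 * \<delta>)" using assms by (simp add: \<delta>_def)
    have "(1 + real n) powr \<sigma> * r ^ n \<le> (K * exp (\<delta> * (1 + real n))) * r ^ n"
      unfolding K_def using assms \<delta> by (intro mult_right_mono powr_le_exp) auto
    also have "\<dots> = K * exp \<delta> * exp (- \<delta>) ^ n"
      unfolding r by (simp add: exp_of_nat_mult[symmetric] exp_add[symmetric] algebra_simps)
    finally show ?thesis .
  qed
  then show "\<exists>N. \<forall>n\<ge>N. norm ((1 + real n) powr \<sigma> * r ^ n) \<le> K * exp \<delta> * exp (- \<delta>) ^ n"
    using assms by auto
  show "summable (\<lambda>n. K * exp \<delta> * exp (- \<delta>) ^ n)"
    using \<delta> by (intro summable_mult summable_geometric) auto
qed

text \<open>The division by \<open>\<rho>\<^sup>2\<close> makes up for the index loss: entry n = m +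
  1 of a jet contains the power m - 1 = n - 2 of \<open>p\<close>.\<close>

definition jet_majorant :: "real \<Rightarrow> real \<Rightarrow> nat \<Rightarrow> real" where
  "jet_majorant L \<rho> n = L / \<rho>\<^sup>2 * ((1 + real n) * \<rho> ^ n)"

lemma norm_jet_le:
  assumes "0 < \<rho>" "\<rho> < 1" "cmod p \<le> \<rho>" "cmod b + cmod c + cmod d \<le> L"
  shows "cmod (jet p b c d n) \<le> jet_majorant L \<rho> n"
proof -
  define R where "R = (1 + real n) * \<rho> ^ n / \<rho>\<^sup>2"
  have \<rho>2: "\<rho>\<^sup>2 \<le> 1" "\<rho> ^ m / \<rho>\<^sup>2 \<ge> \<rho> ^ m" for m
    using assms(1,2) by (auto simp: power_le_one field_simps mult_left_le)
  have R: "R \<ge> 0" using assms by (auto simp: R_def)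
  have "cmod (jet p b c d n) \<le> cmod b * R + cmod c * R + cmod d * R"
  proof (cases n)
    case 0
    then have "1 \<le> R" using \<rho>2(2)[of 0] by (simp add: R_def)
    then have "cmod b \<le> cmod b * R" by (simp add: mult_le_cancel_left1)
    then show ?thesis using R by (simp add: 0 add_increasing2)
  next
    case (Suc m)
    have "cmod p ^ m \<le> R"
    proof -
      have "cmod p ^ m \<le> \<rho> ^ m" using assms by (intro power_mono) auto
      also have "\<dots> \<le> \<rho> ^ m / \<rho>" using assms by (auto simp: field_simps mult_left_le)
      also have "\<dots> = 1 * \<rho> ^ n / \<rho>\<^sup>2" using assms by (simp add: Suc power2_eq_square)
      also have "\<dots> \<le> R" unfolding R_def using assms by (intro divide_right_mono mult_right_mono) auto
      finally show ?thesis .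
    qed
    then have 1: "cmod (c * p ^ m) \<le> cmod c * R" by (simp add: norm_mult norm_power mult_left_mono)
    have "real m * cmod p ^ (m - 1) \<le> R"
    proof (cases m)
      case (Suc k)
      have "real m * cmod p ^ (m - 1) \<le> (1 + real n) * \<rho> ^ k"
        using assms \<open>n = Suc m\<close> Suc by (intro mult_mono) (auto intro!: power_mono)
      also have "\<dots> = R" using assms \<open>n = Suc m\<close> Suc by (simp add: R_def power2_eq_square)
      finally show ?thesis .
    qed (use R in auto)
    then have "cmod (d * (of_nat m * p ^ (m - 1))) \<le> cmod d * R"
      by (simp add: norm_mult norm_power mult_left_mono)
    then show ?thesis
      using 1 norm_triangle_ineq[of "c * p ^ m" "d * (of_nat m * p ^ (m - 1))"] mult_nonneg_nonneg[OF norm_ge_zero R, of b]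
      unfolding Suc jet_simps by linarith
  qed
  also have "\<dots> = (cmod b + cmod c + cmod d) * R" by (simp add: algebra_simps)
  also have "\<dots> \<le> L * R" using R assms by (intro mult_right_mono) auto
  finally show ?thesis by (simp add: jet_majorant_def R_def)
qed

lemma weighted_majorant_summable:
  assumes "0 < \<rho>" "\<rho> < 1" "\<sigma> > 0"
  shows "summable (\<lambda>n. (1 + real n) powr \<sigma> * (jet_majorant L \<rho> n)\<^sup>2)"
proof -
  have "summable (\<lambda>n. (L / \<rho>\<^sup>2)\<^sup>2 * ((1 + real n) powr (\<sigma> + 2) * (\<rho>\<^sup>2) ^ n))"
    using assms by (intro summable_mult summable_powr_geometric) (auto simp: power_less_one_iff)
  moreover have "(L / \<rho>\<^sup>2)\<^sup>2 * ((1 + real n) powr (\<sigma> + 2) * (\<rho>\<^sup>2) ^ n) =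
      (1 + real n) powr \<sigma> * (jet_majorant L \<rho> n)\<^sup>2" for n
    by (simp add: jet_majorant_def powr_add powr_numeral power_mult_distrib power_divide
        power_mult[symmetric] mult.commute)
  ultimately show ?thesis by simp
qed

text \<open>Choosing \<rho> strictly between |p| and 1 keeps it positive even when p = 0, as the
  majorant requires.\<close>

lemma jet_weighted_summable:
  assumes "cmod p < 1" "\<sigma> > 0"
  shows "summable (\<lambda>n. (1 + real n) powr \<sigma> * (cmod (jet p b c d n))\<^sup>2)"
proof -
  obtain \<rho> where \<rho>: "cmod p < \<rho>" "\<rho> < 1" using dense[OF assms(1)] by auto
  then have "0 < \<rho>" using norm_ge_zero[of p] by linarith
  then show ?thesis
    using \<rho> assms(2)
    by (intro summable_comparison_test[OF _ weighted_majorant_summable[of \<rho> \<sigma> "cmod b + cmod c + cmod d"]])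
       (auto intro!: exI[of _ 0] mult_left_mono power_mono norm_jet_le)
qed

lemma jet_l1:
  assumes "cmod p < 1"
  shows "summable (\<lambda>n. cmod (jet p b c d n))"
  using weighted_l2_embedding(1)[of 1 "jet p b c d"] jet_weighted_summable[OF assms, of 2 b c d] by simp

lemma hseries_jet:
  assumes p: "cmod p < 1" and z: "cmod z = 1"
  shows "hseries (jet p b c d) z = b + c * z / (1 - p * z) + d * z\<^sup>2 / (1 - p * z)\<^sup>2"
proof -
  have pz: "cmod (p * z) < 1" using p z by (simp add: norm_mult)
  have g: "(\<lambda>m. (p * z) ^ m) sums (1 / (1 - p * z))"
    using pz by (rule geometric_sums)
  have "(\<lambda>m. of_nat (Suc m) * (p * z) ^ (Suc m - 1)) sums (1 / (1 - p * z)\<^sup>2)"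
    using geometric_deriv_sums[OF pz] by simp
  then have g': "(\<lambda>m. of_nat m * (p * z) ^ (m - 1)) sums (1 / (1 - p * z)\<^sup>2)"
    by (subst (asm) sums_Suc_iff) simp
  have "(\<lambda>m. c * z * (p * z) ^ m + d * z\<^sup>2 * (of_nat m * (p * z) ^ (m - 1))) sums
      (c * z * (1 / (1 - p * z)) + d * z\<^sup>2 * (1 / (1 - p * z)\<^sup>2))"
    by (intro sums_add sums_mult g g')
  moreover have "c * z * (p * z) ^ m + d * z\<^sup>2 * (of_nat m * (p * z) ^ (m - 1)) = jet p b c d (Suc m) * z ^ Suc m" for m
    by (cases m) (simp_all add: power_mult_distrib algebra_simps power2_eq_square)
  ultimately have "(\<lambda>m. jet p b c d (Suc m) * z ^ Suc m) sums
      (c * z * (1 / (1 - p * z)) + d * z\<^sup>2 * (1 / (1 - p * z)\<^sup>2))"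
    by simp
  then have "(\<lambda>m. jet p b c d m * z ^ m) sums
      (c * z * (1 / (1 - p * z)) + d * z\<^sup>2 * (1 / (1 - p * z)\<^sup>2) + jet p b c d 0 * z ^ 0)"
    by (rule sums_Suc)
  then show ?thesis
    unfolding hseries_def by (simp add: sums_iff algebra_simps)
qed

section \<open>The vector field on jets\<close>

text \<open>Splitting the cubic expression into a Hardy part and the conjugate of a Hardy part
  computes the projection. The condition \<open>h 0 = 0\<close> assigns the constant mode to
  \<open>g\<close> alone.\<close>

lemma cubic_coeff_eqI:
  assumes a: "summable (\<lambda>n. cmod (a n))" and g: "summable (\<lambda>n. cmod (g n))"
    and h: "summable (\<lambda>n. cmod (h n))" "h 0 = 0"
    and eq: "\<And>z. cmod z = 1 \<Longrightarrow> cubic (hseries a) z = hseries g z + cnj (hseries h z)"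
  shows "cubic_coeff a = g"
proof
  fix n
  have cnj_measurable: "(\<lambda>z. cnj (hseries h z)) \<in> borel_measurable circle_measure"
    by (intro measurable_compose[OF hseries_measurable] borel_measurable_continuous_onI continuous_intros)
  have "(\<lambda>z. cnj (hseries h z)) \<in> L2_circle"
    using norm_hseries_le[OF h(1)] by (intro L2_circle_bounded[OF cnj_measurable]) auto
  note L2 = hseries_L2_circle[OF g] this
  have "cubic_coeff a n = (LINT z|circle_measure. hseries g z * z powi - int n + cnj (hseries h z) * z powi - int n)"
    unfolding cubic_coeff_def fourier_coeff_def
    by (intro Bochner_Integration.integral_cong) (auto simp: eq algebra_simps)
  also have "\<dots> = fourier_coeff (hseries g) (int n) + (LINT z|circle_measure. cnj (hseries h z) * z powi - int n)"
    unfolding fourier_coeff_def using L2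
    by (intro Bochner_Integration.integral_add L2_circle_integrable_powi)
  also have "(LINT z|circle_measure. cnj (hseries h z) * z powi - int n) =
      (LINT z|circle_measure. cnj (hseries h z * z powi int n))"
    by (intro Bochner_Integration.integral_cong refl)
       (auto simp: power_int_minus power_inverse[symmetric] cnj_eq_inverse_on_circle)
  also have "\<dots> = cnj (fourier_coeff (hseries h) (- int n))"
    unfolding fourier_coeff_def by (simp only: Bochner_Integration.integral_cnj minus_minus)
  also have "\<dots> = 0"
    using h by (simp add: fourier_coeff_hseries)
  finally show "cubic_coeff a n = g n"
    by (simp add: fourier_coeff_hseries g)
qed

text \<open>On the circle cnj z = 1 / z, so the cubic expression is rational with poles from 1 - p z
  and from its conjugate; partial fractions separate them. \<open>y\<close> stands for 1 / (1 -
  |p|^2) and is given by a polynomial equation so that the identities are purely algebraic.\<close>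

lemma cubic_coeff_jet:
  assumes p: "cmod p < 1" and y: "y * (1 - p * cnj p) = 1"
  shows "cubic_coeff (jet p b c 0) = jet p
    (b * b * cnj b + 2 * b * c * cnj c * y + c * c * cnj c * y\<^sup>2 * cnj p)
    (2 * b * cnj b * c + 2 * b * c * cnj c * y * p + c * c * cnj c * y\<^sup>2)
    (cnj b * c\<^sup>2 + c * c * cnj c * y * p)"
    (is "_ = jet p ?B ?C ?D")
proof (rule cubic_coeff_eqI[OF jet_l1[OF p] jet_l1[OF p] jet_l1[OF p]])
  \<comment> \<open>The total coefficient of the conjugate pole: the direct product contributes the
    first summand, \<open>key1\<close> the second and \<open>key2\<close> the third.\<close>
  define K where "K = b\<^sup>2 * cnj c + 2 * b * c * cnj c * y * cnj p + c * c * cnj c * y\<^sup>2 * (cnj p)\<^sup>2"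
  show "jet p 0 (cnj K) 0 0 = 0" by simp
  fix z :: complex assume z: "cmod z = 1"
  define w where "w = cnj z"
  define e where "e = 1 / (1 - p * z)"
  define e' where "e' = 1 / (1 - cnj p * w)"
  have "cmod (p * z) < 1" using p z by (simp add: norm_mult)
  then have "p * z \<noteq> 1" by auto
  then have e: "e * (1 - p * z) = 1" by (simp add: e_def)
  have e'cnj: "e' = cnj e" by (simp add: e'_def e_def w_def)
  then have e': "e' * (1 - cnj p * w) = 1"
    using arg_cong[OF e, of cnj] by (simp add: w_def)
  have zw: "z * w = 1"
    using z complex_norm_square[of z] by (simp add: w_def)
  \<comment> \<open>The expansion of the Poisson kernel, (1 - |p|^2) / |1 - p z|^2 = 1 + 2 Re (p z
    e). Multiplying it by z e and using it once more gives \<open>key2\<close>.\<close>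
  have key1: "e * e' = y * (1 + p * z * e + cnj p * w * e')"
    using zw e e' y by algebra
  have key2: "z * e\<^sup>2 * e' = y * (p * z\<^sup>2 * e\<^sup>2 + y * z * e + y * cnj p * (1 + cnj p * w * e'))"
    using zw e e' y key1 by algebra
  have u: "hseries (jet p b c 0) z = b + c * z * e"
    by (simp add: hseries_jet[OF p z] e_def)
  have "cubic (hseries (jet p b c 0)) z = (b + c * z * e)\<^sup>2 * (cnj b + cnj c * w * e')"
    unfolding cubic_def u e'cnj complex_norm_square w_def by (simp add: power2_eq_square)
  also have "\<dots> = cnj b * (b + c * z * e)\<^sup>2 + b\<^sup>2 * cnj c * w * e' + 2 * b * c * cnj c * (e * e')
      + c\<^sup>2 * cnj c * (z * e\<^sup>2 * e')"
    using zw by algebra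
  also have "\<dots> = (?B + ?C * z * e + ?D * z\<^sup>2 * e\<^sup>2) + K * w * e'"
    unfolding key1 key2 K_def by (simp add: power2_eq_square algebra_simps)
  also have "\<dots> = hseries (jet p ?B ?C ?D) z + cnj (hseries (jet p 0 (cnj K) 0) z)"
    by (simp add: hseries_jet[OF p z] e_def e'_def w_def power_divide)
  finally show "cubic (hseries (jet p b c 0)) z =
      hseries (jet p ?B ?C ?D) z + cnj (hseries (jet p 0 (cnj K) 0) z)" .
qed

text \<open>The shifted second cubic term reproduces exactly the contributions of the first that are
  purely cubic in \<open>c\<close>, in both the simple and the double pole, whence the factor 1 -
  \<beta>. The last slot is displayed as \<open>c\<close> times a bracket because that bracket is
  the velocity of \<open>p\<close>: the field is tangent to the rational family.\<close>

lemma szego_field_jet: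
  assumes p: "cmod p < 1" and y: "y * (1 - p * cnj p) = 1"
  shows "szego_field \<beta> (jet p b c 0) = jet p
    (- \<i> * (b * b * cnj b + 2 * b * c * cnj c * y + c * c * cnj c * y\<^sup>2 * cnj p))
    (- \<i> * (2 * b * cnj b * c + 2 * b * c * cnj c * y * p + (1 - of_real \<beta>) * c * c * cnj c * y\<^sup>2))
    (c * (- \<i> * (cnj b * c + (1 - of_real \<beta>) * c * cnj c * y * p)))"
proof
  fix n
  \<comment> \<open>The adjoint shift replaces (b, c) by (c, c p) and keeps p, so the formula for
    the cubic term applies a second time.\<close>
  have tail: "(\<lambda>k. jet p b c 0 (Suc k)) = jet p c (c * p) 0"
  proof
    fix k show "jet p b c 0 (Suc k) = jet p c (c * p) 0 k" by (cases k) simp_all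
  qed
  have "cubic_coeff (jet p c (c * p) 0) m =
      c * c * cnj c * y\<^sup>2 * p ^ m + c * c * cnj c * y * p * (of_nat m * p ^ (m - 1))" for m
  proof (cases m)
    case 0
    have "c * c * cnj c + 2 * c * (c * p) * cnj (c * p) * y + (c * p) * (c * p) * cnj (c * p) * y\<^sup>2 * cnj p
        = c * c * cnj c * y\<^sup>2"
      unfolding complex_cnj_mult using y by algebra
    then show ?thesis by (simp add: cubic_coeff_jet[OF p y] 0)
  next
    case (Suc k)
    have C: "2 * c * cnj c * (c * p) + 2 * c * (c * p) * cnj (c * p) * y * p + (c * p) * (c * p) * cnj (c * p) * y\<^sup>2
        = c * c * cnj c * p * (y\<^sup>2 + y)"
      unfolding complex_cnj_mult using y by algebra
    have D: "cnj c * (c * p)\<^sup>2 + (c * p) * (c * p) * cnj (c * p) * y * p = c * c * cnj c * y * p\<^sup>2"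
      unfolding complex_cnj_mult using y by algebra
    show ?thesis
      unfolding cubic_coeff_jet[OF p y] Suc jet_simps C D
      by (cases k) (simp_all add: algebra_simps power2_eq_square)
  qed
  then show "szego_field \<beta> (jet p b c 0) n = jet p
    (- \<i> * (b * b * cnj b + 2 * b * c * cnj c * y + c * c * cnj c * y\<^sup>2 * cnj p))
    (- \<i> * (2 * b * cnj b * c + 2 * b * c * cnj c * y * p + (1 - of_real \<beta>) * c * c * cnj c * y\<^sup>2))
    (c * (- \<i> * (cnj b * c + (1 - of_real \<beta>) * c * cnj c * y * p))) n"
    unfolding szego_field_def tail cubic_coeff_jet[OF p y]
    by (cases n) (simp_all add: algebra_simps power2_eq_square)
qed

section \<open>Curves of jets in Sobolev norm\<close>

lemma jet_has_vector_derivative: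
  assumes "(p has_vector_derivative p') (at t within S)" "(b has_vector_derivative b') (at t within S)"
    "(c has_vector_derivative c') (at t within S)"
  shows "((\<lambda>t. jet (p t) (b t) (c t) 0 n) has_vector_derivative jet (p t) b' c' (c t * p') n) (at t within S)"
proof (cases n)
  case (Suc m)
  have "((\<lambda>t. p t ^ m) has_vector_derivative of_nat m * p t ^ (m - 1) * p') (at t within S)"
  proof -
    have "((\<lambda>z. z ^ m) has_field_derivative of_nat m * p t ^ (m - 1)) (at (p t))"
      by (auto intro!: derivative_eq_intros)
    then show ?thesis
      using field_vector_diff_chain_within[OF assms(1), of "\<lambda>z. z ^ m"] has_field_derivative_at_within
      by (fastforce simp: o_def mult_ac)
  qed
  from has_vector_derivative_mult[OF assms(3) this] show ?thesis
    by (simp add: Suc algebra_simps)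
qed (use assms in simp)

lemma bounded_norm_on_interval:
  fixes f :: "real \<Rightarrow> complex"
  assumes "continuous_on UNIV f"
  obtains B where "\<And>x. x \<in> {a..b} \<Longrightarrow> cmod (f x) \<le> B"
proof -
  have "bounded (f ` {a..b})"
    by (intro compact_imp_bounded compact_continuous_image continuous_on_subset[OF assms]) auto
  then show ?thesis using that unfolding bounded_iff by blast
qed

text \<open>Entrywise differentiability is lifted to the weighted sum by Tannery's theorem. On
  [t - 1, t + 1] compactness keeps |p| below some \<rho> < 1, so the entrywise derivatives have a
  common majorant \<open>B\<close>; the mean value inequality passes it to the difference quotients.
  Their difference is at most 2 \<open>B\<close>, and squaring gives the factor 4.\<close>

lemma jet_curve_sobolev_derivative:
  assumes deriv: "\<And>t. (p has_vector_derivative p' t) (at t)" "\<And>t. (b has_vector_derivative b' t) (at t)"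
      "\<And>t. (c has_vector_derivative c' t) (at t)"
    and cont: "continuous_on UNIV p'" "continuous_on UNIV b'" "continuous_on UNIV c'"
    and p: "\<And>t. cmod (p t) < 1" and \<sigma>: "\<sigma> > 0"
  shows "((\<lambda>h. \<Sum>n. (1 + real n) powr \<sigma> *
      (cmod ((jet (p (t + h)) (b (t + h)) (c (t + h)) 0 n - jet (p t) (b t) (c t) 0 n) / of_real h
        - jet (p t) (b' t) (c' t) (c t * p' t) n))\<^sup>2) \<longlongrightarrow> 0) (at 0)"
proof -
  define I where "I = {t - 1..t + 1}"
  define A where "A = (\<lambda>t n. jet (p t) (b t) (c t) 0 n)"
  define A' where "A' = (\<lambda>t n. jet (p t) (b' t) (c' t) (c t * p' t) n)"
  have contp: "continuous_on UNIV p" "continuous_on UNIV c"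
    using deriv by (auto intro!: continuous_at_imp_continuous_on has_vector_derivative_continuous)
  obtain \<rho> where \<rho>: "0 < \<rho>" "\<rho> < 1" "\<And>x. x \<in> I \<Longrightarrow> cmod (p x) \<le> \<rho>"
  proof -
    have "\<exists>x0\<in>I. \<forall>x\<in>I. cmod (p x) \<le> cmod (p x0)"
      unfolding I_def
      by (intro continuous_attains_sup continuous_on_norm continuous_on_subset[OF contp(1)]) auto
    then obtain x0 where x0: "\<And>x. x \<in> I \<Longrightarrow> cmod (p x) \<le> cmod (p x0)" by blast
    obtain r where r: "cmod (p x0) < r" "r < 1" using dense[OF p] by blast
    show ?thesis
    proof (rule that[of r])
      show "0 < r" using r norm_ge_zero[of "p x0"] by linarith
      show "cmod (p x) \<le> r" if "x \<in> I" for x using x0[OF that] r by linarith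
    qed (use r in auto)
  qed
  obtain L1 where L1: "\<And>x. x \<in> I \<Longrightarrow> cmod (b' x) \<le> L1"
    unfolding I_def by (rule bounded_norm_on_interval[OF cont(2)]) blast
  obtain L2 where L2: "\<And>x. x \<in> I \<Longrightarrow> cmod (c' x) \<le> L2"
    unfolding I_def by (rule bounded_norm_on_interval[OF cont(3)]) blast
  obtain L3 where L3: "\<And>x. x \<in> I \<Longrightarrow> cmod (c x * p' x) \<le> L3"
    unfolding I_def by (rule bounded_norm_on_interval[OF continuous_on_mult[OF contp(2) cont(1)]]) blast
  define B where "B = jet_majorant (L1 + L2 + L3) \<rho>"
  have A'B: "cmod (A' x n) \<le> B n" if "x \<in> I" for x n
    unfolding A'_def B_def using \<rho> L1 L2 L3 that by (intro norm_jet_le add_mono) auto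
  have derivA: "((\<lambda>t. A t n) has_vector_derivative A' x n) (at x within S)" for x n S
    unfolding A_def A'_def
    by (intro jet_has_vector_derivative has_vector_derivative_at_within[OF deriv(1)]
        has_vector_derivative_at_within[OF deriv(2)] has_vector_derivative_at_within[OF deriv(3)])
  have quot: "cmod ((A (t + h) n - A t n) / of_real h) \<le> B n" if h: "h \<noteq> 0" "\<bar>h\<bar> \<le> 1" for h n
  proof -
    have "norm (A (t + h) n - A t n) \<le> B n * norm ((t + h) - t)"
    proof (rule differentiable_bound)
      show "convex I" by (simp add: I_def)
      fix x assume "x \<in> I"
      show "((\<lambda>t. A t n) has_derivative (\<lambda>k. k *\<^sub>R A' x n)) (at x within I)"
        using derivA by (simp add: has_vector_derivative_def)
      show "onorm (\<lambda>k. k *\<^sub>R A' x n) \<le> B n"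
        using A'B[OF \<open>x \<in> I\<close>, of n]
        by (intro onorm_le) (auto simp: mult.commute[of "B n"] intro!: mult_left_mono)
    qed (use h in \<open>auto simp: I_def\<close>)
    then show ?thesis using h by (simp add: norm_divide field_simps)
  qed
  have tendsto_term: "((\<lambda>h. (1 + real n) powr \<sigma> * (cmod ((A (t + h) n - A t n) / of_real h - A' t n))\<^sup>2) \<longlongrightarrow> 0) (at 0)" for n
  proof -
    have "((\<lambda>h. norm (((\<lambda>t. A t n) (t + h) - A t n - h *\<^sub>R A' t n)) / norm h) \<longlongrightarrow> 0) (at 0)"
      using derivA[of n t UNIV] unfolding has_vector_derivative_def has_derivative_at by simp
    moreover have "norm (A (t + h) n - A t n - h *\<^sub>R A' t n) / norm h = cmod ((A (t + h) n - A t n) / of_real h - A' t n)"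
      if "h \<noteq> 0" for h
    proof -
      have "(A (t + h) n - A t n) / of_real h - A' t n = (A (t + h) n - A t n - h *\<^sub>R A' t n) / of_real h"
        using that by (simp add: scaleR_conv_of_real field_simps)
      then show ?thesis by (simp add: norm_divide)
    qed
    ultimately have "((\<lambda>h. cmod ((A (t + h) n - A t n) / of_real h - A' t n)) \<longlongrightarrow> 0) (at 0)"
      by (subst (asm) tendsto_cong[where g = "\<lambda>h. cmod ((A (t + h) n - A t n) / of_real h - A' t n)"])
         (auto simp: eventually_at intro!: exI[of _ 1])
    then have "((\<lambda>h. (1 + real n) powr \<sigma> * (cmod ((A (t + h) n - A t n) / of_real h - A' t n))\<^sup>2)
        \<longlongrightarrow> (1 + real n) powr \<sigma> * 0\<^sup>2) (at 0)"
      by (intro tendsto_intros)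
    then show ?thesis by simp
  qed
  have bound: "norm ((1 + real n) powr \<sigma> * (cmod ((A (t + h) n - A t n) / of_real h - A' t n))\<^sup>2)
      \<le> 4 * ((1 + real n) powr \<sigma> * (B n)\<^sup>2)" if h: "h \<noteq> 0" "\<bar>h\<bar> \<le> 1" for h n
  proof -
    have "cmod ((A (t + h) n - A t n) / of_real h - A' t n) \<le> 2 * B n"
      using quot[OF h, of n] A'B[of t n] norm_triangle_ineq4[of "(A (t + h) n - A t n) / of_real h" "A' t n"]
      by (simp add: I_def)
    then have "(cmod ((A (t + h) n - A t n) / of_real h - A' t n))\<^sup>2 \<le> (2 * B n)\<^sup>2"
      by (intro power_mono) auto
    then have "(1 + real n) powr \<sigma> * (cmod ((A (t + h) n - A t n) / of_real h - A' t n))\<^sup>2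
        \<le> (1 + real n) powr \<sigma> * (2 * B n)\<^sup>2"
      by (intro mult_left_mono) auto
    then show ?thesis by (simp add: power_mult_distrib)
  qed
  have "((\<lambda>h. \<Sum>n. (1 + real n) powr \<sigma> * (cmod ((A (t + h) n - A t n) / of_real h - A' t n))\<^sup>2)
      \<longlongrightarrow> (\<Sum>n. 0)) (at 0)"
  proof (rule tannerys_theorem[THEN conjunct2, THEN conjunct2])
    show "summable (\<lambda>n. 4 * ((1 + real n) powr \<sigma> * (B n)\<^sup>2))"
      unfolding B_def by (intro summable_mult weighted_majorant_summable \<rho> \<sigma>)
    have "\<forall>\<^sub>F h in at 0. h \<noteq> 0 \<and> \<bar>h\<bar> \<le> (1::real)"
      by (auto simp: eventually_at intro!: exI[of _ 1])
    then show "\<forall>\<^sub>F (n, h) in at_top \<times>\<^sub>F at 0.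
        norm ((1 + real n) powr \<sigma> * (cmod ((A (t + h) n - A t n) / of_real h - A' t n))\<^sup>2)
      \<le> 4 * ((1 + real n) powr \<sigma> * (B n)\<^sup>2)"
      unfolding eventually_prod_filter using bound
      by (intro exI[of _ "\<lambda>_. True"] exI[of _ "\<lambda>h. h \<noteq> 0 \<and> \<bar>h\<bar> \<le> 1"]) auto
  qed (use tendsto_term in auto)
  then show ?thesis by (simp add: A_def A'_def)
qed

section \<open>The turbulent orbit\<close>

lemma polar_has_vector_derivative:
  assumes "(\<rho> has_real_derivative \<rho>') (at t)" "(\<theta> has_real_derivative \<theta>') (at t)"
  shows "((\<lambda>t. of_real (\<rho> t) * cis (\<theta> t)) has_vector_derivative
    (of_real \<rho>' + \<i> * of_real \<theta>' * of_real (\<rho> t)) * cis (\<theta> t)) (at t)"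
proof -
  have \<rho>: "((\<lambda>t. complex_of_real (\<rho> t)) has_vector_derivative of_real \<rho>') (at t)"
    using assms(1) by (simp add: has_real_derivative_iff_has_vector_derivative has_vector_derivative_of_real)
  have \<theta>: "((\<lambda>t. \<i> * complex_of_real (\<theta> t)) has_vector_derivative \<i> * of_real \<theta>') (at t)"
    using assms(2)
    by (intro has_vector_derivative_mult_right has_vector_derivative_of_real)
       (simp add: has_real_derivative_iff_has_vector_derivative)
  have "((exp \<circ> (\<lambda>t. \<i> * complex_of_real (\<theta> t))) has_vector_derivative
      \<i> * of_real \<theta>' * exp (\<i> * complex_of_real (\<theta> t))) (at t)"
    by (rule field_vector_diff_chain_at[OF \<theta>]) (auto intro!: derivative_eq_intros)
  then have "((\<lambda>t. cis (\<theta> t)) has_vector_derivative \<i> * of_real \<theta>' * cis (\<theta> t)) (at t)"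
    by (simp add: o_def cis_conv_exp)
  from has_vector_derivative_mult[OF \<rho> this] show ?thesis
    by (simp add: algebra_simps)
qed

text \<open>Supplies the phases of \<open>p\<close> and \<open>c\<close>, whose angular velocities
  are explicit continuous functions of time.\<close>

lemma continuous_antiderivative:
  fixes f :: "real \<Rightarrow> real"
  assumes "continuous_on UNIV f"
  obtains F where "\<And>t. (F has_real_derivative f t) (at t)"
proof -
  have "isCont f x" for x
    using assms by (simp add: continuous_on_eq_continuous_at)
  then have "\<exists>F. \<forall>x::real. - \<infinity> < ereal x \<longrightarrow> ereal x < \<infinity> \<longrightarrow> (F has_vector_derivative f x) (at x)"
    by (intro einterval_antiderivative) auto
  then show ?thesis
    using that by (auto simp: has_real_derivative_iff_has_vector_derivative)
qed

text \<open>Time 0 is the turning point: \<open>inverse_gap \<beta> 0\<close> is the larger root 3/4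
  + sqrt (1 + \<beta>) / 4 of 4 r^2 - 6 r + 2 - \<beta> / 4. It exceeds 1 exactly because \<beta> >
  0.\<close>

definition inverse_gap :: "real \<Rightarrow> real \<Rightarrow> real" where
  "inverse_gap \<beta> t = 3 / 4 + sqrt (1 + \<beta>) / 4 * cosh (2 * sqrt \<beta> * t)"

definition inverse_gap' :: "real \<Rightarrow> real \<Rightarrow> real" where
  "inverse_gap' \<beta> t = sqrt \<beta> * sqrt (1 + \<beta>) / 2 * sinh (2 * sqrt \<beta> * t)"

lemma inverse_gap_gt_1:
  assumes "\<beta> > 0"
  shows "inverse_gap \<beta> t > 1"
proof -
  have "1 < sqrt (1 + \<beta>)" using assms by simp
  also have "\<dots> \<le> sqrt (1 + \<beta>) * cosh (2 * sqrt \<beta> * t)"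
    using assms cosh_real_ge_1[of "2 * sqrt \<beta> * t"] by (simp add: mult_le_cancel_left1)
  finally show ?thesis by (simp add: inverse_gap_def)
qed

lemma inverse_gap_derivatives:
  assumes "\<beta> > 0"
  shows "(inverse_gap \<beta> has_real_derivative inverse_gap' \<beta> t) (at t)"
    and "(inverse_gap' \<beta> has_real_derivative \<beta> * (4 * inverse_gap \<beta> t - 3)) (at t)"
    and "(inverse_gap' \<beta> t)\<^sup>2 = \<beta> * (4 * (inverse_gap \<beta> t)\<^sup>2 - 6 * inverse_gap \<beta> t + 2 - \<beta> / 4)"
proof -
  show "(inverse_gap \<beta> has_real_derivative inverse_gap' \<beta> t) (at t)"
    unfolding inverse_gap_def inverse_gap'_def by (auto intro!: derivative_eq_intros)
  have "((\<lambda>t. sqrt \<beta> * sqrt (1 + \<beta>) / 2 * sinh (2 * sqrt \<beta> * t)) has_real_derivative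
      (sqrt \<beta> * sqrt \<beta>) * (sqrt (1 + \<beta>) * cosh (2 * sqrt \<beta> * t))) (at t)"
    by (auto intro!: derivative_eq_intros)
  then show "(inverse_gap' \<beta> has_real_derivative \<beta> * (4 * inverse_gap \<beta> t - 3)) (at t)"
    using assms unfolding inverse_gap_def inverse_gap'_def by simp
  have "(inverse_gap' \<beta> t)\<^sup>2 = \<beta> * (1 + \<beta>) / 4 * (sinh (2 * sqrt \<beta> * t))\<^sup>2"
    using assms by (simp add: inverse_gap'_def power_mult_distrib power_divide)
  also have "\<dots> = \<beta> * (1 + \<beta>) / 4 * ((cosh (2 * sqrt \<beta> * t))\<^sup>2 - 1)"
    by (simp add: cosh_square_eq)
  also have "\<dots> = \<beta> * (4 * (sqrt (1 + \<beta>) / 4 * cosh (2 * sqrt \<beta> * t))\<^sup>2 - (1 + \<beta>) / 4)"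
    using assms by (simp add: power_mult_distrib power_divide algebra_simps)
  also have "sqrt (1 + \<beta>) / 4 * cosh (2 * sqrt \<beta> * t) = inverse_gap \<beta> t - 3 / 4"
    by (simp add: inverse_gap_def)
  finally show "(inverse_gap' \<beta> t)\<^sup>2 = \<beta> * (4 * (inverse_gap \<beta> t)\<^sup>2 - 6 * inverse_gap \<beta> t + 2 - \<beta> / 4)"
    by (simp add: power2_eq_square field_simps)
qed

text \<open>The three modulus identities encode momentum 1 and mass 1 + \<beta>. The energy level
  amounts to 4 Re X + 4 / r - (4 - \<beta>) / r^2 = 0, and (|p|^2)' = 2 Im X forces Im X = r' / (2
  r^2); these are \<open>XR\<close> and \<open>XI\<close>.\<close>

lemma turbulent_orbit:
  fixes \<beta> :: real
  assumes \<beta>: "\<beta> > 0"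
  defines "r \<equiv> inverse_gap \<beta>"
  obtains p b c :: "real \<Rightarrow> complex" where
    "\<And>t. p t * cnj (p t) = of_real (1 - 1 / r t)"
    "\<And>t. c t * cnj (c t) = of_real (1 / (r t)\<^sup>2)"
    "\<And>t. b t * cnj (b t) = of_real (1 + \<beta> - 1 / r t)"
    "\<And>t. (p has_vector_derivative
      - \<i> * (cnj (b t) * c t + (1 - of_real \<beta>) * c t * cnj (c t) * of_real (r t) * p t)) (at t)"
    "\<And>t. (b has_vector_derivative
      - \<i> * (b t * b t * cnj (b t) + 2 * b t * c t * cnj (c t) * of_real (r t)
        + c t * c t * cnj (c t) * (of_real (r t))\<^sup>2 * cnj (p t))) (at t)"
    "\<And>t. (c has_vector_derivative
      - \<i> * (2 * b t * cnj (b t) * c t + 2 * b t * c t * cnj (c t) * of_real (r t) * p t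
        + (1 - of_real \<beta>) * c t * c t * cnj (c t) * (of_real (r t))\<^sup>2)) (at t)"
proof -
  define r' where "r' = inverse_gap' \<beta>"
  have r1: "r t > 1" for t
    unfolding r_def by (rule inverse_gap_gt_1[OF \<beta>])
  have r0: "r t > 0" "r t \<noteq> 0" "r t - 1 > 0" "r t - 1 \<noteq> 0" "(1 + \<beta>) * r t - 1 > 0" "(1 + \<beta>) * r t - 1 \<noteq> 0" for t
    using r1[of t] \<beta> mult_strict_mono[of 1 "1 + \<beta>" 1 "r t"] by auto
  have dr: "(r has_real_derivative r' t) (at t)" 
    and dr': "(r' has_real_derivative \<beta> * (4 * r t - 3)) (at t)"
    and r'sq: "(r' t)\<^sup>2 = \<beta> * (4 * (r t)\<^sup>2 - 6 * r t + 2 - \<beta> / 4)" for t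
    unfolding r_def r'_def using inverse_gap_derivatives[OF \<beta>] by auto
  have contr: "continuous_on UNIV r"
    using dr by (meson DERIV_isCont continuous_at_imp_continuous_on)
  \<comment> \<open>\<open>X\<close> is the phase-invariant quantity \<open>cnj b * c * cnj p\<close>, prescribed by the conservation laws.\<close>
  define XR where "XR = (\<lambda>t. (- r t + (1 - \<beta> / 4)) / (r t)\<^sup>2)"
  define XI where "XI = (\<lambda>t. r' t / (2 * (r t)\<^sup>2))"
  define X where "X = (\<lambda>t. Complex (XR t) (XI t))"
  \<comment> \<open>The imaginary parts of p' / p and c' / c. Dividing the field by \<open>p\<close>
    or \<open>c\<close> leaves only moduli, \<open>X\<close> and \<open>cnj X\<close>, so both are
    functions of \<open>r\<close> alone.\<close>
  define \<phi>' where "\<phi>' = (\<lambda>t. - (XR t / (1 - 1 / r t) + (1 - \<beta>) / r t))"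
  define \<gamma>' where "\<gamma>' = (\<lambda>t. - (2 * (1 + \<beta> - 1 / r t) + 2 * XR t * r t + 1 - \<beta>))"
  have "continuous_on UNIV \<phi>'" "continuous_on UNIV \<gamma>'"
    unfolding \<phi>'_def \<gamma>'_def XR_def using r0 by (auto intro!: continuous_intros contr simp: field_simps)
  then obtain \<phi> \<gamma> where d\<phi>: "\<And>t. (\<phi> has_real_derivative \<phi>' t) (at t)"
    and d\<gamma>: "\<And>t. (\<gamma> has_real_derivative \<gamma>' t) (at t)"
    using continuous_antiderivative by metis
  define p where "p = (\<lambda>t. of_real (sqrt (1 - 1 / r t)) * cis (\<phi> t))"
  define c where "c = (\<lambda>t. of_real (1 / r t) * cis (\<gamma> t))"
  \<comment> \<open>No third integration: the invariant determines \<open>b\<close> once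
    \<open>c\<close> and \<open>p\<close> are known. The price is that the equation for
    \<open>b\<close> has to be verified by the quotient rule.\<close>
  define b where "b = (\<lambda>t. cnj (X t) / (cnj (c t) * p t))"
  have x0: "1 - 1 / r t > 0" for t using r0[of t] by (simp add: field_simps)
  have cis0: "cis a * cnj (cis a) = 1" for a
    by (simp add: cis_cnj cis_mult)
  have pp: "p t * cnj (p t) = of_real (1 - 1 / r t)" for t
  proof -
    have "p t * cnj (p t) = of_real (sqrt (1 - 1 / r t) * sqrt (1 - 1 / r t)) * (cis (\<phi> t) * cnj (cis (\<phi> t)))"
      by (simp add: p_def mult_ac del: real_sqrt_mult_self)
    moreover have "sqrt (1 - 1 / r t) * sqrt (1 - 1 / r t) = 1 - 1 / r t"
      using x0[of t] by simp
    ultimately show ?thesis by (simp only: cis0 mult_1_right)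
  qed
  have cc: "c t * cnj (c t) = of_real (1 / (r t)\<^sup>2)" for t
  proof -
    have "c t * cnj (c t) = of_real (1 / r t * (1 / r t)) * (cis (\<gamma> t) * cnj (cis (\<gamma> t)))"
      by (simp add: c_def mult_ac)
    then show ?thesis by (simp only: cis0) (simp add: power2_eq_square)
  qed
  \<comment> \<open>The compatibility condition |X|^2 = |b|^2 |c|^2 |p|^2, with the prescribed
    moduli on the right. It is precisely the first integral \<open>r'sq\<close>, and it is what
    gives \<open>b\<close> the right modulus.\<close>
  have XX: "X t * cnj (X t) = of_real ((1 + \<beta> - 1 / r t) * (1 / (r t)\<^sup>2) * (1 - 1 / r t))" for t
  proof -
    have "X t * cnj (X t) = of_real ((XR t)\<^sup>2 + (XI t)\<^sup>2)"
      by (simp add: X_def complex_eq_iff power2_eq_square)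
    also have "(XR t)\<^sup>2 + (XI t)\<^sup>2 = ((- r t + (1 - \<beta> / 4))\<^sup>2 + (r' t)\<^sup>2 / 4) / (r t) ^ 4"
      using r0(2)[of t] by (simp add: XR_def XI_def power_divide power_mult_distrib field_simps)
    also have "(- r t + (1 - \<beta> / 4))\<^sup>2 + (r' t)\<^sup>2 / 4 = ((1 + \<beta>) * r t - 1) * (r t - 1)"
      unfolding r'sq by (simp add: power2_eq_square field_simps)
    also have "((1 + \<beta>) * r t - 1) * (r t - 1) / (r t) ^ 4 = (1 + \<beta> - 1 / r t) * (1 / (r t)\<^sup>2) * (1 - 1 / r t)"
      using r0(2)[of t] by (simp add: field_simps power2_eq_square power4_eq_xxxx)
    finally show ?thesis .
  qed
  have p0: "p t \<noteq> 0" and c0: "c t \<noteq> 0" for t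
    using x0[of t] r0(1)[of t] by (auto simp: p_def c_def)
  have bb: "b t * cnj (b t) = of_real (1 + \<beta> - 1 / r t)" for t
  proof -
    have "b t * cnj (b t) = (X t * cnj (X t)) / ((c t * cnj (c t)) * (p t * cnj (p t)))"
      by (simp add: b_def mult_ac)
    also have "\<dots> = of_real ((1 + \<beta> - 1 / r t) * (1 / (r t)\<^sup>2) * (1 - 1 / r t) / (1 / (r t)\<^sup>2 * (1 - 1 / r t)))"
      unfolding XX cc pp by (simp only: of_real_mult of_real_divide)
    also have "(1 + \<beta> - 1 / r t) * (1 / (r t)\<^sup>2) * (1 - 1 / r t) / (1 / (r t)\<^sup>2 * (1 - 1 / r t)) = 1 + \<beta> - 1 / r t"
    proof -
      have "1 / (r t)\<^sup>2 * (1 - 1 / r t) \<noteq> 0" using x0[of t] r0(2)[of t] by auto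
      then show ?thesis unfolding mult.assoc by (rule nonzero_mult_div_cancel_right)
    qed
    finally show ?thesis .
  qed
  have b0: "b t \<noteq> 0" for t
  proof
    assume "b t = 0"
    then have "1 + \<beta> - 1 / r t = 0" using bb[of t] by (metis mult_zero_left of_real_eq_0_iff)
    then show False using x0[of t] \<beta> by linarith
  qed
  have bX: "cnj (b t) * c t * cnj (p t) = X t" for t
    using p0 c0 by (simp add: b_def)
  have bX': "b t * cnj (c t) * p t = cnj (X t)" for t
    using p0 c0 by (simp add: b_def)
  have Xri: "X t = of_real (XR t) + \<i> * of_real (XI t)" "cnj (X t) = of_real (XR t) - \<i> * of_real (XI t)" for t
    by (simp_all add: X_def complex_eq_iff)
  \<comment> \<open>\<open>P\<close> and \<open>C\<close> are the full logarithmic derivatives p' /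
    p and c' / c demanded by the field; their real parts must agree with the prescribed
    moduli.\<close>
  define P where "P = (\<lambda>t. - \<i> * (X t / of_real (1 - 1 / r t) + of_real ((1 - \<beta>) / r t)))"
  define C where "C = (\<lambda>t. - \<i> * (of_real (2 * (1 + \<beta> - 1 / r t) + 1 - \<beta>) + 2 * cnj (X t) * of_real (r t)))"
  have dq: "((\<lambda>t. 1 / r t) has_real_derivative - r' t / (r t)\<^sup>2) (at t)" for t
    using r0(2)[of t] by (auto intro!: derivative_eq_intros dr simp: power2_eq_square)
  have dp: "(p has_vector_derivative p t * P t) (at t)" for t
  proof -
    define x where "x = 1 - 1 / r t"
    have x: "x > 0" using x0 by (simp add: x_def)
    have "((\<lambda>t. sqrt (1 - 1 / r t)) has_real_derivative XI t / x * sqrt x) (at t)"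
    proof -
      have "((\<lambda>t. 1 - 1 / r t) has_real_derivative r' t / (r t)\<^sup>2) (at t)"
        using DERIV_diff[OF DERIV_const dq, of 1 t] by simp
      then have "((\<lambda>t. sqrt (1 - 1 / r t)) has_real_derivative inverse (sqrt x) / 2 * (r' t / (r t)\<^sup>2)) (at t)"
        unfolding x_def using DERIV_real_sqrt[OF x0] by (intro DERIV_chain2[where f = sqrt])
      moreover have "inverse (sqrt x) = sqrt x / x"
        using x by (simp add: field_simps)
      ultimately show ?thesis by (simp add: XI_def mult_ac)
    qed
    from polar_has_vector_derivative[OF this d\<phi>]
    have "(p has_vector_derivative (of_real (XI t / x * sqrt x) + \<i> * of_real (\<phi>' t) * of_real (sqrt x)) * cis (\<phi> t)) (at t)"
      unfolding p_def x_def .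
    moreover have "(of_real (XI t / x * sqrt x) + \<i> * of_real (\<phi>' t) * of_real (sqrt x)) * cis (\<phi> t) = p t * P t"
    proof -
      have "P t = of_real (XI t / x) + \<i> * of_real (\<phi>' t)"
        unfolding P_def \<phi>'_def x_def[symmetric] Xri by (simp add: algebra_simps add_divide_distrib diff_divide_distrib)
      then show ?thesis
        unfolding p_def x_def[symmetric] by (simp add: algebra_simps)
    qed
    ultimately show ?thesis by simp
  qed
  have dc: "(c has_vector_derivative c t * C t) (at t)" for t
  proof -
    have deriv: "(c has_vector_derivative (of_real (- r' t / (r t)\<^sup>2) + \<i> * of_real (\<gamma>' t) * of_real (1 / r t)) * cis (\<gamma> t)) (at t)"
      unfolding c_def by (rule polar_has_vector_derivative[OF dq d\<gamma>])
    have C_eq: "C t = of_real (- r' t / r t) + \<i> * of_real (\<gamma>' t)"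
      unfolding C_def \<gamma>'_def Xri XI_def using r0(2)[of t]
      by (simp add: field_simps power2_eq_square)
    have "(of_real (- r' t / (r t)\<^sup>2) + \<i> * of_real (\<gamma>' t) * of_real (1 / r t)) * cis (\<gamma> t) = c t * C t"
      unfolding c_def C_eq by (simp add: algebra_simps power2_eq_square)
    with deriv show ?thesis by simp
  qed
  \<comment> \<open>The real part follows from r' alone, the imaginary part needs r'' and the first
    integral. The result is arranged as a multiple of \<open>cnj X\<close> plus a function of
    \<open>r\<close>, the form in which the product rule for \<open>b\<close> can be
    compared.\<close>
  have dX: "((\<lambda>t. cnj (X t)) has_vector_derivative
      \<i> * (cnj (X t) * of_real (2 - (4 - \<beta>) / r t)
        + of_real ((2 * (1 + \<beta>) * (r t)\<^sup>2 - 3 * (2 + \<beta>) * r t + 4) / (r t) ^ 3))) (at t)" for t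
  proof -
    have "(XR has_real_derivative XI t * (2 - (4 - \<beta>) / r t)) (at t)"
      unfolding XR_def XI_def using r0(2)[of t]
      by (auto intro!: derivative_eq_intros dr simp: field_simps power2_eq_square)
    moreover have "(XI has_real_derivative - (XR t * (2 - (4 - \<beta>) / r t)
        + (2 * (1 + \<beta>) * (r t)\<^sup>2 - 3 * (2 + \<beta>) * r t + 4) / (r t) ^ 3)) (at t)"
    proof -
      have "(XI has_real_derivative (\<beta> * (4 * r t - 3) * r t / 2 - (r' t)\<^sup>2) / (r t) ^ 3) (at t)"
        unfolding XI_def using r0(2)[of t]
        by (auto intro!: derivative_eq_intros dr dr' simp: field_simps power2_eq_square power3_eq_cube)
      moreover have "(\<beta> * (4 * r t - 3) * r t / 2 - (r' t)\<^sup>2) / (r t) ^ 3 = - (XR t * (2 - (4 - \<beta>) / r t)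
        + (2 * (1 + \<beta>) * (r t)\<^sup>2 - 3 * (2 + \<beta>) * r t + 4) / (r t) ^ 3)"
        unfolding r'sq XR_def using r0(2)[of t]
        by (simp add: field_simps power2_eq_square power3_eq_cube)
      ultimately show ?thesis by simp
    qed
    ultimately have "((\<lambda>t. complex_of_real (XR t) - \<i> * of_real (XI t)) has_vector_derivative
        of_real (XI t * (2 - (4 - \<beta>) / r t)) - \<i> * of_real (- (XR t * (2 - (4 - \<beta>) / r t)
        + (2 * (1 + \<beta>) * (r t)\<^sup>2 - 3 * (2 + \<beta>) * r t + 4) / (r t) ^ 3))) (at t)"
      by (intro has_vector_derivative_diff has_vector_derivative_mult_right has_vector_derivative_of_real)
         (simp_all add: has_real_derivative_iff_has_vector_derivative)
    then show ?thesis
      unfolding Xri(2) by (rule has_vector_derivative_eq_rhs) (simp add: algebra_simps add_divide_distrib diff_divide_distrib)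
  qed
  have Pdef: "p t * P t = - \<i> * (cnj (b t) * c t + (1 - of_real \<beta>) * c t * cnj (c t) * of_real (r t) * p t)" for t
  proof -
    have "p t * X t = cnj (b t) * c t * (p t * cnj (p t))" by (simp add: bX[symmetric] mult_ac)
    then have e1: "p t * (X t / of_real (1 - 1 / r t)) = cnj (b t) * c t"
      using pp[of t] p0[of t] by (metis complex_cnj_zero_iff mult_eq_0_iff nonzero_mult_div_cancel_right times_divide_eq_right)
    have e2: "(1 - of_real \<beta>) * c t * cnj (c t) * of_real (r t) * p t = p t * of_real ((1 - \<beta>) / r t)"
    proof -
      have "(1 - of_real \<beta>) * c t * cnj (c t) * of_real (r t) * p t =
          (1 - of_real \<beta>) * (c t * cnj (c t)) * of_real (r t) * p t" by (simp add: mult_ac)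
      also have "\<dots> = p t * of_real ((1 - \<beta>) / r t)"
        unfolding cc using r0(2)[of t] by (simp add: power2_eq_square)
      finally show ?thesis .
    qed
    have "p t * (k * (A + B)) = k * (p t * A + p t * B)" for k A B
      by (simp add: algebra_simps)
    then show ?thesis unfolding P_def e2 e1[symmetric] .
  qed
  have cc1: "c t * cnj (c t) * (of_real (r t))\<^sup>2 = 1" for t
    unfolding cc using r0(2)[of t] by (simp add: of_real_power[symmetric] del: of_real_power)
  have Cdef: "c t * C t = - \<i> * (2 * b t * cnj (b t) * c t + 2 * b t * c t * cnj (c t) * of_real (r t) * p t
        + (1 - of_real \<beta>) * c t * c t * cnj (c t) * (of_real (r t))\<^sup>2)" for t
  proof -
    have e: "2 * b t * cnj (b t) * c t + 2 * b t * c t * cnj (c t) * of_real (r t) * p t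
        + (1 - of_real \<beta>) * c t * c t * cnj (c t) * (of_real (r t))\<^sup>2 =
        c t * (2 * (b t * cnj (b t)) + 2 * (b t * cnj (c t) * p t) * of_real (r t)
          + (1 - of_real \<beta>) * (c t * cnj (c t) * (of_real (r t))\<^sup>2))"
      by (simp add: algebra_simps)
    show ?thesis unfolding e bb bX' cc1 C_def by (simp add: algebra_simps)
  qed
  have db: "(b has_vector_derivative
      - \<i> * (b t * b t * cnj (b t) + 2 * b t * c t * cnj (c t) * of_real (r t)
        + c t * c t * cnj (c t) * (of_real (r t))\<^sup>2 * cnj (p t))) (at t)" for t
  proof -
    \<comment> \<open>Since b D = cnj X and D' / D = cnj C + P, the claim becomes an identity for
      (cnj X)' - cnj X (cnj C + P) in which every phase-dependent factor is \<open>X\<close> or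
      \<open>cnj X\<close>.\<close>
    define D where "D = (\<lambda>t. cnj (c t) * p t)"
    define x where "x = 1 - 1 / r t"
    define N where "N = 1 + \<beta> - 1 / r t"
    define Xd where "Xd = \<i> * (cnj (X t) * of_real (2 - (4 - \<beta>) / r t)
        + of_real ((2 * (1 + \<beta>) * (r t)\<^sup>2 - 3 * (2 + \<beta>) * r t + 4) / (r t) ^ 3))"
    have x: "x \<noteq> 0" using x0[of t] unfolding x_def by linarith
    have D0: "D t \<noteq> 0" using p0 c0 by (simp add: D_def)
    have bD: "b t * D t = cnj (X t)" using bX'[of t] by (simp add: D_def mult.assoc)
    have "((\<lambda>t. cnj (c t)) has_vector_derivative cnj (c t * C t)) (at t)"
      by (rule bounded_linear.has_vector_derivative[OF bounded_linear_cnj dc])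
    from has_vector_derivative_mult[OF this dp[of t]]
    have dD: "(D has_vector_derivative D t * (cnj (C t) + P t)) (at t)"
      unfolding D_def by (rule has_vector_derivative_eq_rhs) (simp add: algebra_simps)
    have "((inverse \<circ> D) has_vector_derivative (D t * (cnj (C t) + P t)) * - (inverse (D t) * inverse (D t))) (at t)"
      using DERIV_inverse[OF D0] by (intro field_vector_diff_chain_at dD) (simp add: power2_eq_square numeral_2_eq_2)
    from has_vector_derivative_mult[OF dX[of t, folded Xd_def] this]
    have "(b has_vector_derivative cnj (X t) * (D t * (cnj (C t) + P t) * - (inverse (D t) * inverse (D t)))
        + Xd * inverse (D t)) (at t)"
      by (simp only: b_def D_def o_def divide_inverse)
    moreover have "u * (d * e * - (inverse d * inverse d)) + v * inverse d = (v - u * e) / d"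
      if "d \<noteq> 0" for u v d e :: complex
      using that by (simp add: field_simps)
    ultimately have "(b has_vector_derivative (Xd - cnj (X t) * (cnj (C t) + P t)) / D t) (at t)"
      using D0 by metis
    moreover have "Xd - cnj (X t) * (cnj (C t) + P t) =
        - \<i> * (b t * b t * cnj (b t) + 2 * b t * c t * cnj (c t) * of_real (r t)
        + c t * c t * cnj (c t) * (of_real (r t))\<^sup>2 * cnj (p t)) * D t"
    proof -
      \<comment> \<open>Isolates |X|^2 (2 r - 1 / x), with |X|^2 = N x / r^2; this cancels the term
        that X times cnj X produces in cnj X (cnj C + P) and leaves - x / r^2.\<close>
      have R: "(2 * (1 + \<beta>) * (r t)\<^sup>2 - 3 * (2 + \<beta>) * r t + 4) / (r t) ^ 3 =
          N * (1 / (r t)\<^sup>2) * x * (2 * r t - 1 / x) - x / (r t)\<^sup>2"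
      proof -
        have e: "x * (2 * r t - 1 / x) = 2 * r t * x - 1"
          using x by (simp add: field_simps)
        have "N * (1 / (r t)\<^sup>2) * x * (2 * r t - 1 / x) - x / (r t)\<^sup>2 = (N * (2 * r t * x - 1) - x) / (r t)\<^sup>2"
          unfolding mult.assoc e by (simp add: diff_divide_distrib[symmetric])
        also have "\<dots> = (2 * (1 + \<beta>) * (r t)\<^sup>2 - 3 * (2 + \<beta>) * r t + 4) / (r t) ^ 3"
          unfolding N_def x_def using r0(2)[of t] by (simp add: field_simps power2_eq_square power3_eq_cube)
        finally show ?thesis by simp
      qed
      have Ncoef: "2 - (4 - \<beta>) / r t = 2 * N + 1 - \<beta> - (1 - \<beta>) / r t - N - 2 / r t"
        unfolding N_def using r0(2)[of t] by (simp add: field_simps)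
      have "cnj (X t) * (cnj (C t) + P t) = \<i> * (cnj (X t) * of_real (2 * N + 1 - \<beta> - (1 - \<beta>) / r t)
          + X t * cnj (X t) * of_real (2 * r t - 1 / x))"
        unfolding C_def P_def N_def[symmetric] x_def[symmetric] using x by (simp add: algebra_simps add_divide_distrib diff_divide_distrib)
      then have "Xd - cnj (X t) * (cnj (C t) + P t) =
          - \<i> * (cnj (X t) * of_real (N + 2 / r t) + of_real (x / (r t)\<^sup>2))"
        unfolding Xd_def R Ncoef XX N_def[symmetric] x_def[symmetric] by (simp add: algebra_simps)
      also have "cnj (X t) * of_real (N + 2 / r t) = (b t * cnj (b t) + 2 * (c t * cnj (c t)) * of_real (r t)) * (b t * D t)"
        unfolding bb cc bD N_def[symmetric] using r0(2)[of t] by (simp add: field_simps power2_eq_square)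
      also have "of_real (x / (r t)\<^sup>2) = (c t * cnj (c t) * (of_real (r t))\<^sup>2) * ((c t * cnj (c t)) * (p t * cnj (p t)))"
        unfolding cc1 unfolding cc pp x_def[symmetric] by simp
      finally show ?thesis by (simp add: D_def algebra_simps)
    qed
    ultimately show ?thesis using D0 by simp
  qed
  show ?thesis
    using that[of p c b] pp cc bb dp[unfolded Pdef] dc[unfolded Cdef] db by blast
qed

section \<open>Growth of Sobolev norms\<close>

lemma one_minus_le_exp: "1 - x \<le> exp (- x)" for x :: real
  using exp_ge_add_one_self[of "- x"] by simp

lemma exp_minus_le:
  fixes u :: real
  assumes "0 \<le> u" "u \<le> 1"
  shows "exp (- u) \<le> 1 - u / 2"
proof -
  have "exp (- u) = 1 / exp u" by (simp add: exp_minus inverse_eq_divide)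
  also have "\<dots> \<le> 1 / (1 + u)"
    using assms exp_ge_add_one_self[of u] by (intro divide_left_mono) auto
  also have "\<dots> \<le> 1 - u / 2"
    using assms mult_left_mono[of u 1 u] by (simp add: field_simps)
  finally show ?thesis .
qed

lemma weighted_geometric_summable:
  fixes \<sigma> r :: real
  assumes "\<sigma> > 0" "r > 1"
  shows "summable (\<lambda>m. (2 + real m) powr \<sigma> * (1 - 1 / r) ^ m)"
proof -
  have r: "0 < 1 - 1 / r" "1 - 1 / r < 1" using assms by auto
  have "summable (\<lambda>m. (1 + real (Suc m)) powr \<sigma> * (1 - 1 / r) ^ Suc m)"
    using summable_powr_geometric[OF assms(1) r]
    by (simp only: summable_Suc_iff[of "\<lambda>m. (1 + real m) powr \<sigma> * (1 - 1 / r) ^ m"])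
  from summable_mult[OF this, of "1 / (1 - 1 / r)"] show ?thesis
    using r by (simp add: mult_ac)
qed

text \<open>Bound (1 - 1/r)^m by exp (- m / r) and spend half of the exponent on the power weight,
  which costs a multiple of r^\<sigma>. The remaining geometric series has ratio at most 1 - 1 / (4
  r), hence sum at most 4 r. The factor exp 1 comes from the offset 2 in the weight.\<close>

lemma weighted_geometric_upper:
  fixes \<sigma> r :: real
  assumes \<sigma>: "\<sigma> > 0" and r: "r > 1"
  shows "(\<Sum>m. (2 + real m) powr \<sigma> * (1 - 1 / r) ^ m) \<le> 4 * exp 1 * (2 * \<sigma>) powr \<sigma> * r powr (\<sigma> + 1)"
proof -
  define q where "q = 1 / r"
  have q: "0 < q" "q < 1" using r by (auto simp: q_def)
  define e where "e = exp (- (q / 2))"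
  have e: "0 < e" "e \<le> 1 - q / 4" using exp_minus_le[of "q / 2"] q by (auto simp: e_def)
  define K where "K = (2 * \<sigma>) powr \<sigma> * r powr \<sigma> * exp 1"
  have K: "K > 0" using \<sigma> r by (simp add: K_def)
  have le: "(2 + real m) powr \<sigma> * (1 - 1 / r) ^ m \<le> K * e ^ m" for m
  proof -
    have "(2 + real m) powr \<sigma> \<le> (\<sigma> / (q / 2)) powr \<sigma> * exp (q / 2 * (2 + real m))"
      using \<sigma> q by (intro powr_le_exp) auto
    also have "(\<sigma> / (q / 2)) powr \<sigma> = (2 * \<sigma>) powr \<sigma> * r powr \<sigma>"
      using \<sigma> r by (simp add: q_def powr_mult)
    also have "exp (q / 2 * (2 + real m)) = exp q * exp (q / 2 * real m)"
      by (simp add: exp_add[symmetric] algebra_simps)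
    also have "(2 * \<sigma>) powr \<sigma> * r powr \<sigma> * (exp q * exp (q / 2 * real m)) \<le> K * exp (q / 2 * real m)"
      unfolding K_def using q \<sigma> r by (simp add: mult.assoc)
    finally have 1: "(2 + real m) powr \<sigma> \<le> K * exp (q / 2 * real m)" .
    have "(1 - 1 / r) ^ m \<le> exp (- q) ^ m"
      unfolding q_def using r by (intro power_mono one_minus_le_exp) auto
    then have 2: "(1 - 1 / r) ^ m \<le> exp (- q * real m)"
      by (simp add: exp_of_nat_mult[symmetric] mult.commute)
    have "(2 + real m) powr \<sigma> * (1 - 1 / r) ^ m \<le> (K * exp (q / 2 * real m)) * exp (- q * real m)"
      using 1 2 r K by (intro mult_mono) auto
    also have "\<dots> = K * e ^ m"
      unfolding e_def by (simp add: exp_of_nat_mult[symmetric] exp_add[symmetric] algebra_simps)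
    finally show ?thesis .
  qed
  have e1: "norm e < 1" using e q by auto
  have "(\<Sum>m. (2 + real m) powr \<sigma> * (1 - 1 / r) ^ m) \<le> (\<Sum>m. K * e ^ m)"
    by (intro suminf_le le weighted_geometric_summable assms summable_mult summable_geometric e1)
  also have "\<dots> = K * (1 / (1 - e))"
    using e1 by (simp add: suminf_mult summable_geometric suminf_geometric)
  also have "\<dots> \<le> K * (4 * r)"
  proof (intro mult_left_mono)
    have "1 / (1 - e) \<le> 1 / (q / 4)" using e q by (intro divide_left_mono) auto
    then show "1 / (1 - e) \<le> 4 * r" by (simp add: q_def)
  qed (use K in auto)
  also have "\<dots> = 4 * exp 1 * (2 * \<sigma>) powr \<sigma> * r powr (\<sigma> + 1)"
    using r by (simp add: K_def powr_add)
  finally show ?thesis .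
qed

text \<open>Keep only the terms with m at least \<open>R\<close>, about r: there the weight is at
  least r^\<sigma>, the power has lost no more than a constant factor, and the full geometric series
  after index \<open>R\<close> still sums to r.\<close>

lemma weighted_geometric_lower:
  fixes \<sigma> r :: real
  assumes \<sigma>: "\<sigma> > 0" and r: "r \<ge> 2"
  shows "exp (- 3) * r powr (\<sigma> + 1) \<le> (\<Sum>m. (2 + real m) powr \<sigma> * (1 - 1 / r) ^ m)"
proof -
  define f where "f = (\<lambda>m. (2 + real m) powr \<sigma> * (1 - 1 / r) ^ m)"
  define R where "R = nat \<lceil>r\<rceil>"
  have R: "r \<le> real R" "real R \<le> r + 1" using r by (auto simp: R_def)
  have x: "0 < 1 - 1 / r" "1 - 1 / r < 1" using r by auto
  have f: "summable f" unfolding f_def using r by (intro weighted_geometric_summable \<sigma>) auto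
  have "- (2 / r) \<le> ln (1 - 1 / r)"
  proof -
    have "- (1 / r) - 2 * (1 / r)\<^sup>2 \<le> ln (1 - 1 / r)"
      using r by (intro ln_one_minus_pos_lower_bound) auto
    moreover have "2 * (1 / r)\<^sup>2 \<le> 1 / r" using r by (simp add: power2_eq_square field_simps)
    ultimately show ?thesis by simp
  qed
  then have "exp (- (2 / r)) \<le> 1 - 1 / r"
    using x by (metis exp_le_cancel_iff exp_ln)
  then have "exp (- (2 / r)) ^ R \<le> (1 - 1 / r) ^ R" by (intro power_mono) auto
  \<comment> \<open>From R \<le> r + 1 and r \<ge> 2 follows 2 R / r \<le> 3.\<close>
  moreover have "exp (- 3) \<le> exp (- (2 / r)) ^ R"
  proof -
    have "2 * real R \<le> 3 * r" using R r by linarith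
    then have "- 3 \<le> real R * (- (2 / r))" using r by (simp add: field_simps)
    then show ?thesis by (simp only: exp_of_nat_mult[symmetric] exp_le_cancel_iff)
  qed
  ultimately have xR: "exp (- 3) \<le> (1 - 1 / r) ^ R" by linarith
  have "exp (- 3) * r powr (\<sigma> + 1) = r powr \<sigma> * exp (- 3) * r"
    using r by (simp add: powr_add)
  also have "\<dots> = (\<Sum>m. r powr \<sigma> * exp (- 3) * (1 - 1 / r) ^ m)"
    using x by (simp add: suminf_mult summable_geometric suminf_geometric)
  also have "\<dots> \<le> (\<Sum>m. f (m + R))"
  proof (intro suminf_le)
    fix m
    have "r powr \<sigma> * (exp (- 3) * (1 - 1 / r) ^ m) \<le> (2 + real (m + R)) powr \<sigma> * ((1 - 1 / r) ^ R * (1 - 1 / r) ^ m)"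
      using R r x \<sigma> by (intro mult_mono powr_mono2 xR) auto
    then show "r powr \<sigma> * exp (- 3) * (1 - 1 / r) ^ m \<le> f (m + R)"
      by (simp add: f_def power_add mult_ac)
  qed (use x f in \<open>auto intro!: summable_mult summable_geometric simp: summable_iff_shift\<close>)
  also have "\<dots> \<le> (\<Sum>m. f m)"
  proof -
    have "0 \<le> (\<Sum>m<R. f m)" unfolding f_def using x by (intro sum_nonneg) auto
    then show ?thesis using suminf_minus_initial_segment[OF f, of R] by linarith
  qed
  finally show ?thesis by (simp add: f_def)
qed

text \<open>Splitting off the constant mode shifts the weight from 1 + n to 2 + m; the rest depends
  on the jet only through \<open>r\<close>.\<close>

lemma jet_sobolev_norm_square:
  assumes "\<sigma> > 0" "r > 1" "(cmod p)\<^sup>2 = 1 - 1 / r" "(cmod c)\<^sup>2 = 1 / r\<^sup>2"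
  shows "(\<Sum>n. (1 + real n) powr \<sigma> * (cmod (jet p b c 0 n))\<^sup>2) =
    (cmod b)\<^sup>2 + (\<Sum>m. (2 + real m) powr \<sigma> * (1 - 1 / r) ^ m) / r\<^sup>2"
proof -
  have "(cmod p)\<^sup>2 < 1" using assms by simp
  then have p: "cmod p < 1" by (simp add: power_less_one_iff abs_square_less_1)
  have term_eq: "(1 + real (Suc m)) powr \<sigma> * (cmod (jet p b c 0 (Suc m)))\<^sup>2 =
      1 / r\<^sup>2 * ((2 + real m) powr \<sigma> * (1 - 1 / r) ^ m)" for m
    unfolding assms(3,4)[symmetric]
    by (simp add: norm_mult norm_power power_mult_distrib power_mult[symmetric] mult_ac)
  have "(\<Sum>n. (1 + real n) powr \<sigma> * (cmod (jet p b c 0 n))\<^sup>2) =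
      (\<Sum>m. (1 + real (Suc m)) powr \<sigma> * (cmod (jet p b c 0 (Suc m)))\<^sup>2) + (cmod b)\<^sup>2"
    using suminf_split_head[OF jet_weighted_summable[OF p assms(1), of b c 0]] by simp
  then show ?thesis
    unfolding term_eq using suminf_mult[OF weighted_geometric_summable[OF assms(1,2)], of "1 / r\<^sup>2"] by simp
qed

lemma inverse_gap_bounds:
  assumes "\<beta> > 0" "t \<ge> 0"
  shows "sqrt (1 + \<beta>) / 8 * exp (2 * sqrt \<beta> * t) \<le> inverse_gap \<beta> t"
    and "inverse_gap \<beta> t \<le> (3 / 4 + sqrt (1 + \<beta>) / 4) * exp (2 * sqrt \<beta> * t)"
proof -
  let ?E = "exp (2 * sqrt \<beta> * t)"
  have E: "1 \<le> ?E" using assms by simp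
  have cosh_le: "cosh (2 * sqrt \<beta> * t) \<le> ?E"
    using assms by (simp add: cosh_def)
  have cosh_ge: "?E / 2 \<le> cosh (2 * sqrt \<beta> * t)"
    by (simp add: cosh_def)
  have "sqrt (1 + \<beta>) / 8 * ?E = sqrt (1 + \<beta>) / 4 * (?E / 2)" by simp
  also have "\<dots> \<le> sqrt (1 + \<beta>) / 4 * cosh (2 * sqrt \<beta> * t)"
    using assms by (intro mult_left_mono cosh_ge) auto
  finally show "sqrt (1 + \<beta>) / 8 * ?E \<le> inverse_gap \<beta> t" by (simp add: inverse_gap_def)
  have "sqrt (1 + \<beta>) / 4 * cosh (2 * sqrt \<beta> * t) \<le> sqrt (1 + \<beta>) / 4 * ?E"
    using assms by (intro mult_left_mono cosh_le) auto
  then show "inverse_gap \<beta> t \<le> (3 / 4 + sqrt (1 + \<beta>) / 4) * ?E"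
    using E unfolding inverse_gap_def distrib_right by linarith
qed

text \<open>The series contributes r^(2 s + 1) / r^2 = r^(2 s - 1). As 2 s > 1 and r > 1, the
  bounded term |b|^2 is absorbed. Since r grows like exp (2 sqrt \<beta> t), the final square root
  turns this into the rate (2 s - 1) sqrt \<beta>.\<close>

lemma jet_sobolev_growth:
  assumes \<beta>: "\<beta> > 0" and s: "s > 1/2"
    and p: "\<And>t. (cmod (p t))\<^sup>2 = 1 - 1 / inverse_gap \<beta> t"
    and c: "\<And>t. (cmod (c t))\<^sup>2 = 1 / (inverse_gap \<beta> t)\<^sup>2"
    and b: "\<And>t. (cmod (b t))\<^sup>2 \<le> 1 + \<beta>"
  shows "comparable_at_top (\<lambda>t. sqrt (\<Sum>n. (1 + real n) powr (2 * s) * (cmod (jet (p t) (b t) (c t) 0 n))\<^sup>2))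
    (\<lambda>t. exp ((2 * s - 1) * sqrt \<beta> * \<bar>t\<bar>))"
proof -
  let ?r = "inverse_gap \<beta>" and ?\<sigma> = "2 * s"
  define S where "S = (\<lambda>t. \<Sum>n. (1 + real n) powr ?\<sigma> * (cmod (jet (p t) (b t) (c t) 0 n))\<^sup>2)"
  define k1 where "k1 = sqrt (1 + \<beta>) / 8"
  define k2 where "k2 = 3 / 4 + sqrt (1 + \<beta>) / 4"
  define M2 where "M2 = (1 + \<beta> + 4 * exp 1 * (2 * ?\<sigma>) powr ?\<sigma>) * k2 powr (?\<sigma> - 1)"
  define m2 where "m2 = exp (- 3) * k1 powr (?\<sigma> - 1)"
  \<comment> \<open>Chosen so that k1 exp (2 sqrt \<beta> t) \<ge> k1 * 2 sqrt \<beta> T = 2 for t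
    \<ge> T, by x \<le> exp x; the lower bound on the series requires r \<ge> 2.\<close>
  define T where "T = 1 / (k1 * sqrt \<beta>)"
  have k: "k1 > 0" "k2 > 0" using \<beta> by (auto simp: k1_def k2_def add_pos_pos)
  have r1: "?r t > 1" for t by (rule inverse_gap_gt_1[OF \<beta>])
  have S: "S t = (cmod (b t))\<^sup>2 + (\<Sum>m. (2 + real m) powr ?\<sigma> * (1 - 1 / ?r t) ^ m) / (?r t)\<^sup>2" for t
    unfolding S_def using s by (intro jet_sobolev_norm_square r1 p c) auto
  have rpow: "?r t powr (?\<sigma> + 1) / (?r t)\<^sup>2 = ?r t powr (?\<sigma> - 1)" for t
    using r1[of t] by (simp add: powr_add powr_diff power2_eq_square field_simps)
  have Epow: "exp (2 * sqrt \<beta> * t) powr (?\<sigma> - 1) = (exp ((2 * s - 1) * sqrt \<beta> * t))\<^sup>2" for t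
    by (simp add: powr_def power2_eq_square exp_add[symmetric] algebra_simps)
  have upper: "S t \<le> M2 * (exp ((2 * s - 1) * sqrt \<beta> * t))\<^sup>2" if "t \<ge> 0" for t
  proof -
    have "(\<Sum>m. (2 + real m) powr ?\<sigma> * (1 - 1 / ?r t) ^ m) / (?r t)\<^sup>2
        \<le> 4 * exp 1 * (2 * ?\<sigma>) powr ?\<sigma> * ?r t powr (?\<sigma> + 1) / (?r t)\<^sup>2"
      using s by (intro divide_right_mono weighted_geometric_upper r1) auto
    also have "\<dots> = 4 * exp 1 * (2 * ?\<sigma>) powr ?\<sigma> * ?r t powr (?\<sigma> - 1)"
      using rpow[of t] by (simp only: times_divide_eq_right[symmetric])
    finally have "S t \<le> (1 + \<beta>) + 4 * exp 1 * (2 * ?\<sigma>) powr ?\<sigma> * ?r t powr (?\<sigma> - 1)"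
      unfolding S using b[of t] by linarith
    moreover have "(1 + \<beta>) * 1 \<le> (1 + \<beta>) * ?r t powr (?\<sigma> - 1)"
      using r1[of t] s \<beta> by (intro mult_left_mono ge_one_powr_ge_zero) auto
    ultimately have "S t \<le> (1 + \<beta> + 4 * exp 1 * (2 * ?\<sigma>) powr ?\<sigma>) * ?r t powr (?\<sigma> - 1)"
      by (simp add: distrib_right)
    also have "\<dots> \<le> (1 + \<beta> + 4 * exp 1 * (2 * ?\<sigma>) powr ?\<sigma>) * (k2 * exp (2 * sqrt \<beta> * t)) powr (?\<sigma> - 1)"
      using inverse_gap_bounds(2)[OF \<beta> that] r1[of t] s \<beta> k2_def
      by (intro mult_left_mono powr_mono2) (auto intro!: add_nonneg_nonneg)
    also have "\<dots> = M2 * (exp ((2 * s - 1) * sqrt \<beta> * t))\<^sup>2"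
      using k by (simp add: M2_def powr_mult Epow)
    finally show ?thesis .
  qed
  have lower: "m2 * (exp ((2 * s - 1) * sqrt \<beta> * t))\<^sup>2 \<le> S t" if "t \<ge> T" for t
  proof -
    have T0: "T \<ge> 0" unfolding T_def using k \<beta> by simp
    have t: "t \<ge> 0" using T0 that by linarith
    have kE: "k1 * exp (2 * sqrt \<beta> * t) \<le> ?r t"
      using inverse_gap_bounds(1)[OF \<beta> t] by (simp add: k1_def)
    have "2 = k1 * (2 * sqrt \<beta> * T)" using k \<beta> by (simp add: T_def)
    also have "\<dots> \<le> k1 * exp (2 * sqrt \<beta> * t)"
    proof (intro mult_left_mono)
      have "2 * sqrt \<beta> * T \<le> 2 * sqrt \<beta> * t" using that \<beta> by (intro mult_left_mono) auto
      also have "\<dots> \<le> exp (2 * sqrt \<beta> * t)" using exp_ge_add_one_self[of "2 * sqrt \<beta> * t"] by linarith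
      finally show "2 * sqrt \<beta> * T \<le> exp (2 * sqrt \<beta> * t)" .
    qed (use k in auto)
    finally have r2: "?r t \<ge> 2" using kE by linarith
    have "m2 * (exp ((2 * s - 1) * sqrt \<beta> * t))\<^sup>2 = exp (- 3) * (k1 * exp (2 * sqrt \<beta> * t)) powr (?\<sigma> - 1)"
      using k by (simp add: m2_def powr_mult Epow)
    also have "\<dots> \<le> exp (- 3) * ?r t powr (?\<sigma> - 1)"
      using kE k s by (intro mult_left_mono powr_mono2) auto
    also have "\<dots> = exp (- 3) * ?r t powr (?\<sigma> + 1) / (?r t)\<^sup>2"
      using rpow[of t] by (simp only: times_divide_eq_right[symmetric])
    also have "\<dots> \<le> (\<Sum>m. (2 + real m) powr ?\<sigma> * (1 - 1 / ?r t) ^ m) / (?r t)\<^sup>2"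
      using s by (intro divide_right_mono weighted_geometric_lower r2) auto
    also have "\<dots> \<le> S t" unfolding S by simp
    finally show ?thesis .
  qed
  have m2: "m2 > 0" using k by (simp add: m2_def)
  have "comparable_at_top (\<lambda>t. sqrt (S t)) (\<lambda>t. exp ((2 * s - 1) * sqrt \<beta> * \<bar>t\<bar>))"
    unfolding comparable_at_top_def
  proof (rule exI[of _ "sqrt m2"], rule exI[of _ "sqrt (max m2 M2)"], rule exI[of _ "max 0 T"], intro conjI allI impI)
    fix t assume t: "max 0 T \<le> t"
    let ?g = "exp ((2 * s - 1) * sqrt \<beta> * \<bar>t\<bar>)"
    have "sqrt m2 * ?g = sqrt (m2 * ?g\<^sup>2)" by (simp add: real_sqrt_mult)
    also have "\<dots> \<le> sqrt (S t)" using lower[of t] t by (intro real_sqrt_le_mono) auto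
    finally show "sqrt m2 * ?g \<le> sqrt (S t)" .
    have "M2 * ?g\<^sup>2 \<le> max m2 M2 * ?g\<^sup>2" by (intro mult_right_mono) auto
    moreover have "S t \<le> M2 * ?g\<^sup>2" using upper[of t] t by simp
    ultimately have "sqrt (S t) \<le> sqrt (max m2 M2 * ?g\<^sup>2)" by (intro real_sqrt_le_mono) linarith
    also have "\<dots> = sqrt (max m2 M2) * ?g" by (simp add: real_sqrt_mult)
    finally show "sqrt (S t) \<le> sqrt (max m2 M2) * ?g" .
  qed (use m2 in auto)
  then show ?thesis by (simp only: S_def)
qed

section \<open>Rational initial data and the conclusion\<close>

lemma rational_jet_mem_L1:
  assumes p: "p \<noteq> 0" "cmod p < 1" and c: "c \<noteq> 0"
  shows "(\<lambda>z. poly [:b, c - b * p:] z / poly [:1, - p:] z) \<in> rational_L1"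
  unfolding rational_L1_def mem_Collect_eq
proof (rule exI[of _ "[:b, c - b * p:]"], rule exI[of _ "[:1, - p:]"], intro conjI allI impI)
  show "coprime [:b, c - b * p:] [:1, - p:]"
  proof (rule coprimeI)
    fix d assume d: "d dvd [:b, c - b * p:]" "d dvd [:1, - p:]"
    have "d dvd [:p / c:] * ([:b, c - b * p:] - [:b:] * [:1, - p:]) + [:1, - p:]"
      by (intro dvd_add dvd_mult dvd_diff d)
    also have "[:p / c:] * ([:b, c - b * p:] - [:b:] * [:1, - p:]) + [:1, - p:] = 1"
      using c by (simp add: one_pCons)
    finally show "is_unit d" .
  qed
  fix z :: complex assume "cmod z \<le> 1"
  then have "cmod (p * z) < 1"
    using p(2) mult_left_mono[of "cmod z" 1 "cmod p"] unfolding norm_mult by auto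
  then have "p * z \<noteq> 1" by auto
  then show "poly [:1, - p:] z \<noteq> 0" by (simp add: mult.commute)
qed (use p in auto)

theorem mainTheorem10:
  fixes \<beta> :: real
  assumes "\<beta> > 0"
  shows "\<exists>u0 \<in> rational_L1.
    (\<exists>u. \<forall>s > 1/2. beta_szego_solution s \<beta> u0 u) \<and>
    (\<exists>c > 0. \<forall>s > 1/2. \<forall>u. beta_szego_solution s \<beta> u0 u \<longrightarrow>
       comparable_at_top (\<lambda>t. sobolev_norm s (u t)) (\<lambda>t. exp ((2 * s - 1) * c * \<bar>t\<bar>)))"
proof -
  define r where "r = inverse_gap \<beta>"
  have r1: "r t > 1" for t unfolding r_def by (rule inverse_gap_gt_1[OF assms])
  obtain p b c :: "real \<Rightarrow> complex" where
    pp: "\<And>t. p t * cnj (p t) = of_real (1 - 1 / r t)" and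
    cc: "\<And>t. c t * cnj (c t) = of_real (1 / (r t)\<^sup>2)" and
    bb: "\<And>t. b t * cnj (b t) = of_real (1 + \<beta> - 1 / r t)" and
    dp: "\<And>t. (p has_vector_derivative
      - \<i> * (cnj (b t) * c t + (1 - of_real \<beta>) * c t * cnj (c t) * of_real (r t) * p t)) (at t)" and
    db: "\<And>t. (b has_vector_derivative
      - \<i> * (b t * b t * cnj (b t) + 2 * b t * c t * cnj (c t) * of_real (r t)
        + c t * c t * cnj (c t) * (of_real (r t))\<^sup>2 * cnj (p t))) (at t)" and
    dc: "\<And>t. (c has_vector_derivative
      - \<i> * (2 * b t * cnj (b t) * c t + 2 * b t * c t * cnj (c t) * of_real (r t) * p t
        + (1 - of_real \<beta>) * c t * c t * cnj (c t) * (of_real (r t))\<^sup>2)) (at t)"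
    by (rule turbulent_orbit[OF assms, folded r_def]) (rule that, assumption+)
  have psq: "(cmod (p t))\<^sup>2 = 1 - 1 / r t" and csq: "(cmod (c t))\<^sup>2 = 1 / (r t)\<^sup>2"
    and bsq: "(cmod (b t))\<^sup>2 = 1 + \<beta> - 1 / r t" for t
    using pp[of t] cc[of t] bb[of t] by (simp_all only: complex_norm_square[symmetric] of_real_eq_iff)
  have "(cmod (p t))\<^sup>2 < 1" for t using psq[of t] r1[of t] by simp
  then have p1: "cmod (p t) < 1" for t by (simp add: abs_square_less_1)
  have nz: "p 0 \<noteq> 0" "c 0 \<noteq> 0"
    using psq[of 0] csq[of 0] r1[of 0] by auto
  define A where "A = (\<lambda>t. jet (p t) (b t) (c t) 0)"
  \<comment> \<open>Membership in \<open>rational_L1\<close> is equality of functions on the whole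
    plane, whereas the series represents the rational function on the circle; hence the quotient
    itself is taken as datum.\<close>
  define u0 where "u0 = (\<lambda>z. poly [:b 0, c 0 - b 0 * p 0:] z / poly [:1, - p 0:] z)"
  have u0: "u0 z = hseries (A 0) z" if z: "cmod z = 1" for z
  proof -
    have "cmod (p 0 * z) < 1" using p1[of 0] z by (simp add: norm_mult)
    then have "p 0 * z \<noteq> 1" by auto
    then show ?thesis
      unfolding A_def u0_def hseries_jet[OF p1 z] by (simp add: field_simps)
  qed
  have u0_meas: "u0 \<in> borel_measurable circle_measure"
    by (subst measurable_cong[where g = "hseries (A 0)"]) (auto simp: u0)
  have field: "szego_field \<beta> (A t) = jet (p t)
      (- \<i> * (b t * b t * cnj (b t) + 2 * b t * c t * cnj (c t) * of_real (r t)
        + c t * c t * cnj (c t) * (of_real (r t))\<^sup>2 * cnj (p t)))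
      (- \<i> * (2 * b t * cnj (b t) * c t + 2 * b t * c t * cnj (c t) * of_real (r t) * p t
        + (1 - of_real \<beta>) * c t * c t * cnj (c t) * (of_real (r t))\<^sup>2))
      (c t * (- \<i> * (cnj (b t) * c t + (1 - of_real \<beta>) * c t * cnj (c t) * of_real (r t) * p t)))" for t
    unfolding A_def
  proof (rule szego_field_jet[OF p1])
    show "of_real (r t) * (1 - p t * cnj (p t)) = 1"
      unfolding pp using r1[of t] by simp
  qed
  have contr: "continuous_on UNIV r"
    unfolding r_def using inverse_gap_derivatives(1)[OF assms]
    by (meson DERIV_isCont continuous_at_imp_continuous_on)
  have cont: "continuous_on UNIV p" "continuous_on UNIV b" "continuous_on UNIV c"
    using dp db dc by (auto intro!: continuous_at_imp_continuous_on intro: has_vector_derivative_continuous)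
  have sol: "beta_szego_solution s \<beta> u0 (\<lambda>t. hseries (A t))" if s: "s > 1/2" for s
  proof (rule beta_szego_solution_hseries[OF s])
    fix t
    show "summable (\<lambda>n. (1 + real n) powr (2 * s) * (cmod (A t n))\<^sup>2)"
      unfolding A_def using s by (intro jet_weighted_summable p1) auto
    show "summable (\<lambda>n. (1 + real n) powr (2 * s) * (cmod (szego_field \<beta> (A t) n))\<^sup>2)"
      unfolding field using s by (intro jet_weighted_summable p1) auto
    show "((\<lambda>h. \<Sum>n. (1 + real n) powr (2 * s) *
      (cmod ((A (t + h) n - A t n) / of_real h - szego_field \<beta> (A t) n))\<^sup>2) \<longlongrightarrow> 0) (at 0)"
      unfolding field unfolding A_def using s
      by (intro jet_curve_sobolev_derivative dp db dc p1 continuous_intros cont contr) auto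
  qed (use u0 in auto)
  \<comment> \<open>An arbitrary solution \<open>u\<close> in some H^s is compared with the explicit
    one, which is a solution for that same s; the uniqueness argument runs forward in time from t =
    0.\<close>
  have coeff: "fourier_coeff (u t) (int n) = A t n"
    if s: "s > 1/2" and u: "beta_szego_solution s \<beta> u0 u" and t: "t \<ge> 0" for s u t n
  proof -
    have A: "fourier_coeff (hseries (A t)) (int n) = A t n" for t n
      unfolding A_def by (simp add: fourier_coeff_hseries jet_l1 p1)
    have "(\<lambda>t n. fourier_coeff (u t) (int n)) t = (\<lambda>t n. fourier_coeff (hseries (A t)) (int n)) t"
    proof (rule szego_coefficients_unique[OF _ _ _ _ _ t])
      show "(\<lambda>n. fourier_coeff (u 0) (int n)) = (\<lambda>n. fourier_coeff (hseries (A 0)) (int n))"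
        using beta_szego_solution_coeff(3)[OF s u u0_meas] beta_szego_solution_coeff(3)[OF s sol[OF s] u0_meas] by simp
    qed (rule beta_szego_solution_coeff(1,2)[OF s u] beta_szego_solution_coeff(1,2)[OF s sol[OF s]])+
    then show ?thesis using A by (metis (no_types))
  qed
  have growth: "comparable_at_top (\<lambda>t. sobolev_norm s (u t)) (\<lambda>t. exp ((2 * s - 1) * sqrt \<beta> * \<bar>t\<bar>))"
    if s: "s > 1/2" and u: "beta_szego_solution s \<beta> u0 u" for s u
  proof -
    have "comparable_at_top (\<lambda>t. sqrt (\<Sum>n. (1 + real n) powr (2 * s) * (cmod (A t n))\<^sup>2))
      (\<lambda>t. exp ((2 * s - 1) * sqrt \<beta> * \<bar>t\<bar>))"
      unfolding A_def
    proof (rule jet_sobolev_growth[OF assms s psq[unfolded r_def] csq[unfolded r_def]])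
      show "(cmod (b t))\<^sup>2 \<le> 1 + \<beta>" for t using bsq[of t] r1[of t] by simp
    qed
    then obtain m M T where mM: "0 < m" "m \<le> M" and
      bounds: "\<And>t. t \<ge> T \<Longrightarrow>
        m * exp ((2 * s - 1) * sqrt \<beta> * \<bar>t\<bar>) \<le> sqrt (\<Sum>n. (1 + real n) powr (2 * s) * (cmod (A t n))\<^sup>2) \<and>
        sqrt (\<Sum>n. (1 + real n) powr (2 * s) * (cmod (A t n))\<^sup>2) \<le> M * exp ((2 * s - 1) * sqrt \<beta> * \<bar>t\<bar>)"
      unfolding comparable_at_top_def by blast
    have norm_eq: "sobolev_norm s (u t) = sqrt (\<Sum>n. (1 + real n) powr (2 * s) * (cmod (A t n))\<^sup>2)" if "t \<ge> 0" for t
      unfolding sobolev_norm_def by (simp add: coeff[OF s u that])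
    \<comment> \<open>The threshold is raised to at least 0 because the coefficients of
      \<open>u\<close> have been identified only for t \<ge> 0.\<close>
    have "\<forall>t\<ge>max 0 T. m * exp ((2 * s - 1) * sqrt \<beta> * \<bar>t\<bar>) \<le> sobolev_norm s (u t) \<and>
        sobolev_norm s (u t) \<le> M * exp ((2 * s - 1) * sqrt \<beta> * \<bar>t\<bar>)"
    proof (intro allI impI)
      fix t assume "t \<ge> max 0 T"
      then have t: "t \<ge> 0" "t \<ge> T" by auto
      show "m * exp ((2 * s - 1) * sqrt \<beta> * \<bar>t\<bar>) \<le> sobolev_norm s (u t) \<and>
          sobolev_norm s (u t) \<le> M * exp ((2 * s - 1) * sqrt \<beta> * \<bar>t\<bar>)"
        unfolding norm_eq[OF t(1)] by (rule bounds[OF t(2)])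
    qed
    then show ?thesis
      unfolding comparable_at_top_def using mM by blast
  qed
  have "u0 \<in> rational_L1"
    unfolding u0_def by (rule rational_jet_mem_L1[OF nz(1) p1 nz(2)])
  moreover have "sqrt \<beta> > 0" using assms by simp
  ultimately show ?thesis
    using sol growth by blast
qed

end
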